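(* For a given ribbon graph $G$, both the graded partial-dual genus polynomial ${}^{\partial}\tilde\varepsilon_G(w,z)$ and the partial-dual genus polynomial ${}^{\partial}\varepsilon_G(z)$ can be recovered from the graded Euler characteristic of the cohomology groups $H^*(G)$.
   Context: **Ribbon graphs.** A ribbon graph $G$ is a (not necessarily orientable or connected) surface with nonempty boundary that is a union of finitely many disjoint vertex-disks (set $V(G)$) and finitely many disjoint edge-ribbons (set $E(G)$), such that vertex-disks and edge-ribbons meet in disjoint line segments, each such segment lies on the boundary of exactly one vertex-disk and exactly one edge-ribbon, and each edge-ribbon contains exactly two such segments. $F(G)$ is the set of face-disks, equivalently the set of boundary components of $G$; $c(G)$ is the number of connected components; $n=|E(G)|$. The Euler genus is $\varepsilon(G)=2c(G)-|V(G)|+|E(G)|-|F(G)|$ (for connected $G$: twice the genus, resp. the crosscap number, of the closed surface obtained by capping off the boundary components, if this surface is orientable, resp. non-orientable). A subset $A\subseteq E(G)$ is also regarded as the spanning ribbon subgraph with all vertex-disks of $G$ and the edge-ribbons in $A$; $F(A)$ is its set of face-disks (boundary circles); $A^c=E(G)\setminus A$. **Partial dual and polynomials.** For $A\subseteq E(G)$, the partial dual $G^A$ is obtained by gluing a disk to each boundary component of the spanning subgraph $A$ and removing the interiors of all vertex-disks of $G$; the newly glued disks are the vertex-disks of $G^A$ and the edge-ribbons are those of $G$ (ribbons not in $A$ keep their attaching segments; ribbons in $A$ are now attached along their other two sides). The partial-dual genus polynomial is ${}^{\partial}\varepsilon_G(z)=\sum_{A\subseteq E(G)}z^{\varepsilon(G^A)}$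 and the graded partial-dual genus polynomial is ${}^{\partial}\tilde\varepsilon_G(w,z)=\sum_{A\subseteq E(G)}w^{|A|}z^{\varepsilon(G^A)}$. **Cubes.** Fix an ordering of $E(G)$, so that subsets $A\subseteq E(G)$ correspond to elements of $\{0,1\}^n$ ($1$ means the edge is included). $A,B$ satisfy the edge condition if $B$ is obtained from $A$ by replacing one $0$ with $1$. An algebraic $n$-cube assigns a module to each $A\in\{0,1\}^n$ and a linear map from the module at $A$ to the module at $B$ to each pair $A,B$ satisfying the edge condition. The tensor product of cubes is taken vertexwise and edgewise. All tensor products of modules and maps in the cubes are over $\mathbb{Z}[\sqrt3]$. **Algebras.** $M=\mathbb{Z}[\sqrt3,x]/\langle x^3\rangle$ with $\deg 1=1$, $\deg x=0$, $\deg x^2=-1$, multiplication $m$, comultiplication $\Delta(1)=1\otimes x^2+x\otimes x+x^2\otimes 1$, $\Delta(x)=x\otimes x^2+x^2\otimes x$, $\Delta(x^2)=x^2\otimes x^2$, and half genus map $h(a)=\sqrt3\,x\,a$. $N=\mathbb{Z}[\sqrt3,y]/\langle y^2\rangle$ with $\deg 1=0$, $\deg y=1$, and unit map $u:\mathbb{Z}[\sqrt3]\to N$, $1\mapsto 1$. **The four cubes of $G$.** For $A,B$ satisfying the edge condition: - $S$-cube: $S_A=\mathbb{Z}[\sqrt3]$; $s_A^B$ is multiplication by $(-1)^{m_A^B}$, where $m_A^B$ is the number of $1$'s of $A$ standing before the position that is $0$ in $A$ and $1$ in $B$. - $F$-cube: $F_A=N^{\otimes |A|}$; $f_A^B=u\otimes\mathrm{Id}_N^{\otimes|A|}$.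 - $V$-cube: $V_A=M^{\otimes F(A)}$ (one factor for each element of $F(A)$). If $|F(B)|=|F(A)|-1$, adding the new edge-ribbon merges two boundary circles and $v_A^B$ is $m$ on their two factors; if $|F(B)|=|F(A)|+1$, it splits one circle into two and $v_A^B$ is $\Delta$ on its factor; if $|F(B)|=|F(A)|$, it turns one circle into another and $v_A^B$ is $h$ on its factor; in each case it is the identity on the factors of all other circles. - $W$-cube: $W_A=M^{\otimes F(A^c)}$; $w_A^B$ is defined by the same rule applied to the change of boundary circles from $A^c$ to $B^c$ ($m$, $\Delta$, $h$ according to $|F(B^c)|-|F(A^c)|=-1,+1,0$). The partial dual cube is $(Cube(G),d)=(S,s)\otimes(F,f)\otimes(V,v)\otimes(W,w)$. **Bi-grading and complex.** A homogeneous tensor in a vertex space of $Cube(G)$ has bi-degree (sum of degrees of its $N$-factors, sum of degrees of its $M$-factors). For a bi-graded $\mathbb{Z}[\sqrt3]$-module $\mathcal M=\oplus_{m,k}\mathcal M_{m,k}$, $\mathrm{qdim}\,\mathcal M=\sum_{m,k}p^mq^k\dim_{\mathbb R}(\mathcal M_{m,k}\otimes\mathbb R)$, and $\mathcal M\{l\}_{m,k}=\mathcal M_{m,k+l}$. The partial dual cochain complex $(C(G),\partial)$ has $C^i(G)=\oplus_{|A|=i}Cube(G)_A\{-2i\}$ and $\partial^i=\sum d_A^B$, summed over pairs $A,B$ with $|A|=i$, $|B|=i+1$ satisfying the edge condition; $H^*(G)$ is its bi-graded cohomology. The graded Euler characteristic of the cohomology groups $H^*(G)$ is $\chi_q(C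)=\sum_{i=0}^{|E(G)|}(-1)^i\,\mathrm{qdim}\,H^i(G)$.
   Formalization: The polynomials are recovered from the graded Euler characteristic together with the number c(G) of connected components; without c(G) this fails (two disjoint twisted loops and the two-edge path have equal Euler characteristic but different polynomials). *)

theory Defs
  imports
    Complex_Main
    "HOL-Algebra.Module"
    "HOL-Algebra.AbelCoset"
    "HOL-Library.Poly_Mapping"
    "HOL-Library.Product_Plus"
    "HOL-Library.FuncSet"
begin

section \<open>Ribbon graphs\<close>

text \<open>
  A ribbon graph is recorded by its vertex-disks, its edge-ribbons and the way they are glued.
  An edge-ribbon \<open>e\<close> is a rectangle whose corners are \<open>(e, i, j)\<close> with bits \<open>i\<close> and \<open>j\<close>:
  the side joining \<open>(e, i, False)\<close> to \<open>(e, i, True)\<close> is the \<open>i\<close>-th attaching segment, and the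
  side joining \<open>(e, False, j)\<close> to \<open>(e, True, j)\<close> is the \<open>j\<close>-th free side. The boundary circle
  of a vertex-disk that meets some ribbon consists, alternately, of attaching segments and of arcs
  between consecutive segments; \<open>arc G\<close> sends a corner to the other end of the arc that starts
  there, and \<open>disk_at G c\<close> is the vertex-disk whose boundary carries the corner \<open>c\<close>.
  No orientation is imposed, so orientable and non-orientable surfaces are both covered.
\<close>

type_synonym 'e corner = "'e \<times> bool \<times> bool"

record ('e, 'v) rgraph =
  verts :: "'v set"
  edges :: "'e set"
  arc :: "'e corner \<Rightarrow> 'e corner"
  disk_at :: "'e corner \<Rightarrow> 'v"

definition corners :: "('e, 'v) rgraph \<Rightarrow> 'e corner set" where
  "corners G = edges G \<times> UNIV"

fun along_segment :: "'e corner \<Rightarrow> 'e corner" where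
  "along_segment (e, i, j) = (e, i, \<not> j)"

fun along_free_side :: "'e corner \<Rightarrow> 'e corner" where
  "along_free_side (e, i, j) = (e, \<not> i, j)"

text \<open>
  The boundary of the spanning subgraph \<open>A\<close> runs through the arcs, along the free sides of the
  ribbons in \<open>A\<close>, and along the (now unoccupied) attaching segments of the ribbons not in \<open>A\<close>.
  For \<open>A = {}\<close> these are the boundaries of the vertex-disks.
\<close>

definition boundary_steps :: "('e, 'v) rgraph \<Rightarrow> 'e set \<Rightarrow> 'e corner rel" where
  "boundary_steps G A =
     {(c, arc G c) | c. c \<in> corners G} \<union>
     {(c, if fst c \<in> A then along_free_side c else along_segment c) | c. c \<in> corners G}"

locale ribbon_graph =
  fixes G :: "('e, 'v) rgraph"
  assumes finite_verts: "finite (verts G)"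
    and finite_edges: "finite (edges G)"
    and arc_closed: "c \<in> corners G \<Longrightarrow> arc G c \<in> corners G"
    and arc_arc: "c \<in> corners G \<Longrightarrow> arc G (arc G c) = c"
    and arc_neq: "c \<in> corners G \<Longrightarrow> arc G c \<noteq> c"
    and disk_at_closed: "c \<in> corners G \<Longrightarrow> disk_at G c \<in> verts G"
    \<comment> \<open>each vertex-disk has exactly one boundary circle\<close>
    and disk_at_eq_iff: "c \<in> corners G \<Longrightarrow> c' \<in> corners G \<Longrightarrow>
      disk_at G c = disk_at G c' \<longleftrightarrow> (c, c') \<in> (boundary_steps G {})\<^sup>*"

text \<open>
  A boundary circle of the spanning subgraph \<open>A\<close> is either the boundary of a vertex-disk that
  meets no ribbon of \<open>G\<close> (\<open>Inl\<close>), or it is identified with the set of corners on it (\<open>Inr\<close>).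
\<close>

type_synonym ('e, 'v) circle = "'v + 'e corner set"

definition face_disks :: "('e, 'v) rgraph \<Rightarrow> 'e set \<Rightarrow> ('e, 'v) circle set" where
  "face_disks G A =
     Inl ` (verts G - disk_at G ` corners G) \<union> Inr ` (corners G // (boundary_steps G A)\<^sup>*)"

definition components :: "('e, 'v) rgraph \<Rightarrow> 'v set set" where
  "components G =
     verts G // {(disk_at G c, disk_at G (along_free_side c)) | c. c \<in> corners G}\<^sup>*"

definition num_components :: "('e, 'v) rgraph \<Rightarrow> nat" where
  "num_components G = card (components G)"

definition euler_genus :: "('e, 'v) rgraph \<Rightarrow> int" where
  "euler_genus G =
     2 * int (num_components G) - int (card (verts G)) + int (card (edges G))
       - int (card (face_disks G (edges G)))"

text \<open>
  In the partial dual the ribbons in \<open>A\<close> are attached along their former free sides, so the two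
  bits of their corners change roles; the arcs between ribbons are the same as in \<open>G\<close>.
\<close>

definition dual_corner :: "'e set \<Rightarrow> 'e corner \<Rightarrow> 'e corner" where
  "dual_corner A = (\<lambda>(e, i, j). if e \<in> A then (e, j, i) else (e, i, j))"

definition partial_dual :: "('e, 'v) rgraph \<Rightarrow> 'e set \<Rightarrow> ('e, ('e, 'v) circle) rgraph" where
  "partial_dual G A =
     \<lparr>verts = face_disks G A,
      edges = edges G,
      arc = dual_corner A \<circ> arc G \<circ> dual_corner A,
      disk_at = (\<lambda>c. Inr ((boundary_steps G A)\<^sup>* `` {dual_corner A c}))\<rparr>"

text \<open>
  Laurent polynomials with integer coefficients, as finitely supported coefficient families.
  The partial-dual genus polynomials are regarded as Laurent polynomials as well, so that the
  integer \<open>euler_genus\<close> can be used as an exponent without truncation.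
\<close>

type_synonym laurent1 = "int \<Rightarrow>\<^sub>0 int"
type_synonym laurent2 = "int \<times> int \<Rightarrow>\<^sub>0 int"

definition pd_genus_poly :: "('e, 'v) rgraph \<Rightarrow> laurent1" where
  "pd_genus_poly G =
     (\<Sum>A\<in>Pow (edges G). Poly_Mapping.single (euler_genus (partial_dual G A)) 1)"

definition graded_pd_genus_poly :: "('e, 'v) rgraph \<Rightarrow> laurent2" where
  "graded_pd_genus_poly G =
     (\<Sum>A\<in>Pow (edges G).
        Poly_Mapping.single (int (card A), euler_genus (partial_dual G A)) 1)"


section \<open>Modules\<close>

definition Zsqrt3 :: "real set" where
  "Zsqrt3 = {of_int a + of_int b * sqrt 3 | a b. True}"

definition real_subring :: "real set \<Rightarrow> real ring" where
  "real_subring S = \<lparr>carrier = S, monoid.mult = (*), one = 1, ring.zero = 0, add = (+)\<rparr>"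

text \<open>
  The free module on \<open>X\<close> over a subring \<open>S\<close> of the reals. The fields \<open>mult\<close> and \<open>one\<close> of a module
  record carry no meaning here and below.
\<close>

definition free_module :: "real set \<Rightarrow> 'b set \<Rightarrow> (real, 'b \<Rightarrow> real) module" where
  "free_module S X =
     \<lparr>carrier = {f. range f \<subseteq> S \<and> finite {b. f b \<noteq> 0} \<and> {b. f b \<noteq> 0} \<subseteq> X},
      monoid.mult = undefined, one = undefined,
      ring.zero = (\<lambda>_. 0), add = (\<lambda>f g b. f b + g b), smult = (\<lambda>a f b. a * f b)\<rparr>"

definition quotient_module :: "('r, 'a) module \<Rightarrow> 'a set \<Rightarrow> ('r, 'a set) module" where
  "quotient_module M B =
     \<lparr>carrier = a_rcosets\<^bsub>M\<^esub> B,
      monoid.mult = undefined, one = undefined,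
      ring.zero = B, add = set_add M,
      smult = (\<lambda>a X. \<Union>x\<in>X. B +>\<^bsub>M\<^esub> (a \<odot>\<^bsub>M\<^esub> x))\<rparr>"

definition submodule_span :: "('r, 'm) ring_scheme \<Rightarrow> ('r, 'a) module \<Rightarrow> 'a set \<Rightarrow> 'a set" where
  "submodule_span R M X = \<Inter>{H. submodule H R M \<and> X \<subseteq> H}"

text \<open>
  \<open>M \<otimes> \<real>\<close> over \<open>Zsqrt3\<close>: the real vector space generated by symbols \<open>x \<otimes> 1\<close> for \<open>x\<close> in \<open>M\<close>,
  subject to additivity and to \<open>(a x) \<otimes> 1 = a (x \<otimes> 1)\<close> for \<open>a\<close> in \<open>Zsqrt3\<close>.
\<close>

definition tensor_generator :: "'a \<Rightarrow> 'a \<Rightarrow> real" where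
  "tensor_generator x = (\<lambda>y. of_bool (y = x))"

definition tensor_relations :: "(real, 'a) module \<Rightarrow> ('a \<Rightarrow> real) set" where
  "tensor_relations M =
     {\<lambda>t. tensor_generator (x \<oplus>\<^bsub>M\<^esub> y) t - tensor_generator x t - tensor_generator y t
        | x y. x \<in> carrier M \<and> y \<in> carrier M} \<union>
     {\<lambda>t. tensor_generator (a \<odot>\<^bsub>M\<^esub> x) t - a * tensor_generator x t
        | a x. a \<in> Zsqrt3 \<and> x \<in> carrier M}"

definition tensor_reals :: "(real, 'a) module \<Rightarrow> (real, ('a \<Rightarrow> real) set) module" where
  "tensor_reals M =
     (let F = free_module UNIV (carrier M)
      in quotient_module F (submodule_span (real_subring UNIV) F (tensor_relations M)))"

definition is_finite_basis :: "(real, 'a) module \<Rightarrow> 'a set \<Rightarrow> bool" where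
  "is_finite_basis V S \<longleftrightarrow>
     finite S \<and> S \<subseteq> carrier V \<and>
     (\<forall>v\<in>carrier V. \<exists>!c. c \<in> S \<rightarrow>\<^sub>E (UNIV :: real set) \<and> v = (\<Oplus>\<^bsub>V\<^esub>s\<in>S. c s \<odot>\<^bsub>V\<^esub> s))"

definition real_dim :: "(real, 'a) module \<Rightarrow> nat" where
  "real_dim V = (THE n. \<exists>S. is_finite_basis V S \<and> card S = n)"


section \<open>Cubes of based free modules\<close>

text \<open>
  All modules in the cubes are finitely generated free \<open>Zsqrt3\<close>-modules with distinguished
  homogeneous bases. \<open>basis K A\<close> is the basis of the module at \<open>A\<close>, \<open>bideg K A b\<close> the bi-degree of
  the basis vector \<open>b\<close>, and \<open>entry K A B b b'\<close> the coefficient of \<open>b'\<close> in the image of \<open>b\<close> under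
  the map from the module at \<open>A\<close> to the one at \<open>B\<close>. The tensor product of free modules is free
  on pairs of basis vectors, and the tensor product of maps multiplies the entries.
\<close>

record ('e, 'b) cube =
  basis :: "'e set \<Rightarrow> 'b set"
  bideg :: "'e set \<Rightarrow> 'b \<Rightarrow> int \<times> int"
  entry :: "'e set \<Rightarrow> 'e set \<Rightarrow> 'b \<Rightarrow> 'b \<Rightarrow> real"

definition cube_tensor :: "('e, 'b) cube \<Rightarrow> ('e, 'c) cube \<Rightarrow> ('e, 'b \<times> 'c) cube"
    (infixl "\<otimes>\<^sub>c" 70) where
  "K \<otimes>\<^sub>c L =
     \<lparr>basis = (\<lambda>A. basis K A \<times> basis L A),
      bideg = (\<lambda>A (b, c). bideg K A b + bideg L A c),
      entry = (\<lambda>A B (b, c) (b', c'). entry K A B b b' * entry L A B c c')\<rparr>"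

definition edge_cond :: "('e, 'v) rgraph \<Rightarrow> 'e set \<Rightarrow> 'e set \<Rightarrow> bool" where
  "edge_cond G A B \<longleftrightarrow> A \<subseteq> edges G \<and> (\<exists>e\<in>edges G - A. B = insert e A)"

abbreviation new_edge :: "'e set \<Rightarrow> 'e set \<Rightarrow> 'e" where
  "new_edge A B \<equiv> the_elem (B - A)"

definition edge_ordering :: "('e, 'v) rgraph \<Rightarrow> 'e list \<Rightarrow> bool" where
  "edge_ordering G es \<longleftrightarrow> distinct es \<and> set es = edges G"

definition S_cube :: "'e list \<Rightarrow> ('e, unit) cube" where
  "S_cube es =
     \<lparr>basis = (\<lambda>_. UNIV),
      bideg = (\<lambda>_ _. (0, 0)),
      entry = (\<lambda>A B _ _.
        (- 1) ^ length (filter (\<lambda>e. e \<in> A) (takeWhile (\<lambda>e. e \<noteq> new_edge A B) es)))\<rparr>"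

text \<open>
  A basis vector of a tensor power of \<open>N\<close>, a tensor of powers of \<open>y\<close>, is the list of its
  exponents, so that \<open>u \<otimes> Id\<close> puts a \<open>0\<close> in front. The degree of \<open>y\<^sup>a\<close> is \<open>a\<close>.
\<close>

definition F_cube :: "('e, nat list) cube" where
  "F_cube =
     \<lparr>basis = (\<lambda>A. {l. length l = card A \<and> set l \<subseteq> {..1}}),
      bideg = (\<lambda>_ l. (int (sum_list l), 0)),
      entry = (\<lambda>_ _ l l'. of_bool (l' = 0 # l))\<rparr>"

text \<open>
  Structure constants of \<open>M\<close> in the basis \<open>1, x, x\<^sup>2\<close>, where the degree of \<open>x\<^sup>a\<close> is \<open>1 - a\<close>. All
  arguments are exponents at most \<open>2\<close>, so products that reach \<open>x\<^sup>3 = 0\<close> have no nonzero constant.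
\<close>

definition mult_const :: "nat \<Rightarrow> nat \<Rightarrow> nat \<Rightarrow> real" where
  "mult_const a b c = of_bool (a + b = c)"

definition comult_terms :: "nat \<Rightarrow> (nat \<times> nat) set" where
  "comult_terms a =
     (if a = 0 then {(0, 2), (1, 1), (2, 0)}
      else if a = 1 then {(1, 2), (2, 1)}
      else {(2, 2)})"

definition comult_const :: "nat \<Rightarrow> nat \<Rightarrow> nat \<Rightarrow> real" where
  "comult_const a b c = of_bool ((b, c) \<in> comult_terms a)"

definition half_genus_const :: "nat \<Rightarrow> nat \<Rightarrow> real" where
  "half_genus_const a b = sqrt 3 * of_bool (b = Suc a)"

definition circles_at :: "'e \<Rightarrow> ('e, 'v) circle set \<Rightarrow> ('e, 'v) circle set" where
  "circles_at e X = {c \<in> X. \<exists>C i j. c = Inr C \<and> (e, i, j) \<in> C}"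

text \<open>
  The order in which the two circles are taken is irrelevant, as \<open>M\<close> is commutative and
  cocommutative.
\<close>

definition two_circles ::
    "('e, 'v) circle set \<Rightarrow> ('e, 'v) circle \<times> ('e, 'v) circle" where
  "two_circles X = (SOME (c, c'). c \<noteq> c' \<and> X = {c, c'})"

text \<open>
  A basis vector of the tensor power of \<open>M\<close> indexed by a set \<open>X\<close> of circles is a family of
  exponents \<open>\<phi>\<close>. Adding or removing the ribbon \<open>e\<close> turns the circles \<open>X\<close> into the circles \<open>Y\<close>; a
  circle without a corner of \<open>e\<close> belongs to both. A circle that is turned into another one may have
  the same set of corners as the new one, so the affected circles are those through \<open>e\<close> and not
  those in the difference of \<open>X\<close> and \<open>Y\<close>.
\<close>

definition surgery_entry ::
    "'e \<Rightarrow> ('e, 'v) circle set \<Rightarrow> ('e, 'v) circle set \<Rightarrow>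
     (('e, 'v) circle \<Rightarrow> nat) \<Rightarrow> (('e, 'v) circle \<Rightarrow> nat) \<Rightarrow> real" where
  "surgery_entry e X Y \<phi> \<psi> =
     of_bool (\<forall>c\<in>X - circles_at e X. \<psi> c = \<phi> c) *
     (if card Y + 1 = card X then
        (case two_circles (circles_at e X) of
           (c, c') \<Rightarrow> mult_const (\<phi> c) (\<phi> c') (\<psi> (the_elem (circles_at e Y))))
      else if card Y = card X + 1 then
        (case two_circles (circles_at e Y) of
           (c, c') \<Rightarrow> comult_const (\<phi> (the_elem (circles_at e X))) (\<psi> c) (\<psi> c'))
      else
        half_genus_const (\<phi> (the_elem (circles_at e X))) (\<psi> (the_elem (circles_at e Y))))"

definition M_power_basis :: "('e, 'v) circle set \<Rightarrow> (('e, 'v) circle \<Rightarrow> nat) set" where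
  "M_power_basis X = X \<rightarrow>\<^sub>E {..2}"

definition M_power_deg :: "('e, 'v) circle set \<Rightarrow> (('e, 'v) circle \<Rightarrow> nat) \<Rightarrow> int" where
  "M_power_deg X \<phi> = (\<Sum>c\<in>X. 1 - int (\<phi> c))"

definition V_cube :: "('e, 'v) rgraph \<Rightarrow> ('e, ('e, 'v) circle \<Rightarrow> nat) cube" where
  "V_cube G =
     \<lparr>basis = (\<lambda>A. M_power_basis (face_disks G A)),
      bideg = (\<lambda>A \<phi>. (0, M_power_deg (face_disks G A) \<phi>)),
      entry = (\<lambda>A B. surgery_entry (new_edge A B) (face_disks G A) (face_disks G B))\<rparr>"

definition W_cube :: "('e, 'v) rgraph \<Rightarrow> ('e, ('e, 'v) circle \<Rightarrow> nat) cube" where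
  "W_cube G =
     \<lparr>basis = (\<lambda>A. M_power_basis (face_disks G (edges G - A))),
      bideg = (\<lambda>A \<phi>. (0, M_power_deg (face_disks G (edges G - A)) \<phi>)),
      entry = (\<lambda>A B. surgery_entry (new_edge A B)
        (face_disks G (edges G - A)) (face_disks G (edges G - B)))\<rparr>"

type_synonym ('e, 'v) pd_basis =
  "((unit \<times> nat list) \<times> (('e, 'v) circle \<Rightarrow> nat)) \<times> (('e, 'v) circle \<Rightarrow> nat)"

definition pd_cube :: "('e, 'v) rgraph \<Rightarrow> 'e list \<Rightarrow> ('e, ('e, 'v) pd_basis) cube" where
  "pd_cube G es = S_cube es \<otimes>\<^sub>c F_cube \<otimes>\<^sub>c V_cube G \<otimes>\<^sub>c W_cube G"


section \<open>The partial dual complex and its cohomology\<close>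

text \<open>
  \<open>cochains G es i (m, k)\<close> is the component of bi-degree \<open>(m, k)\<close> of the \<open>i\<close>-th cochain module,
  the direct sum being the free module on the disjoint union of the bases. The \<open>(m, k)\<close> component
  of a module shifted by \<open>l\<close> is its \<open>(m, k + l)\<close> component, here with \<open>l = - 2 i\<close>.
\<close>

definition cochains ::
    "('e, 'v) rgraph \<Rightarrow> 'e list \<Rightarrow> nat \<Rightarrow> int \<times> int \<Rightarrow>
     (real, 'e set \<times> ('e, 'v) pd_basis \<Rightarrow> real) module" where
  "cochains G es i = (\<lambda>(m, k). free_module Zsqrt3
     {(A, b). A \<subseteq> edges G \<and> card A = i \<and> b \<in> basis (pd_cube G es) A \<and>
              bideg (pd_cube G es) A b = (m, k + (- 2 * int i))})"

definition coboundary ::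
    "('e, 'v) rgraph \<Rightarrow> 'e list \<Rightarrow>
     ('e set \<times> ('e, 'v) pd_basis \<Rightarrow> real) \<Rightarrow> ('e set \<times> ('e, 'v) pd_basis \<Rightarrow> real)" where
  "coboundary G es f = (\<lambda>(B, b').
     if b' \<in> basis (pd_cube G es) B
     then \<Sum>A | edge_cond G A B.
            \<Sum>b\<in>basis (pd_cube G es) A. f (A, b) * entry (pd_cube G es) A B b b'
     else 0)"

definition cocycles ::
    "('e, 'v) rgraph \<Rightarrow> 'e list \<Rightarrow> nat \<Rightarrow> int \<times> int \<Rightarrow>
     ('e set \<times> ('e, 'v) pd_basis \<Rightarrow> real) set" where
  "cocycles G es i mk = {f \<in> carrier (cochains G es i mk). coboundary G es f = (\<lambda>_. 0)}"

definition coboundaries ::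
    "('e, 'v) rgraph \<Rightarrow> 'e list \<Rightarrow> nat \<Rightarrow> int \<times> int \<Rightarrow>
     ('e set \<times> ('e, 'v) pd_basis \<Rightarrow> real) set" where
  "coboundaries G es i mk =
     (case i of 0 \<Rightarrow> {\<lambda>_. 0}
      | Suc j \<Rightarrow> coboundary G es ` carrier (cochains G es j mk))"

definition cohomology ::
    "('e, 'v) rgraph \<Rightarrow> 'e list \<Rightarrow> nat \<Rightarrow> int \<times> int \<Rightarrow>
     (real, ('e set \<times> ('e, 'v) pd_basis \<Rightarrow> real) set) module" where
  "cohomology G es i mk =
     quotient_module ((cochains G es i mk)\<lparr>carrier := cocycles G es i mk\<rparr>)
       (coboundaries G es i mk)"

text \<open>
  The quantum dimension of a bi-graded module given by its homogeneous components;
  \<open>Poly_Mapping.single (m, k) d\<close> is the monomial \<open>d p\<^sup>m q\<^sup>k\<close>.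
\<close>

definition qdim :: "(int \<times> int \<Rightarrow> (real, 'a) module) \<Rightarrow> laurent2" where
  "qdim M = (\<Sum>mk. Poly_Mapping.single mk (int (real_dim (tensor_reals (M mk)))))"

definition graded_euler_char :: "('e, 'v) rgraph \<Rightarrow> 'e list \<Rightarrow> laurent2" where
  "graded_euler_char G es =
     (\<Sum>i = 0..card (edges G). (- 1) ^ i * qdim (cohomology G es i))"

end

theory Submission
  imports Defs "HOL-Library.Disjoint_Sets" "HOL-Library.Function_Algebras" "HOL-Library.Multiset"
begin

text \<open>
  Adding a ribbon to a spanning subgraph, or removing one, merges two boundary circles, splits one,
  or turns one into another. As \<open>M\<close> has one-dimensional graded pieces, the composite of the maps of
  two such steps that meet depends only on the circles before and after both of them and is
  independent of their order; hence the cube anticommutes and the partial dual complex is a complex.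
  After base change to the reals, its graded Euler characteristic is that of the cochains, namely
  \<open>\<Sum>\<^sub>A w\<^bsup>|A|\<^esup> t\<^bsup>f(A)\<^esup>\<close> with \<open>w = - (1 + p) q\<^sup>2\<close>, \<open>t = q + 1 + q\<^sup>-\<^sup>1\<close> and \<open>f(A) = |F(A)| + |F(A\<^sup>c)|\<close>.
  Now \<open>w\<close> and \<open>t\<close> are algebraically independent, so the pairs \<open>(|A|, f(A))\<close> are determined with
  their multiplicities. They give the number \<open>n\<close> of edges as the largest \<open>|A|\<close>, and they give the
  exponents since the Euler genus of the partial dual is \<open>2 c(G) + n - f(A)\<close>.
\<close>


section \<open>Boundary circles\<close>

text \<open>Each structure map has the same coefficient at every pair of basis vectors that the
  grading allows, namely \<open>sqrt 3\<close> raised to the Euler genus of the surface swept out by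
  the affected circles: with a circles before and b after, one saddle has Euler characteristic -1,
  hence genus 3 - a - b, and two connected saddles have genus 4 - a - b. The critical case is a
  circle split and merged again: it sends 1 to 3 x^2, and this 3 must be the square of the half
  genus scalar; hence \<open>sqrt 3\<close> in the ground ring. Passing from \<open>Zsqrt3\<close>
  to real dimensions needs flatness of the reals. It is replaced by the fact that finitely many
  reals lie in a finitely generated free \<open>Zsqrt3\<close>-submodule of the reals, so that real
  relations can be compared coordinate by coordinate. The number of components must be an input of
  the recovery. One vertex with two unlinked untwisted loops, and one vertex with two unlinked
  twisted loops plus an isolated vertex, both have f(A) = 4 for every A, hence the same Euler
  characteristic, while their exponents are all 0 and all 2 respectively.\<close>

lemma even_card_involution:
  assumes "finite X" "\<And>x. x \<in> X \<Longrightarrow> h x \<in> X" "\<And>x. x \<in> X \<Longrightarrow> h (h x) = x" "\<And>x. x \<in> X \<Longrightarrow> h x \<noteq> x"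
  shows "even (card X)"
  using assms
proof (induction X rule: finite_psubset_induct)
  case (psubset X)
  show ?case
  proof (cases "X = {}")
    case False
    then obtain x where x: "x \<in> X" by blast
    let ?Y = "X - {x, h x}"
    have "even (card ?Y)"
    proof (rule psubset.IH)
      show "?Y \<subset> X" using x by blast
      show "h y \<in> ?Y" if "y \<in> ?Y" for y
        using that psubset.prems x by (metis Diff_iff insert_iff empty_iff)
    qed (use psubset.prems in auto)
    moreover have "card X = card ?Y + card {x, h x}"
      using psubset.hyps psubset.prems(1) x
      by (subst card_Un_disjoint[symmetric]) (auto intro!: arg_cong[of _ _ card])
    ultimately show ?thesis using psubset.prems(3)[OF x] by auto
  qed auto
qed

text \<open>Named apart from \<open>boundary_steps\<close> because, like \<open>arc G\<close>, it is
  an involution without fixed points; the parity argument plays the two against each other.\<close>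

definition side_step :: "'e set \<Rightarrow> 'e corner \<Rightarrow> 'e corner" where
  "side_step A c = (if fst c \<in> A then along_free_side c else along_segment c)"

lemma fst_side_step [simp]: "fst (side_step A c) = fst c"
  by (cases c) (auto simp: side_step_def)

lemma side_step_side_step [simp]: "side_step A (side_step A c) = c"
  by (cases c) (auto simp: side_step_def)

lemma side_step_neq [simp]: "side_step A c \<noteq> c"
  by (cases c) (auto simp: side_step_def)

lemma in_corners_iff: "c \<in> corners G \<longleftrightarrow> fst c \<in> edges G"
  by (cases c) (auto simp: corners_def)

lemma side_step_in_corners [simp]: "side_step A c \<in> corners G \<longleftrightarrow> c \<in> corners G"
  by (simp add: in_corners_iff)

lemma boundary_steps_iff:
  "(c, c') \<in> boundary_steps G A \<longleftrightarrow> c \<in> corners G \<and> (c' = arc G c \<or> c' = side_step A c)"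
  by (auto simp: boundary_steps_def side_step_def simp del: split_paired_Ex split_paired_All)

abbreviation circle_of :: "('e, 'v) rgraph \<Rightarrow> 'e set \<Rightarrow> 'e corner \<Rightarrow> 'e corner set" where
  "circle_of G A c \<equiv> (boundary_steps G A)\<^sup>* `` {c}"

text \<open>
  The common shape of adding a ribbon \<open>e\<close> and of removing it; the last condition excludes that
  two circles are turned into two others.
\<close>

definition surgery :: "'e \<Rightarrow> ('e, 'v) circle set \<Rightarrow> ('e, 'v) circle set \<Rightarrow> bool" where
  "surgery e X Y \<longleftrightarrow> finite X \<and> finite Y \<and>
     X - circles_at e X = Y - circles_at e Y \<and>
     \<Union> {C. Inr C \<in> X} = \<Union> {C. Inr C \<in> Y} \<and>
     disjoint {C. Inr C \<in> X} \<and> disjoint {C. Inr C \<in> Y} \<and>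
     (card (circles_at e X), card (circles_at e Y)) \<in> {(2, 1), (1, 2), (1, 1)}"

lemma surgery_sym: "surgery e X Y \<Longrightarrow> surgery e Y X"
  by (auto simp: surgery_def)

context ribbon_graph
begin

lemma finite_corners: "finite (corners G)"
  using finite_edges by (auto simp: corners_def)

lemma sym_boundary_steps: "sym (boundary_steps G A)"
  unfolding sym_def boundary_steps_iff
  by (metis arc_arc arc_closed side_step_in_corners side_step_side_step)

lemma boundary_steps_rtrancl_corners:
  "(c, c') \<in> (boundary_steps G A)\<^sup>* \<Longrightarrow> c \<in> corners G \<Longrightarrow> c' \<in> corners G"
  by (induction rule: rtrancl_induct) (auto simp: boundary_steps_iff arc_closed)

lemma circle_of_subset: "c \<in> corners G \<Longrightarrow> circle_of G A c \<subseteq> corners G"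
  using boundary_steps_rtrancl_corners by blast

lemma circle_of_eqI: "c' \<in> circle_of G A c \<Longrightarrow> circle_of G A c' = circle_of G A c"
  using symD[OF sym_rtrancl[OF sym_boundary_steps, of A]]
  by (safe; simp; metis rtrancl_trans)

lemma circle_of_eq_iff: "circle_of G A c' = circle_of G A c \<longleftrightarrow> c' \<in> circle_of G A c"
  using circle_of_eqI by blast

lemma circle_of_step: "c \<in> corners G \<Longrightarrow> circle_of G A (side_step A c) = circle_of G A c"
  by (rule circle_of_eqI) (auto simp: boundary_steps_iff)

lemma Inr_face_disks_iff: "Inr C \<in> face_disks G A \<longleftrightarrow> (\<exists>c\<in>corners G. C = circle_of G A c)"
  by (auto simp: face_disks_def quotient_def)

lemma finite_face_disks: "finite (face_disks G A)"
proof -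
  have "corners G // (boundary_steps G A)\<^sup>* = circle_of G A ` corners G"
    by (auto simp: quotient_def)
  then show ?thesis
    using finite_corners finite_verts by (simp add: face_disks_def)
qed

text \<open>Away from \<open>e\<close> the steps of the two subgraphs agree. Avoidance of
  \<open>e\<close> is given for the circle of \<open>A\<close>; the second induction can use it
  because it shows along the way that the path stays on that circle.\<close>

lemma circle_of_subset_cong:
  assumes AB: "\<And>x. x \<noteq> e \<Longrightarrow> x \<in> A \<longleftrightarrow> x \<in> B"
    and e: "\<And>x. x \<in> circle_of G A c \<Longrightarrow> fst x \<noteq> e"
  shows "circle_of G A c = circle_of G B c"
proof -
  have step: "side_step A x = side_step B x" if "fst x \<noteq> e" for x
    using AB[OF that] by (auto simp: side_step_def)
  have "(c, x) \<in> (boundary_steps G B)\<^sup>*" if "(c, x) \<in> (boundary_steps G A)\<^sup>*" for x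
    using that
  proof (induction rule: rtrancl_induct)
    case (step y z)
    then have "(y, z) \<in> boundary_steps G B"
      using \<open>\<And>x. fst x \<noteq> e \<Longrightarrow> side_step A x = side_step B x\<close>[OF e[of y]]
      by (auto simp: boundary_steps_iff)
    with step show ?case by auto
  qed auto
  moreover have "(c, x) \<in> (boundary_steps G A)\<^sup>*" if "(c, x) \<in> (boundary_steps G B)\<^sup>*" for x
    using that
  proof (induction rule: rtrancl_induct)
    case (step y z)
    then have "(y, z) \<in> boundary_steps G A"
      using \<open>\<And>x. fst x \<noteq> e \<Longrightarrow> side_step A x = side_step B x\<close>[OF e[of y]]
      by (auto simp: boundary_steps_iff)
    with step show ?case by auto
  qed auto
  ultimately show ?thesis by blast
qed

lemma face_disks_diff_subset:
  assumes AB: "\<And>x. x \<noteq> e \<Longrightarrow> x \<in> A \<longleftrightarrow> x \<in> B"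
  shows "face_disks G A - circles_at e (face_disks G A) \<subseteq>
    face_disks G B - circles_at e (face_disks G B)"
proof
  fix d assume d: "d \<in> face_disks G A - circles_at e (face_disks G A)"
  show "d \<in> face_disks G B - circles_at e (face_disks G B)"
  proof (cases d)
    case (Inl v)
    then show ?thesis using d by (auto simp: face_disks_def circles_at_def)
  next
    case (Inr C)
    then obtain c where c: "c \<in> corners G" "C = circle_of G A c"
      using d Inr_face_disks_iff by blast
    have e: "fst x \<noteq> e" if "x \<in> circle_of G A c" for x
      using that d Inr c by (cases x) (auto simp: circles_at_def)
    have "C = circle_of G B c"
      using circle_of_subset_cong[OF AB e] c by simp
    then have "d \<in> face_disks G B"
      using Inr c Inr_face_disks_iff by blast
    moreover have "d \<notin> circles_at e (face_disks G B)"
      using d Inr unfolding circles_at_def by auto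
    ultimately show ?thesis by simp
  qed
qed

lemma circles_at_face_disks:
  assumes "e \<in> edges G"
  shows "circles_at e (face_disks G A) = (\<lambda>(i, j). Inr (circle_of G A (e, i, j))) ` UNIV"
proof (intro equalityI subsetI)
  fix d assume "d \<in> circles_at e (face_disks G A)"
  then obtain C i j where C: "Inr C \<in> face_disks G A" "d = Inr C" "(e, i, j) \<in> C"
    by (auto simp: circles_at_def)
  then obtain c where c: "c \<in> corners G" "C = circle_of G A c"
    using Inr_face_disks_iff by blast
  then have "C = circle_of G A (e, i, j)"
    using C circle_of_eqI by blast
  then show "d \<in> (\<lambda>(i, j). Inr (circle_of G A (e, i, j))) ` UNIV" using C by auto
next
  fix d :: "('e, 'v) circle" assume "d \<in> (\<lambda>(i, j). Inr (circle_of G A (e, i, j))) ` UNIV"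
  then obtain i j where "d = Inr (circle_of G A (e, i, j))" by auto
  moreover have "(e, i, j) \<in> corners G" using assms by (simp add: in_corners_iff)
  ultimately show "d \<in> circles_at e (face_disks G A)"
    using Inr_face_disks_iff by (auto simp: circles_at_def)
qed

text \<open>
  Without the sides of the ribbon \<open>e\<close>, the boundary falls into arcs whose ends are the corners of
  \<open>e\<close>, so no corner of \<open>e\<close> is alone on its piece.
\<close>

lemma corner_joined_to_other:
  assumes "e \<in> edges G" "p = (e, i, j)"
  obtains i' j' where "(i', j') \<noteq> (i, j)"
    "(p, (e, i', j')) \<in> {(c, c') \<in> boundary_steps G A. c' = arc G c \<or> fst c \<noteq> e}\<^sup>*"
proof -
  define R where "R = {(c, c') \<in> boundary_steps G A. c' = arc G c \<or> fst c \<noteq> e}"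
  define D where "D = R\<^sup>* `` {p}"
  have p: "p \<in> corners G" using assms by (simp add: in_corners_iff)
  have "R\<^sup>* \<subseteq> (boundary_steps G A)\<^sup>*" by (rule rtrancl_mono) (auto simp: R_def)
  then have D: "D \<subseteq> corners G" using circle_of_subset[OF p] by (auto simp: D_def)
  then have fin: "finite D" using finite_corners finite_subset by blast
  have arcD: "arc G c \<in> D" if "c \<in> D" for c
  proof -
    have "(c, arc G c) \<in> R" using that D by (auto simp: R_def boundary_steps_iff)
    then show ?thesis using that unfolding D_def by (auto intro: rtrancl_into_rtrancl)
  qed
  have sideD: "side_step A c \<in> D" if "c \<in> D" "fst c \<noteq> e" for c
  proof -
    have "(c, side_step A c) \<in> R" using that D by (auto simp: R_def boundary_steps_iff)
    then show ?thesis using that unfolding D_def by (auto intro: rtrancl_into_rtrancl)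
  qed
  have "even (card D)"
    using fin arcD D arc_arc arc_neq by (intro even_card_involution[of D "arc G"]) auto
  have "\<exists>i' j'. (i', j') \<noteq> (i, j) \<and> (e, i', j') \<in> D"
  proof (rule ccontr)
    assume "\<not> ?thesis"
    then have others: "(e, i', j') \<notin> D" if "(i', j') \<noteq> (i, j)" for i' j' using that by blast
    have *: "fst c \<noteq> e" if "c \<in> D - {p}" for c
    proof
      assume "fst c = e"
      then obtain i' j' where c: "c = (e, i', j')" by (cases c) simp
      with that assms(2) have "(i', j') \<noteq> (i, j)" by simp
      then show False using others that c by simp
    qed
    \<comment> \<open>If \<open>p\<close> were the only corner of \<open>e\<close> in
      \<open>D\<close>, then \<open>side_step A\<close> would pair off the rest of \<open>D\<close>,
      while \<open>arc G\<close> pairs off all of \<open>D\<close>.\<close>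
    have "even (card (D - {p}))"
    proof (rule even_card_involution[of _ "side_step A"])
      show "side_step A c \<in> D - {p}" if "c \<in> D - {p}" for c
      proof -
        have "fst (side_step A c) \<noteq> fst p" using *[OF that] assms(2) by simp
        then show ?thesis using sideD that *[OF that] by blast
      qed
    qed (use fin in auto)
    moreover have "p \<in> D" by (auto simp: D_def)
    ultimately show False using \<open>even (card D)\<close> fin by (auto simp: card_gt_0_iff)
  qed
  then show ?thesis using that unfolding D_def R_def by blast
qed

lemma disjoint_face_disks: "disjoint {C. Inr C \<in> face_disks G A}"
proof -
  have "circle_of G A c = circle_of G A c'" if "x \<in> circle_of G A c" "x \<in> circle_of G A c'" for x c c'
    using circle_of_eqI[OF that(1)] circle_of_eqI[OF that(2)] by metis
  then show ?thesis
    unfolding disjoint_def Inr_face_disks_iff by blast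
qed

lemma Union_face_disks: "\<Union> {C. Inr C \<in> face_disks G A} = corners G"
proof (intro equalityI subsetI)
  fix c assume "c \<in> corners G"
  moreover have "c \<in> circle_of G A c" by simp
  ultimately show "c \<in> \<Union> {C. Inr C \<in> face_disks G A}"
    unfolding Inr_face_disks_iff by blast
next
  fix c assume "c \<in> \<Union> {C. Inr C \<in> face_disks G A}"
  then show "c \<in> corners G"
    unfolding Inr_face_disks_iff using circle_of_subset by blast
qed

text \<open>Segments identify corners of \<open>e\<close> with equal first bit, so at most two
  circles pass \<open>e\<close> before; free sides identify those with equal second bit, so at most
  two pass it after. A path avoiding the sides of \<open>e\<close> joins the corner with bits
  (False, False) to another one in both subgraphs. A difference in the first bit collapses the
  circles before, a difference in the second those after, so two circles never become two.\<close>

lemma surgery_insert: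
  assumes e: "e \<in> edges G" "e \<notin> A"
  shows "surgery e (face_disks G A) (face_disks G (insert e A))"
proof -
  let ?B = "insert e A"
  have corner: "(e, i, j) \<in> corners G" for i j using e by (simp add: in_corners_iff)
  have A: "circle_of G A (e, i, \<not> j) = circle_of G A (e, i, j)" for i j
    using circle_of_step[OF corner, of A i j] e by (simp add: side_step_def)
  have B: "circle_of G ?B (e, \<not> i, j) = circle_of G ?B (e, i, j)" for i j
    using circle_of_step[OF corner, of ?B i j] e by (simp add: side_step_def)
  have U: "(UNIV :: (bool \<times> bool) set) = {(True, True), (True, False), (False, True), (False, False)}"
    by (auto)
  have cA: "circles_at e (face_disks G A) =
      {Inr (circle_of G A (e, False, False)), Inr (circle_of G A (e, True, False))}"
    unfolding circles_at_face_disks[OF e(1)] U using A[of _ False] by (auto)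
  have cB: "circles_at e (face_disks G ?B) =
      {Inr (circle_of G ?B (e, False, False)), Inr (circle_of G ?B (e, False, True))}"
    unfolding circles_at_face_disks[OF e(1)] U using B[of False] by (auto)
  obtain i j where ij: "(i, j) \<noteq> (False, False)"
    "((e, False, False), (e, i, j)) \<in> {(c, c') \<in> boundary_steps G A. c' = arc G c \<or> fst c \<noteq> e}\<^sup>*"
    by (rule corner_joined_to_other[OF e(1) refl, of False False A]) auto
  have "{(c, c') \<in> boundary_steps G A. c' = arc G c \<or> fst c \<noteq> e} \<subseteq> boundary_steps G ?B"
    by (auto simp: boundary_steps_iff side_step_def)
  from rtrancl_mono[OF this] ij(2)
  have Beq: "circle_of G ?B (e, i, j) = circle_of G ?B (e, False, False)"
    by (intro circle_of_eqI) auto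
  have "{(c, c') \<in> boundary_steps G A. c' = arc G c \<or> fst c \<noteq> e} \<subseteq> boundary_steps G A"
    by auto
  from rtrancl_mono[OF this] ij(2)
  have Aeq: "circle_of G A (e, i, j) = circle_of G A (e, False, False)"
    by (intro circle_of_eqI) auto
  have "circle_of G A (e, True, False) = circle_of G A (e, False, False) \<or>
      circle_of G ?B (e, False, True) = circle_of G ?B (e, False, False)"
    using ij(1) Aeq Beq A[of i j] B[of i j] by (cases i; cases j) auto
  then have "(card (circles_at e (face_disks G A)), card (circles_at e (face_disks G ?B)))
      \<in> {(2, 1), (1, 2), (1, 1)}"
    unfolding cA cB by (auto simp: card_insert_if)
  moreover have "face_disks G A - circles_at e (face_disks G A) =
      face_disks G ?B - circles_at e (face_disks G ?B)"
    using face_disks_diff_subset[of e A ?B] face_disks_diff_subset[of e ?B A] by auto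
  ultimately show ?thesis
    unfolding surgery_def by (simp add: finite_face_disks disjoint_face_disks Union_face_disks)
qed

end


section \<open>Maps of surgeries and their composites\<close>

lemma finite_M_power_basis: "finite X \<Longrightarrow> finite (M_power_basis X)"
  by (simp add: M_power_basis_def finite_PiE)

lemma circles_at_subset: "circles_at e X \<subseteq> X"
  by (auto simp: circles_at_def)

lemma circles_at_transfer: "c \<in> X \<Longrightarrow> c \<in> Y \<Longrightarrow> c \<in> circles_at e X \<longleftrightarrow> c \<in> circles_at e Y"
  by (auto simp: circles_at_def)

lemma two_circles:
  assumes "card X = 2"
  obtains c c' where "two_circles X = (c, c')" "c \<noteq> c'" "X = {c, c'}"
proof -
  obtain c c' where "c \<noteq> c'" "X = {c, c'}" using assms card_2_iff by metis
  then have "\<exists>p. case p of (c, c') \<Rightarrow> c \<noteq> c' \<and> X = {c, c'}" by auto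
  from someI_ex[OF this] show ?thesis
    using that by (cases "two_circles X") (auto simp: two_circles_def)
qed

text \<open>The comultiplication raises the total exponent by 2 and has coefficient 1 at every pair
  of exponents that this allows.\<close>

lemma comult_terms_iff:
  assumes "a \<le> 2" "b \<le> 2" "c \<le> 2"
  shows "(b, c) \<in> comult_terms a \<longleftrightarrow> b + c = a + 2"
proof -
  consider "a = 0" | "a = 1" | "a = 2" using assms by linarith
  then show ?thesis
    by cases (use assms in \<open>simp_all add: comult_terms_def, presburger+\<close>)
qed

text \<open>Merging, splitting and turning obey one formula: with the other circles unchanged, the
  entry is nonzero exactly when the degree on the affected circles drops by one, and then it is 1
  when three circles are involved and \<open>sqrt 3\<close> when two are. The subtraction in the
  exponent is never truncated.\<close>

lemma surgery_entry_eq: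
  assumes "surgery e X Y" "\<phi> \<in> M_power_basis X" "\<psi> \<in> M_power_basis Y"
  shows "surgery_entry e X Y \<phi> \<psi> =
    of_bool (\<forall>c\<in>X - circles_at e X. \<psi> c = \<phi> c) *
    sqrt 3 ^ (3 - card (circles_at e X) - card (circles_at e Y)) *
    of_bool (sum \<psi> (circles_at e Y) + card (circles_at e X) =
      sum \<phi> (circles_at e X) + 1 + card (circles_at e Y))"
proof -
  let ?a = "circles_at e X" and ?b = "circles_at e Y"
  have fin: "finite X" "finite Y" using assms by (auto simp: surgery_def)
  have "card X = card (X - ?a) + card ?a" "card Y = card (Y - ?b) + card ?b"
    using fin circles_at_subset[of e X] circles_at_subset[of e Y]
    by (simp_all add: card_Diff_subset card_mono finite_subset)
  moreover have "X - ?a = Y - ?b" using assms by (auto simp: surgery_def)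
  ultimately have card: "card Y + card ?a = card X + card ?b" by simp
  have le: "\<phi> c \<le> 2" if "c \<in> ?a" for c
    using that assms(2) circles_at_subset[of e X] by (auto simp: M_power_basis_def PiE_iff)
  have le': "\<psi> c \<le> 2" if "c \<in> ?b" for c
    using that assms(3) circles_at_subset[of e Y] by (auto simp: M_power_basis_def PiE_iff)
  have "(card ?a, card ?b) \<in> {(2, 1), (1, 2), (1, 1)}" using assms by (auto simp: surgery_def)
  then consider (merge) "card ?a = 2" "card ?b = 1" | (split) "card ?a = 1" "card ?b = 2"
    | (turn) "card ?a = 1" "card ?b = 1" by auto
  then show ?thesis
  proof cases
    case merge
    obtain c c' where c: "two_circles ?a = (c, c')" "c \<noteq> c'" "?a = {c, c'}"
      using two_circles[OF merge(1)] by metis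
    obtain d where d: "?b = {d}" using merge(2) by (auto simp: card_1_singleton_iff)
    have Y: "card Y + 1 = card X" using card merge by simp
    show ?thesis
      unfolding surgery_entry_def if_P[OF Y] c(1) using c(2) d merge
      by (auto simp: c(3) mult_const_def of_bool_def)
  next
    case split
    obtain c c' where c: "two_circles ?b = (c, c')" "c \<noteq> c'" "?b = {c, c'}"
      using two_circles[OF split(2)] by metis
    obtain d where d: "?a = {d}" using split(1) by (auto simp: card_1_singleton_iff)
    have Y: "card Y + 1 \<noteq> card X" "card Y = card X + 1" using card split by simp_all
    have "comult_const (\<phi> d) (\<psi> c) (\<psi> c') = of_bool (\<psi> c + \<psi> c' = \<phi> d + 2)"
      using comult_terms_iff[of "\<phi> d" "\<psi> c" "\<psi> c'"] le le' c(3) d by (simp add: comult_const_def)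
    then show ?thesis
      unfolding surgery_entry_def if_not_P[OF Y(1)] if_P[OF Y(2)] c(1) using c(2) d split
      by (auto simp: c(3) of_bool_def)
  next
    case turn
    obtain d where d: "?a = {d}" using turn(1) by (auto simp: card_1_singleton_iff)
    obtain c where c: "?b = {c}" using turn(2) by (auto simp: card_1_singleton_iff)
    have Y: "card Y + 1 \<noteq> card X" "card Y \<noteq> card X + 1" using card turn by simp_all
    show ?thesis
      unfolding surgery_entry_def if_not_P[OF Y(1)] if_not_P[OF Y(2)] using c d turn
      by (auto simp: half_genus_const_def of_bool_def)
  qed
qed

definition surgery_composite ::
    "'e \<Rightarrow> 'e \<Rightarrow> ('e, 'v) circle set \<Rightarrow> ('e, 'v) circle set \<Rightarrow> ('e, 'v) circle set \<Rightarrow>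
     (('e, 'v) circle \<Rightarrow> nat) \<Rightarrow> (('e, 'v) circle \<Rightarrow> nat) \<Rightarrow> real" where
  "surgery_composite e f X Y Z \<phi> \<psi> =
     (\<Sum>\<chi>\<in>M_power_basis Y. surgery_entry e X Y \<phi> \<chi> * surgery_entry f Y Z \<chi> \<psi>)"

text \<open>The middle state is prescribed by \<open>\<phi>\<close> off the circles at
  \<open>e\<close> and by \<open>\<psi>\<close> off those at \<open>f\<close>. Only its values on
  the circles met by both ribbons are free, so the sum counts families on \<open>I\<close> subject
  to both degree conditions.\<close>

lemma surgery_composite_eq:
  fixes X Y Z :: "('e, 'v) circle set"
  assumes e: "surgery e X Y" and f: "surgery f Y Z"
    and \<phi>: "\<phi> \<in> M_power_basis X" and \<psi>: "\<psi> \<in> M_power_basis Z"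
  defines "I \<equiv> circles_at e Y \<inter> circles_at f Y"
  shows "surgery_composite e f X Y Z \<phi> \<psi> =
    of_bool (\<forall>c\<in>X - (circles_at e X \<union> circles_at f X). \<psi> c = \<phi> c) *
    sqrt 3 ^ ((3 - card (circles_at e X) - card (circles_at e Y)) +
              (3 - card (circles_at f Y) - card (circles_at f Z))) *
    card {u \<in> M_power_basis I.
      sum u I + sum \<psi> (circles_at e Y - circles_at f Y) + card (circles_at e X) =
        sum \<phi> (circles_at e X) + 1 + card (circles_at e Y) \<and>
      sum \<psi> (circles_at f Z) + card (circles_at f Y) =
        sum u I + sum \<phi> (circles_at f Y - circles_at e Y) + 1 + card (circles_at f Z)}"
    (is "_ = of_bool ?same * ?s * real (card ?U)")
proof -
  let ?Xe = "circles_at e X" and ?Xf = "circles_at f X" and ?Ye = "circles_at e Y"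
    and ?Yf = "circles_at f Y" and ?Zf = "circles_at f Z"
  have fin: "finite X" "finite Y" "finite Z" using e f by (auto simp: surgery_def)
  have eXY: "X - ?Xe = Y - ?Ye" and fYZ: "Y - ?Yf = Z - ?Zf"
    using e f by (auto simp: surgery_def)
  have fY: "finite ?Ye" "finite ?Yf" using fin circles_at_subset finite_subset by metis+
  define S where "S = {\<chi> \<in> M_power_basis Y. (\<forall>c\<in>Y - ?Ye. \<chi> c = \<phi> c) \<and> (\<forall>c\<in>Y - ?Yf. \<psi> c = \<chi> c) \<and>
     sum \<chi> ?Ye + card ?Xe = sum \<phi> ?Xe + 1 + card ?Ye \<and>
     sum \<psi> ?Zf + card ?Yf = sum \<chi> ?Yf + 1 + card ?Zf}"
  have "surgery_composite e f X Y Z \<phi> \<psi> = (\<Sum>\<chi>\<in>M_power_basis Y. if \<chi> \<in> S then ?s else 0)"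
    unfolding surgery_composite_def
    by (intro sum.cong refl)
      (simp add: surgery_entry_eq[OF e \<phi>] surgery_entry_eq[OF f _ \<psi>] S_def eXY power_add)
  also have "\<dots> = ?s * card S"
  proof -
    have "S \<subseteq> M_power_basis Y" by (auto simp: S_def)
    then have "M_power_basis Y \<inter> {\<chi>. \<chi> \<in> S} = S" by auto
    then show ?thesis
      using finite_M_power_basis[OF fin(2)] by (simp add: sum.If_cases)
  qed
  also have "real (card S) = of_bool ?same * card ?U"
  proof (cases ?same)
    case False
    \<comment> \<open>A circle away from both ribbons is carried unchanged through the middle, so no
      middle state is compatible with different exponents at the two ends.\<close>
    then obtain c where c: "c \<in> X" "c \<notin> ?Xe" "c \<notin> ?Xf" "\<psi> c \<noteq> \<phi> c" by auto
    then have "c \<in> Y - ?Ye" using eXY by auto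
    moreover from this c have "c \<in> Y - ?Yf" using circles_at_transfer[of c X Y f] by auto
    ultimately have "S = {}" unfolding S_def using c(4) by force
    then show ?thesis using False by simp
  next
    case True
    have Y\<phi>: "\<phi> c \<le> 2" if "c \<in> Y - ?Ye" for c
      using that \<phi> eXY by (auto simp: M_power_basis_def PiE_iff)
    have Y\<psi>: "\<psi> c \<le> 2" if "c \<in> Y - ?Yf" for c
      using that \<psi> fYZ by (auto simp: M_power_basis_def PiE_iff)
    have same: "\<psi> c = \<phi> c" if "c \<in> Y - ?Ye" "c \<in> Y - ?Yf" for c
      using that True eXY circles_at_transfer[of c X Y f] by blast
    have I: "I \<subseteq> Y" "I \<subseteq> ?Ye" "I \<subseteq> ?Yf" using circles_at_subset[of e Y] by (auto simp: I_def)
    \<comment> \<open>Rebuilds the middle state: on circles at \<open>e\<close> but not at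
      \<open>f\<close> the value is already the final one, on all others outside \<open>I\<close>
      still the initial one.\<close>
    define ext where "ext u = (\<lambda>c\<in>Y. if c \<in> I then u c else if c \<in> ?Ye then \<psi> c else \<phi> c)"
      for u :: "('e, 'v) circle \<Rightarrow> nat"
    have sumYe: "sum \<chi> ?Ye = sum \<chi> I + sum \<psi> (?Ye - ?Yf)" if "\<And>c. c \<in> ?Ye - ?Yf \<Longrightarrow> \<chi> c = \<psi> c" for \<chi>
      using sum.Int_Diff[OF fY(1), of \<chi> ?Yf] that by (simp add: I_def)
    have sumYf: "sum \<chi> ?Yf = sum \<chi> I + sum \<phi> (?Yf - ?Ye)" if "\<And>c. c \<in> ?Yf - ?Ye \<Longrightarrow> \<chi> c = \<phi> c" for \<chi>
      using sum.Int_Diff[OF fY(2), of \<chi> ?Ye] that by (simp add: I_def Int_commute)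
    have sub: "?Ye \<subseteq> Y" "?Yf \<subseteq> Y" by (rule circles_at_subset)+
    have "bij_betw (\<lambda>\<chi>. restrict \<chi> I) S ?U"
    proof (rule bij_betwI[of _ _ _ ext])
      show "(\<lambda>\<chi>. restrict \<chi> I) \<in> S \<rightarrow> ?U"
      proof
        fix \<chi> assume \<chi>: "\<chi> \<in> S"
        have "sum \<chi> ?Ye = sum \<chi> I + sum \<psi> (?Ye - ?Yf)" "sum \<chi> ?Yf = sum \<chi> I + sum \<phi> (?Yf - ?Ye)"
          using \<chi> sub by (intro sumYe sumYf; force simp: S_def)+
        moreover have "restrict \<chi> I \<in> M_power_basis I"
          using \<chi> I(1) by (auto simp: S_def M_power_basis_def PiE_iff)
        ultimately show "restrict \<chi> I \<in> ?U"
          using \<chi> by (simp add: S_def)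
      qed
      show "ext \<in> ?U \<rightarrow> S"
      proof
        fix u assume u: "u \<in> ?U"
        have u2: "u c \<le> 2" if "c \<in> I" for c
          using u that by (auto simp: M_power_basis_def PiE_iff)
        have bas: "ext u \<in> M_power_basis Y"
          using u2 Y\<phi> Y\<psi> unfolding M_power_basis_def ext_def by (auto simp: I_def)
        have 1: "sum (ext u) ?Ye = sum (ext u) I + sum \<psi> (?Ye - ?Yf)"
          using sub by (intro sumYe) (auto simp: ext_def I_def)
        have 2: "sum (ext u) ?Yf = sum (ext u) I + sum \<phi> (?Yf - ?Ye)"
          using sub by (intro sumYf) (auto simp: ext_def I_def)
        have 3: "sum (ext u) I = sum u I"
          using I by (intro sum.cong) (auto simp: ext_def)
        have 4: "\<forall>c\<in>Y - ?Ye. ext u c = \<phi> c" by (auto simp: ext_def I_def)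
        have 5: "\<forall>c\<in>Y - ?Yf. \<psi> c = ext u c" using same by (auto simp: ext_def I_def)
        show "ext u \<in> S" using u bas 4 5 unfolding S_def 1 2 3 mem_Collect_eq by simp
      qed
      show "ext (restrict \<chi> I) = \<chi>" if "\<chi> \<in> S" for \<chi>
      proof
        fix c show "ext (restrict \<chi> I) c = \<chi> c"
          using that by (auto simp: ext_def S_def I_def M_power_basis_def PiE_iff extensional_def)
      qed
      show "restrict (ext u) I = u" if "u \<in> ?U" for u
      proof
        fix c show "restrict (ext u) I c = u c"
          using that I(1) by (auto simp: ext_def M_power_basis_def PiE_iff extensional_def)
      qed
    qed
    then show ?thesis using True by (simp add: bij_betw_same_card)
  qed
  finally show ?thesis by simp
qed

lemma card_M_power_basis_empty: "card {u \<in> M_power_basis {}. P} = of_bool P"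
  by (cases P) (simp_all add: M_power_basis_def)

lemma card_M_power_basis_single:
  "card {u \<in> M_power_basis {c}. P (u c)} = card {t. t \<le> 2 \<and> P t}"
proof -
  have "{u \<in> M_power_basis {c}. P (u c)} = (\<lambda>t. \<lambda>x\<in>{c}. t) ` {t. t \<le> 2 \<and> P t}"
  proof (intro equalityI subsetI)
    fix u assume "u \<in> {u \<in> M_power_basis {c}. P (u c)}"
    then have u: "u \<in> {c} \<rightarrow>\<^sub>E {..2}" "P (u c)" by (auto simp: M_power_basis_def)
    then have "u = (\<lambda>x\<in>{c}. u c)" by (intro PiE_ext[of u _ _ "\<lambda>x\<in>{c}. u c"]) auto
    then show "u \<in> (\<lambda>t. \<lambda>x\<in>{c}. t) ` {t. t \<le> 2 \<and> P t}" using u by blast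
  qed (auto simp: M_power_basis_def restrict_PiE_iff intro!: restrict_PiE_iff[THEN iffD2])
  moreover have "inj_on (\<lambda>t. \<lambda>x\<in>{c}. t) {t. t \<le> 2 \<and> P t}"
  proof (rule inj_onI)
    fix s t :: nat assume "(\<lambda>x\<in>{c}. s) = (\<lambda>x\<in>{c}. t)"
    then have "(\<lambda>x\<in>{c}. s) c = (\<lambda>x\<in>{c}. t) c" by (rule fun_cong)
    then show "s = t" by simp
  qed
  ultimately show ?thesis by (simp add: card_image)
qed

text \<open>The three families are the terms of \<open>\<Delta>(1)\<close>, so this 3 is the
  coefficient of x^2 after splitting and merging.\<close>

lemma card_M_power_basis_pair:
  assumes "c \<noteq> c'"
  shows "card {u \<in> M_power_basis {c, c'}. u c + u c' = 2} = 3"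
proof -
  have "bij_betw (\<lambda>u. u c) {u \<in> M_power_basis {c, c'}. u c + u c' = 2} {..2}"
  proof (rule bij_betwI)
    show "(\<lambda>t. \<lambda>x\<in>{c, c'}. if x = c then t else 2 - t) \<in> {..2} \<rightarrow>
        {u \<in> M_power_basis {c, c'}. u c + u c' = 2}"
      using assms by (auto simp: M_power_basis_def)
  qed (use assms in \<open>auto simp: M_power_basis_def PiE_iff extensional_def fun_eq_iff\<close>)
  then show ?thesis by (simp add: bij_betw_same_card)
qed

text \<open>
  On a connected composite the grading leaves no freedom but the number of ways to distribute the
  exponents over the circles in the middle; this number is \<open>3\<close> when a circle is split and merged
  again, as for two half genus maps.
\<close>

lemma surgery_composite_connected:
  fixes X Y Z :: "('e, 'v) circle set"
  assumes e: "surgery e X Y" and f: "surgery f Y Z"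
    and \<phi>: "\<phi> \<in> M_power_basis X" and \<psi>: "\<psi> \<in> M_power_basis Z"
    and I: "circles_at e Y \<inter> circles_at f Y \<noteq> {}"
  defines "U \<equiv> circles_at e X \<union> circles_at f X" and "V \<equiv> circles_at e Z \<union> circles_at f Z"
  shows "surgery_composite e f X Y Z \<phi> \<psi> =
    of_bool (\<forall>c\<in>X - U. \<psi> c = \<phi> c) * sqrt 3 ^ (4 - card U - card V) *
    of_bool (sum \<psi> V + card U = sum \<phi> U + 2 + card V)"
proof -
  let ?Xe = "circles_at e X" and ?Xf = "circles_at f X" and ?Ye = "circles_at e Y"
    and ?Yf = "circles_at f Y" and ?Zf = "circles_at f Z" and ?Ze = "circles_at e Z"
  let ?I = "?Ye \<inter> ?Yf"
  have fin: "finite X" "finite Y" "finite Z" using e f by (auto simp: surgery_def)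
  have eXY: "X - ?Xe = Y - ?Ye" and fYZ: "Y - ?Yf = Z - ?Zf"
    using e f by (auto simp: surgery_def)
  have fs: "finite ?Xe" "finite ?Ye" "finite ?Yf" "finite ?Zf"
    using fin circles_at_subset finite_subset by metis+
  \<comment> \<open>Circles at \<open>f\<close> that miss \<open>e\<close> survive the first step.
    So the touched circles at the start are those consumed by the first step and those that reach
    the second one intact; likewise for \<open>V\<close> read backwards.\<close>
  have U: "U = ?Xe \<union> (?Yf - ?Ye)" "?Xe \<inter> (?Yf - ?Ye) = {}"
    unfolding U_def using eXY circles_at_subset[of f X] circles_at_subset[of f Y]
      circles_at_transfer[of _ X Y f] by blast+
  have V: "V = ?Zf \<union> (?Ye - ?Yf)" "?Zf \<inter> (?Ye - ?Yf) = {}"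
    unfolding V_def using fYZ circles_at_subset[of e Z] circles_at_subset[of e Y]
      circles_at_transfer[of _ Z Y e] by blast+
  have sums: "sum \<phi> U = sum \<phi> ?Xe + sum \<phi> (?Yf - ?Ye)" "sum \<psi> V = sum \<psi> ?Zf + sum \<psi> (?Ye - ?Yf)"
    "card U = card ?Xe + card (?Yf - ?Ye)" "card V = card ?Zf + card (?Ye - ?Yf)"
    unfolding U(1) V(1) using fs U(2) V(2)
    by (simp_all add: sum.union_disjoint card_Un_disjoint)
  have cards: "card ?Ye = card ?I + card (?Ye - ?Yf)" "card ?Yf = card ?I + card (?Yf - ?Ye)"
    using fs by (simp_all add: card_Diff_subset_Int Int_commute card_mono)
  \<comment> \<open>Exponents are at most 2; this bound and the next keep the subtraction defining
    \<open>t\<close> below exact and make \<open>t\<close> at most 2.\<close>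
  have P: "sum \<psi> (?Ye - ?Yf) \<le> 2 * card (?Ye - ?Yf)"
  proof -
    have "\<psi> c \<le> 2" if "c \<in> ?Ye - ?Yf" for c
      using that \<psi> fYZ circles_at_subset[of e Y] by (auto simp: M_power_basis_def PiE_iff)
    then show ?thesis using sum_bounded_above[of "?Ye - ?Yf" \<psi> 2] by (simp add: mult.commute)
  qed
  have R: "sum \<psi> ?Zf \<le> 2 * card ?Zf"
  proof -
    have "\<psi> c \<le> 2" if "c \<in> ?Zf" for c
      using that \<psi> circles_at_subset[of f Z] by (auto simp: M_power_basis_def PiE_iff)
    then show ?thesis using sum_bounded_above[of "?Zf" \<psi> 2] by (simp add: mult.commute)
  qed
  have ecard: "(card ?Xe, card ?Ye) \<in> {(2, 1), (1, 2), (1, 1)}"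
    and fcard: "(card ?Yf, card ?Zf) \<in> {(2, 1), (1, 2), (1, 1)}"
    using e f by (auto simp: surgery_def)
  have Ipos: "card ?I > 0" using I fs by (simp add: card_gt_0_iff)
  moreover have "card ?I \<le> 2" using cards ecard by auto
  ultimately consider "card ?I = 1" | "card ?I = 2" by linarith
  then show ?thesis
  proof cases
    case 1
    then obtain c where c: "?I = {c}" by (auto simp: card_1_singleton_iff)
    define Q where "Q t \<longleftrightarrow> t + sum \<psi> (?Ye - ?Yf) + card ?Xe = sum \<phi> ?Xe + 1 + card ?Ye \<and>
      sum \<psi> ?Zf + card ?Yf = t + sum \<phi> (?Yf - ?Ye) + 1 + card ?Zf" for t
    have "card {t. t \<le> 2 \<and> Q t} = of_bool (sum \<psi> V + card U = sum \<phi> U + 2 + card V)"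
    proof (cases "sum \<psi> V + card U = sum \<phi> U + 2 + card V")
      case True
      \<comment> \<open>The exponent of the single shared circle is forced by the degree condition
        of the first map.\<close>
      define t where "t = sum \<phi> ?Xe + 1 + card ?Ye - sum \<psi> (?Ye - ?Yf) - card ?Xe"
      have "t + sum \<psi> (?Ye - ?Yf) + card ?Xe = sum \<phi> ?Xe + 1 + card ?Ye"
        unfolding t_def using P cards 1 ecard by auto
      moreover from this have "t \<le> 2" "Q t"
        unfolding Q_def using True sums cards 1 R fcard by auto
      ultimately have "{t. t \<le> 2 \<and> Q t} = {t}" unfolding Q_def by auto
      then show ?thesis using True by simp
    next
      case False
      then have "\<not> Q t" for t using sums cards 1 unfolding Q_def by auto
      then show ?thesis using False by simp
    qed
    moreover have "(3 - card ?Xe - card ?Ye) + (3 - card ?Yf - card ?Zf) = 4 - card U - card V"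
      using ecard fcard cards sums 1 by auto
    ultimately show ?thesis
      unfolding surgery_composite_eq[OF e f \<phi> \<psi>] c U_def[symmetric]
      using card_M_power_basis_single[of c Q] by (simp add: Q_def)
  next
    case 2
    then obtain c c' where c: "?I = {c, c'}" "c \<noteq> c'" by (auto simp: card_2_iff)
    \<comment> \<open>Two shared circles leave only one possibility: a circle is split and the same
      two pieces are merged.\<close>
    have n: "card ?Ye = 2" "card ?Yf = 2" "card ?Xe = 1" "card ?Zf = 1"
      "?Ye - ?Yf = {}" "?Yf - ?Ye = {}"
      using 2 cards ecard fcard fs by auto
    show ?thesis
    proof (cases "sum \<psi> V + card U = sum \<phi> U + 2 + card V")
      case True
      \<comment> \<open>The exponent rises by 2 from one circle to one circle, so the only nonzero
        entry sends 1 to x^2.\<close>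
      then have "sum \<psi> ?Zf = 2" "sum \<phi> ?Xe = 0" using sums n R by auto
      then have *: "{u \<in> M_power_basis ?I. sum u ?I + sum \<psi> (?Ye - ?Yf) + card ?Xe = sum \<phi> ?Xe + 1 + card ?Ye \<and>
        sum \<psi> ?Zf + card ?Yf = sum u ?I + sum \<phi> (?Yf - ?Ye) + 1 + card ?Zf} =
        {u \<in> M_power_basis {c, c'}. u c + u c' = 2}" using c n by auto
      show ?thesis
        unfolding surgery_composite_eq[OF e f \<phi> \<psi>] U_def[symmetric] * card_M_power_basis_pair[OF c(2)]
        using True n sums by simp
    next
      case False
      then have *: "{u \<in> M_power_basis ?I. sum u ?I + sum \<psi> (?Ye - ?Yf) + card ?Xe = sum \<phi> ?Xe + 1 + card ?Ye \<and>
        sum \<psi> ?Zf + card ?Yf = sum u ?I + sum \<phi> (?Yf - ?Ye) + 1 + card ?Zf} = {}"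
        using n sums by auto
      show ?thesis
        unfolding surgery_composite_eq[OF e f \<phi> \<psi>] U_def[symmetric] * using False by simp
    qed
  qed
qed

text \<open>The circles at \<open>e\<close> stay apart from those at \<open>f\<close> throughout.
  Hence those at \<open>e\<close> after its own step are the final ones, and those at
  \<open>f\<close> before its step are the initial ones. Eliminating the middle in this way leaves a
  formula symmetric in the two ribbons.\<close>

lemma surgery_composite_disconnected:
  fixes X Y Z :: "('e, 'v) circle set"
  assumes e: "surgery e X Y" and f: "surgery f Y Z"
    and \<phi>: "\<phi> \<in> M_power_basis X" and \<psi>: "\<psi> \<in> M_power_basis Z"
    and I: "circles_at e Y \<inter> circles_at f Y = {}" "circles_at e X \<inter> circles_at f X = {}"
  shows "surgery_composite e f X Y Z \<phi> \<psi> =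
    of_bool (\<forall>c\<in>X - (circles_at e X \<union> circles_at f X). \<psi> c = \<phi> c) *
    sqrt 3 ^ ((3 - card (circles_at e X) - card (circles_at e Z)) +
              (3 - card (circles_at f X) - card (circles_at f Z))) *
    of_bool (sum \<psi> (circles_at e Z) + card (circles_at e X) =
        sum \<phi> (circles_at e X) + 1 + card (circles_at e Z) \<and>
      sum \<psi> (circles_at f Z) + card (circles_at f X) =
        sum \<phi> (circles_at f X) + 1 + card (circles_at f Z))"
proof -
  let ?Xe = "circles_at e X" and ?Xf = "circles_at f X" and ?Ye = "circles_at e Y"
    and ?Yf = "circles_at f Y" and ?Zf = "circles_at f Z" and ?Ze = "circles_at e Z"
  have eXY: "X - ?Xe = Y - ?Ye" and fYZ: "Y - ?Yf = Z - ?Zf"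
    using e f by (auto simp: surgery_def)
  have disj: "?Ze \<inter> ?Zf = {}"
  proof -
    have U: "\<Union> {C. Inr C \<in> Y} = \<Union> {C. Inr C \<in> Z}" and D: "disjoint {C. Inr C \<in> Z}"
      using f by (auto simp: surgery_def)
    show ?thesis
    proof (rule ccontr)
      assume "?Ze \<inter> ?Zf \<noteq> {}"
      \<comment> \<open>Such a circle contains a corner of \<open>e\<close>. The circle of
        \<open>Y\<close> at that corner misses \<open>f\<close>, hence persists in \<open>Z\<close>
        and by disjointness is the same circle.\<close>
      then obtain d where "d \<in> ?Ze" "d \<in> ?Zf" by blast
      then obtain C i j where C: "Inr C \<in> Z" "(e, i, j) \<in> C" "Inr C \<in> ?Zf"
        unfolding circles_at_def by blast
      then obtain C' where C': "Inr C' \<in> Y" "(e, i, j) \<in> C'" using U by blast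
      then have "Inr C' \<in> ?Ye" by (auto simp: circles_at_def)
      then have "Inr C' \<in> Z - ?Zf" using I(1) fYZ C'(1) by blast
      moreover have "C' = C" using D C C' calculation unfolding disjoint_def by blast
      ultimately show False using C(3) by blast
    qed
  qed
  have Yf: "?Yf = ?Xf" using I eXY circles_at_subset[of f X] circles_at_subset[of f Y]
      circles_at_transfer[of _ X Y f] by blast
  have Ye: "?Ye = ?Ze" using I(1) disj fYZ circles_at_subset[of e Z] circles_at_subset[of e Y]
      circles_at_transfer[of _ Z Y e] by blast
  have "?Ye - ?Yf = ?Ye" "?Yf - ?Ye = ?Yf" using I(1) by auto
  then show ?thesis
    unfolding surgery_composite_eq[OF e f \<phi> \<psi>] I(1)
    by (simp only: Yf Ye sum.empty add_0 card.empty card_M_power_basis_empty of_nat_of_bool)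
qed

text \<open>A surgery at \<open>e\<close> only rearranges the corners on the circles at
  \<open>e\<close>: a corner of \<open>f\<close> on such a circle lies on such a circle afterwards.
  So both orders of the two steps fall into the same case.\<close>

lemma surgery_meet_iff:
  fixes X Y :: "('e, 'v) circle set"
  assumes "surgery e X Y"
  shows "circles_at e X \<inter> circles_at f X \<noteq> {} \<longleftrightarrow> circles_at e Y \<inter> circles_at f Y \<noteq> {}"
proof -
  have *: "circles_at e Y \<inter> circles_at f Y \<noteq> {}"
    if XY: "surgery e X Y" and ne: "circles_at e X \<inter> circles_at f X \<noteq> {}"
    for X Y :: "('e, 'v) circle set"
  proof -
    from ne obtain d where "d \<in> circles_at e X" "d \<in> circles_at f X" by blast
    then obtain C i j where C: "Inr C \<in> X" "(f, i, j) \<in> C" "Inr C \<in> circles_at e X"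
      unfolding circles_at_def by blast
    have U: "\<Union> {C. Inr C \<in> X} = \<Union> {C. Inr C \<in> Y}" and D: "disjoint {C. Inr C \<in> X}"
      and XY': "X - circles_at e X = Y - circles_at e Y"
      using XY by (auto simp: surgery_def)
    then obtain C' where C': "Inr C' \<in> Y" "(f, i, j) \<in> C'" using C by blast
    have "Inr C' \<in> circles_at e Y"
    proof (rule ccontr)
      assume "Inr C' \<notin> circles_at e Y"
      then have "Inr C' \<in> X - circles_at e X" using XY' C'(1) by blast
      moreover from this have "C' = C" using D C C' unfolding disjoint_def by blast
      ultimately show False using C(3) by blast
    qed
    moreover have "Inr C' \<in> circles_at f Y" using C' by (auto simp: circles_at_def)
    ultimately show ?thesis by blast
  qed
  show ?thesis using *[OF assms] *[OF surgery_sym[OF assms]] by blast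
qed

text \<open>Both closed formulas involve only circles of \<open>X\<close> and \<open>Z\<close> and
  treat \<open>e\<close> and \<open>f\<close> alike. The types of surgery may differ on the two
  routes, for instance a split and a merge against two half genus maps.\<close>

lemma surgery_composite_commute:
  assumes "surgery e X Y" "surgery f Y Z" "surgery f X Y'" "surgery e Y' Z"
    and "\<phi> \<in> M_power_basis X" "\<psi> \<in> M_power_basis Z"
  shows "surgery_composite e f X Y Z \<phi> \<psi> = surgery_composite f e X Y' Z \<phi> \<psi>"
proof (cases "circles_at e X \<inter> circles_at f X = {}")
  case True
  then have "circles_at e Y \<inter> circles_at f Y = {}" "circles_at f Y' \<inter> circles_at e Y' = {}"
    using surgery_meet_iff[OF assms(1), of f] surgery_meet_iff[OF assms(3), of e] by blast+
  then show ?thesis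
    using surgery_composite_disconnected[OF assms(1,2,5,6)] True
      surgery_composite_disconnected[OF assms(3,4,5,6)]
    by (simp add: Int_commute Un_commute conj_commute add.commute)
next
  case False
  then have "circles_at e Y \<inter> circles_at f Y \<noteq> {}" "circles_at f Y' \<inter> circles_at e Y' \<noteq> {}"
    using surgery_meet_iff[OF assms(1), of f] surgery_meet_iff[OF assms(3), of e] by blast+
  then show ?thesis
    using surgery_composite_connected[OF assms(1,2,5,6)]
      surgery_composite_connected[OF assms(3,4,5,6)]
    by (simp add: Un_commute)
qed

text \<open>One such drop from the V-cube and one from the W-cube make up the degree shift by 2 per
  cohomological degree.\<close>

lemma surgery_entry_degree:
  fixes X Y :: "('e, 'v) circle set"
  assumes "surgery e X Y" "\<phi> \<in> M_power_basis X" "\<psi> \<in> M_power_basis Y"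
    and "surgery_entry e X Y \<phi> \<psi> \<noteq> 0"
  shows "M_power_deg Y \<psi> = M_power_deg X \<phi> - 1"
proof -
  let ?a = "circles_at e X" and ?b = "circles_at e Y"
  have *: "\<forall>c\<in>X - ?a. \<psi> c = \<phi> c" "sum \<psi> ?b + card ?a = sum \<phi> ?a + 1 + card ?b"
    using assms(4) unfolding surgery_entry_eq[OF assms(1-3)] by (auto split: if_splits)
  have fin: "finite X" "finite Y" and XY: "X - ?a = Y - ?b" using assms(1) by (auto simp: surgery_def)
  have deg: "M_power_deg X \<phi> = (\<Sum>c\<in>X - circles_at e X. 1 - int (\<phi> c)) +
      int (card (circles_at e X)) - int (sum \<phi> (circles_at e X))" if "finite X"
    for X :: "('e, 'v) circle set" and \<phi>
    unfolding M_power_deg_def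
    using sum.subset_diff[OF circles_at_subset[of e X] that, of "\<lambda>c. 1 - int (\<phi> c)"]
    by (simp add: sum_subtractf)
  have "(\<Sum>c\<in>Y - ?b. 1 - int (\<psi> c)) = (\<Sum>c\<in>X - ?a. 1 - int (\<phi> c))"
    using * by (intro sum.cong) (auto simp: XY)
  then show ?thesis
    unfolding deg[OF fin(1)] deg[OF fin(2)] using *(2) by linarith
qed


section \<open>Real functions and the ring \<open>Zsqrt3\<close>\<close>

lemma (in vector_space) span_Int_disjoint:
  assumes "independent (A \<union> B)" "A \<inter> B = {}" "v \<in> span A" "v \<in> span B"
  shows "v = 0"
proof -
  have "representation A v = representation B v"
    using representation_extend[OF assms(1,3)] representation_extend[OF assms(1,4)] by simp
  then have "representation A v b = 0" for b
    using representation_ne_zero[of A v b] representation_ne_zero[of B v b] assms(2) by force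
  moreover have "independent A" using assms(1) independent_mono by blast
  ultimately show ?thesis
    using sum_nonzero_representation_eq[of A v] assms(3) by simp
qed

text \<open>The ambient function spaces may have infinite dimension; finiteness enters through
  \<open>S\<close>. A basis \<open>B\<close> of the kernel is extended to a basis \<open>C\<close>
  of \<open>V\<close>, and \<open>f\<close> maps \<open>C - B\<close> bijectively onto a basis of
  the image.\<close>

lemma (in vector_space_pair) rank_nullity:
  assumes lf: "Vector_Spaces.linear s1 s2 f" and V: "vs1.subspace V" and S: "finite S" "V \<subseteq> vs1.span S"
  shows "vs1.dim V = vs1.dim {v \<in> V. f v = 0} + vs2.dim (f ` V)"
proof -
  interpret f: Vector_Spaces.linear s1 s2 f by fact
  let ?K = "{v \<in> V. f v = 0}"
  obtain B where B: "B \<subseteq> ?K" "vs1.independent B" "?K \<subseteq> vs1.span B"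
    using vs1.maximal_independent_subset by blast
  have "B \<subseteq> V" using B by auto
  then obtain C where C: "B \<subseteq> C" "C \<subseteq> V" "vs1.independent C" "V \<subseteq> vs1.span C"
    using vs1.maximal_independent_subset_extend B(2) by blast
  have finC: "finite C"
    using vs1.independent_span_bound[OF S(1) C(3)] C(2) S(2) by blast
  let ?D = "C - B"
  have indD: "vs1.independent ?D" using C(3) vs1.independent_mono by blast
  have "vs1.span ?D \<subseteq> V" using C(2) V by (intro vs1.span_minimal) auto
  have inj: "inj_on f (vs1.span ?D)"
  proof (subst f.inj_on_iff_eq_0)
    show "\<forall>x\<in>vs1.span ?D. f x = 0 \<longrightarrow> x = 0"
    proof (intro ballI impI)
      fix x assume x: "x \<in> vs1.span ?D" "f x = 0"
      then have "x \<in> vs1.span B" using \<open>vs1.span ?D \<subseteq> V\<close> B(3) by blast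
      moreover have "B \<union> ?D = C" using C(1) by blast
      ultimately show "x = 0" using vs1.span_Int_disjoint[of B ?D x] C(3) x(1) by auto
    qed
  qed simp
  have "vs1.dim V = card C" using vs1.basis_card_eq_dim[OF C(2,4,3)] by simp
  moreover have "vs1.dim ?K = card B" using vs1.basis_card_eq_dim[OF B(1,3,2)] by simp
  moreover have "vs2.dim (f ` V) = card (f ` ?D)"
  proof (rule vs2.dim_unique)
    show "f ` ?D \<subseteq> f ` V" using C(2) by auto
    show "vs2.independent (f ` ?D)"
      using f.independent_injective_image[OF indD inj] .
    have "f ` V \<subseteq> vs2.span (f ` C)" using C(4) f.span_image[of C] by auto
    also have "f ` C \<subseteq> insert 0 (f ` ?D)" using B(1) by auto
    then have "vs2.span (f ` C) \<subseteq> vs2.span (f ` ?D)"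
      using vs2.span_mono[of "f ` C" "insert 0 (f ` ?D)"] by simp
    finally show "f ` V \<subseteq> vs2.span (f ` ?D)" .
  qed simp
  moreover have "card (f ` ?D) = card ?D"
    using inj by (meson card_image inj_on_subset vs1.span_superset)
  moreover have "card C = card B + card ?D"
    using finC C(1) by (simp add: card_Diff_subset card_mono finite_subset)
  ultimately show ?thesis by simp
qed

lemma sum_fun_apply: "(\<Sum>a\<in>A. f a) x = (\<Sum>a\<in>A. f a x)" for f :: "'a \<Rightarrow> 'b \<Rightarrow> 'c::comm_monoid_add"
  by (induction A rule: infinite_finite_induct) auto

definition fscale :: "real \<Rightarrow> ('x \<Rightarrow> real) \<Rightarrow> 'x \<Rightarrow> real" where
  "fscale a f = (\<lambda>x. a * f x)"

lemma fscale_apply: "fscale a f x = a * f x"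
  by (simp add: fscale_def)

interpretation fun_space: vector_space fscale
  by standard (auto simp: fscale_def fun_eq_iff algebra_simps)

interpretation fun_spaces: vector_space_pair fscale fscale ..

definition Zsqrt3_independent :: "real set \<Rightarrow> bool" where
  "Zsqrt3_independent R \<longleftrightarrow>
     (\<forall>a. (\<forall>r\<in>R. a r \<in> Zsqrt3) \<longrightarrow> (\<Sum>r\<in>R. a r * r) = 0 \<longrightarrow> (\<forall>r\<in>R. a r = 0))"

lemma Zsqrt3_of_int [simp]: "of_int k \<in> Zsqrt3"
  unfolding Zsqrt3_def by (intro CollectI exI[of _ k] exI[of _ 0]) auto

lemma Zsqrt3_0 [simp]: "0 \<in> Zsqrt3" and Zsqrt3_1 [simp]: "1 \<in> Zsqrt3"
  using Zsqrt3_of_int[of 0] Zsqrt3_of_int[of 1] by auto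

lemma Zsqrt3_sqrt [simp]: "sqrt 3 \<in> Zsqrt3"
  unfolding Zsqrt3_def by (intro CollectI exI[of _ 0] exI[of _ 1]) auto

lemma Zsqrt3_add: "a \<in> Zsqrt3 \<Longrightarrow> b \<in> Zsqrt3 \<Longrightarrow> a + b \<in> Zsqrt3"
proof -
  assume "a \<in> Zsqrt3" "b \<in> Zsqrt3"
  then obtain k l m n where "a = of_int k + of_int l * sqrt 3" "b = of_int m + of_int n * sqrt 3"
    unfolding Zsqrt3_def by blast
  then have "a + b = of_int (k + m) + of_int (l + n) * sqrt 3" by (simp add: algebra_simps)
  then show ?thesis unfolding Zsqrt3_def by blast
qed

lemma Zsqrt3_mult: "a \<in> Zsqrt3 \<Longrightarrow> b \<in> Zsqrt3 \<Longrightarrow> a * b \<in> Zsqrt3"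
proof -
  assume "a \<in> Zsqrt3" "b \<in> Zsqrt3"
  then obtain k l m n where "a = of_int k + of_int l * sqrt 3" "b = of_int m + of_int n * sqrt 3"
    unfolding Zsqrt3_def by blast
  then have "a * b = of_int (k * m + 3 * (l * n)) + of_int (k * n + l * m) * sqrt 3"
    by (simp add: algebra_simps)
  then show ?thesis unfolding Zsqrt3_def by blast
qed

lemma Zsqrt3_uminus: "a \<in> Zsqrt3 \<Longrightarrow> - a \<in> Zsqrt3"
  using Zsqrt3_mult[of "- 1" a] Zsqrt3_of_int[of "- 1"] by simp

lemma Zsqrt3_sum: "(\<And>i. i \<in> I \<Longrightarrow> f i \<in> Zsqrt3) \<Longrightarrow> sum f I \<in> Zsqrt3"
  by (induction I rule: infinite_finite_induct) (auto intro: Zsqrt3_add)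

lemma Zsqrt3_power: "a \<in> Zsqrt3 \<Longrightarrow> a ^ n \<in> Zsqrt3"
  by (induction n) (auto intro: Zsqrt3_mult)

lemma Zsqrt3_of_bool [simp]: "of_bool P \<in> Zsqrt3"
  by (cases P) auto

text \<open>Induction on \<open>T\<close>. A number that satisfies no relation with the generators
  becomes a new generator. If instead d t is a combination of the generators for some nonzero d in
  \<open>Zsqrt3\<close>, all generators are divided by d, which keeps them independent and brings
  \<open>t\<close> into their span.\<close>

lemma finite_in_free_Zsqrt3_module:
  assumes "finite T"
  obtains R where "finite R" "Zsqrt3_independent R"
    "\<And>t. t \<in> T \<Longrightarrow> \<exists>a. (\<forall>r\<in>R. a r \<in> Zsqrt3) \<and> t = (\<Sum>r\<in>R. a r * r)"
proof -
  have "\<exists>R. finite R \<and> Zsqrt3_independent R \<and>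
      (\<forall>t\<in>T. \<exists>a. (\<forall>r\<in>R. a r \<in> Zsqrt3) \<and> t = (\<Sum>r\<in>R. a r * r))"
    using assms
  proof (induction T)
    case empty
    then show ?case by (intro exI[of _ "{}"]) (simp add: Zsqrt3_independent_def)
  next
    case (insert t T)
    then obtain R where R: "finite R" "Zsqrt3_independent R"
      "\<And>t. t \<in> T \<Longrightarrow> \<exists>a. (\<forall>r\<in>R. a r \<in> Zsqrt3) \<and> t = (\<Sum>r\<in>R. a r * r)" by blast
    show ?case
    proof (cases "\<exists>d c. d \<in> Zsqrt3 \<and> d \<noteq> 0 \<and> (\<forall>r\<in>R. c r \<in> Zsqrt3) \<and> d * t = (\<Sum>r\<in>R. c r * r)")
      case True
      then obtain d c where d: "d \<in> Zsqrt3" "d \<noteq> 0" "\<And>r. r \<in> R \<Longrightarrow> c r \<in> Zsqrt3"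
        "d * t = (\<Sum>r\<in>R. c r * r)" by blast
      let ?R = "(\<lambda>r. r / d) ` R"
      have inj: "inj_on (\<lambda>r. r / d) R" using d(2) by (auto intro: inj_onI)
      have sum: "(\<Sum>r\<in>?R. a r * r) = (\<Sum>r\<in>R. a (r / d) * r) / d" for a
        by (simp add: sum.reindex[OF inj] sum_divide_distrib)
      have "Zsqrt3_independent ?R"
        unfolding Zsqrt3_independent_def
      proof (intro allI impI)
        fix a assume a: "\<forall>r\<in>?R. a r \<in> Zsqrt3" "(\<Sum>r\<in>?R. a r * r) = 0"
        then have "(\<Sum>r\<in>R. a (r / d) * r) = 0" using d(2) unfolding sum by simp
        moreover have "\<forall>r\<in>R. a (r / d) \<in> Zsqrt3" using a(1) by blast
        ultimately have "\<forall>r\<in>R. a (r / d) = 0"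
          using R(2)[unfolded Zsqrt3_independent_def, THEN spec, of "\<lambda>r. a (r / d)"] by blast
        then show "\<forall>r\<in>?R. a r = 0" by blast
      qed
      moreover have "\<exists>a. (\<forall>r\<in>?R. a r \<in> Zsqrt3) \<and> s = (\<Sum>r\<in>?R. a r * r)" if s: "s \<in> insert t T" for s
      proof -
        \<comment> \<open>It suffices to express d s in the old generators: for the new number this
          is the assumption, for the others the coefficients are multiplied by d.\<close>
        obtain a where a: "\<And>r. r \<in> R \<Longrightarrow> a r \<in> Zsqrt3" "d * s = (\<Sum>r\<in>R. a r * r)"
        proof (cases "s = t")
          case True
          then show ?thesis using that d by blast
        next
          case False
          then obtain a where a: "\<forall>r\<in>R. a r \<in> Zsqrt3" "s = (\<Sum>r\<in>R. a r * r)"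
            using R(3) s by blast
          then show ?thesis using that[of "\<lambda>r. d * a r"] d(1)
            by (simp add: Zsqrt3_mult sum_distrib_left mult.assoc)
        qed
        then show ?thesis
          unfolding sum using d(2)
          by (intro exI[of _ "\<lambda>r. a (d * r)"]) (auto simp: field_simps)
      qed
      ultimately show ?thesis using R(1) by (intro exI[of _ ?R]) auto
    next
      case False
      have no: "d * t \<noteq> (\<Sum>r\<in>R. c r * r)"
        if "d \<in> Zsqrt3" "d \<noteq> 0" "\<And>r. r \<in> R \<Longrightarrow> c r \<in> Zsqrt3" for d c
        using False that by blast
      have "t \<notin> R"
      proof
        assume "t \<in> R"
        then have "(\<Sum>r\<in>R. of_bool (r = t) * r) = t"
          using R(1) by (subst sum.remove[of _ t]) auto
        then have "1 * t = (\<Sum>r\<in>R. of_bool (r = t) * r)" by simp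
        then show False using no[of 1 "\<lambda>r. of_bool (r = t)"] by simp
      qed
      then have sum: "(\<Sum>r\<in>insert t R. a r * r) = a t * t + (\<Sum>r\<in>R. a r * r)" for a
        using R(1) by simp
      have "Zsqrt3_independent (insert t R)"
        unfolding Zsqrt3_independent_def
      proof (intro allI impI)
        fix a assume a: "\<forall>r\<in>insert t R. a r \<in> Zsqrt3" "(\<Sum>r\<in>insert t R. a r * r) = 0"
        have "a t = 0"
        proof (rule ccontr)
          assume "a t \<noteq> 0"
          moreover have "a t * t = (\<Sum>r\<in>R. (- a r) * r)"
            using a(2) unfolding sum by (simp add: sum_negf)
          ultimately show False
            using no[of "a t" "\<lambda>r. - a r"] a(1) Zsqrt3_uminus by simp
        qed
        moreover from this have "\<forall>r\<in>R. a r = 0"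
          using a R(2) unfolding sum Zsqrt3_independent_def by auto
        ultimately show "\<forall>r\<in>insert t R. a r = 0" by auto
      qed
      moreover have "\<exists>a. (\<forall>r\<in>insert t R. a r \<in> Zsqrt3) \<and> s = (\<Sum>r\<in>insert t R. a r * r)"
        if s: "s \<in> insert t T" for s
      proof (cases "s = t")
        case True
        then show ?thesis unfolding sum using \<open>t \<notin> R\<close> R(1)
          by (intro exI[of _ "\<lambda>r. of_bool (r = t)"]) (auto intro!: sum.neutral)
      next
        case False
        then obtain a where a: "\<forall>r\<in>R. a r \<in> Zsqrt3" "s = (\<Sum>r\<in>R. a r * r)"
          using R(3) s by blast
        then show ?thesis unfolding sum using \<open>t \<notin> R\<close>
          by (intro exI[of _ "a(t := 0)"]) (auto intro!: sum.cong)
      qed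
      ultimately show ?thesis using R(1) by (intro exI[of _ "insert t R"]) auto
    qed
  qed
  then show ?thesis using that by blast
qed


section \<open>Dimension of a quotient tensored with the reals\<close>

text \<open>\<open>real_dim\<close> is a definite description over bases of a module record. An
  injective linear \<open>\<phi>\<close> into functions matches these bases with bases of its image,
  where existence and equal cardinality are known from vector space theory.\<close>

lemma real_dim_eq_dim_image:
  fixes V :: "(real, 'a) module" and \<phi> :: "'a \<Rightarrow> 'x \<Rightarrow> real"
  assumes inj: "inj_on \<phi> (carrier V)"
    and zero: "\<zero>\<^bsub>V\<^esub> \<in> carrier V" "\<phi> \<zero>\<^bsub>V\<^esub> = 0"
    and add: "\<And>x y. x \<in> carrier V \<Longrightarrow> y \<in> carrier V \<Longrightarrow> x \<oplus>\<^bsub>V\<^esub> y \<in> carrier V"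
      "\<And>x y. x \<in> carrier V \<Longrightarrow> y \<in> carrier V \<Longrightarrow> \<phi> (x \<oplus>\<^bsub>V\<^esub> y) = \<phi> x + \<phi> y"
    and smult: "\<And>a x. x \<in> carrier V \<Longrightarrow> a \<odot>\<^bsub>V\<^esub> x \<in> carrier V"
      "\<And>a x. x \<in> carrier V \<Longrightarrow> \<phi> (a \<odot>\<^bsub>V\<^esub> x) = fscale a (\<phi> x)"
    and fin: "finite T" "\<phi> ` carrier V \<subseteq> fun_space.span T"
  shows "real_dim V = fun_space.dim (\<phi> ` carrier V)"
proof -
  let ?W = "\<phi> ` carrier V"
  have inj': "x = y" if "x \<in> carrier V" "y \<in> carrier V" "\<phi> x = \<phi> y" for x y
    using inj that by (auto dest: inj_onD)
  interpret V: abelian_monoid V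
  proof (rule abelian_monoidI)
    fix x y z assume "x \<in> carrier V" "y \<in> carrier V" "z \<in> carrier V"
    then show "x \<oplus>\<^bsub>V\<^esub> y \<oplus>\<^bsub>V\<^esub> z = x \<oplus>\<^bsub>V\<^esub> (y \<oplus>\<^bsub>V\<^esub> z)"
      by (intro inj') (simp_all add: add add.assoc)
  next
    fix x assume "x \<in> carrier V"
    then show "\<zero>\<^bsub>V\<^esub> \<oplus>\<^bsub>V\<^esub> x = x"
      by (intro inj') (simp_all add: add zero)
  next
    fix x y assume "x \<in> carrier V" "y \<in> carrier V"
    then show "x \<oplus>\<^bsub>V\<^esub> y = y \<oplus>\<^bsub>V\<^esub> x"
      by (intro inj') (simp_all add: add add.commute)
  qed (use zero add in auto)
  have finsum: "\<phi> (\<Oplus>\<^bsub>V\<^esub>s\<in>S. c s \<odot>\<^bsub>V\<^esub> s) = (\<Sum>s\<in>S. fscale (c s) (\<phi> s))"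
    if "finite S" "S \<subseteq> carrier V" for S and c :: "'a \<Rightarrow> real"
    using that
  proof (induction S)
    case empty
    then show ?case by (simp add: zero)
  next
    case (insert s S)
    then have 1: "(\<lambda>s. c s \<odot>\<^bsub>V\<^esub> s) \<in> S \<rightarrow> carrier V" "c s \<odot>\<^bsub>V\<^esub> s \<in> carrier V"
      using smult by auto
    have "(\<Oplus>\<^bsub>V\<^esub>s\<in>S. c s \<odot>\<^bsub>V\<^esub> s) \<in> carrier V" using 1(1) by (rule V.finsum_closed)
    with 1 insert show ?case
      by (subst V.finsum_insert) (auto simp: add smult)
  qed
  have finsum_closed: "(\<Oplus>\<^bsub>V\<^esub>s\<in>S. c s \<odot>\<^bsub>V\<^esub> s) \<in> carrier V"
    if "S \<subseteq> carrier V" for S and c :: "'a \<Rightarrow> real"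
    using that smult by (intro V.finsum_closed) auto
  have sumimg: "(\<Sum>b\<in>\<phi> ` S. fscale (u b) b) = (\<Sum>s\<in>S. fscale (u (\<phi> s)) (\<phi> s))"
    if "S \<subseteq> carrier V" for S and u :: "('x \<Rightarrow> real) \<Rightarrow> real"
    using inj_on_subset[OF inj that] by (simp add: sum.reindex)
  have card: "card S = fun_space.dim ?W" if S: "is_finite_basis V S" for S
  proof -
    have S': "finite S" "S \<subseteq> carrier V"
      and ex1: "\<And>v. v \<in> carrier V \<Longrightarrow> \<exists>!c. c \<in> S \<rightarrow>\<^sub>E (UNIV :: real set) \<and> v = (\<Oplus>\<^bsub>V\<^esub>s\<in>S. c s \<odot>\<^bsub>V\<^esub> s)"
      using S by (auto simp: is_finite_basis_def)
    have "fun_space.dim ?W = card (\<phi> ` S)"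
    proof (rule fun_space.dim_unique)
      show "\<phi> ` S \<subseteq> ?W" using S' by auto
      show "?W \<subseteq> fun_space.span (\<phi> ` S)"
      proof
        fix w assume "w \<in> ?W"
        then obtain v where v: "v \<in> carrier V" "w = \<phi> v" by blast
        then obtain c where "v = (\<Oplus>\<^bsub>V\<^esub>s\<in>S. c s \<odot>\<^bsub>V\<^esub> s)" using ex1 by blast
        then have "w = (\<Sum>s\<in>S. fscale (c s) (\<phi> s))" using v finsum[OF S'] by simp
        then show "w \<in> fun_space.span (\<phi> ` S)"
          by (auto intro!: fun_space.span_sum fun_space.span_scale intro: fun_space.span_base)
      qed
      show "fun_space.independent (\<phi> ` S)"
      proof (rule fun_space.independent_if_scalars_zero)
        fix u b assume u: "(\<Sum>b\<in>\<phi> ` S. fscale (u b) b) = 0" and b: "b \<in> \<phi> ` S"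
        have "\<phi> (\<Oplus>\<^bsub>V\<^esub>s\<in>S. (\<lambda>s\<in>S. u (\<phi> s)) s \<odot>\<^bsub>V\<^esub> s) = 0"
          using u unfolding sumimg[OF S'(2)] finsum[OF S'] by simp
        moreover have "\<phi> (\<Oplus>\<^bsub>V\<^esub>s\<in>S. (\<lambda>s\<in>S. 0) s \<odot>\<^bsub>V\<^esub> s) = 0"
          unfolding finsum[OF S'] by (simp add: fun_space.scale_zero_left)
        \<comment> \<open>Two expansions of zero: the uniqueness clause of
          \<open>is_finite_basis\<close> turns them into independence of the images.\<close>
        ultimately have "\<zero>\<^bsub>V\<^esub> = (\<Oplus>\<^bsub>V\<^esub>s\<in>S. (\<lambda>s\<in>S. u (\<phi> s)) s \<odot>\<^bsub>V\<^esub> s)"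
          "\<zero>\<^bsub>V\<^esub> = (\<Oplus>\<^bsub>V\<^esub>s\<in>S. (\<lambda>s\<in>S. 0) s \<odot>\<^bsub>V\<^esub> s)"
          using zero finsum_closed[OF S'(2)] by (auto intro!: inj')
        moreover have "(\<lambda>s\<in>S. u (\<phi> s)) \<in> S \<rightarrow>\<^sub>E (UNIV :: real set)" "(\<lambda>s\<in>S. 0) \<in> S \<rightarrow>\<^sub>E (UNIV :: real set)"
          by auto
        ultimately have "(\<lambda>s\<in>S. u (\<phi> s)) = (\<lambda>s\<in>S. 0)" using ex1[OF zero(1)] by blast
        moreover obtain s where "s \<in> S" "b = \<phi> s" using b by blast
        ultimately show "u b = 0" by (metis restrict_apply')
      qed (use S' in auto)
    qed simp
    then show ?thesis using inj_on_subset[OF inj S'(2)] by (simp add: card_image)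
  qed
  have "\<exists>S. is_finite_basis V S"
  proof -
    obtain B where B: "B \<subseteq> ?W" "fun_space.independent B" "?W \<subseteq> fun_space.span B"
      using fun_space.maximal_independent_subset by blast
    have finB: "finite B"
      using fun_space.independent_span_bound[OF fin(1) B(2)] B(1) fin(2) by blast
    obtain S where S: "S \<subseteq> carrier V" "\<phi> ` S = B" using B(1) unfolding subset_image_iff by blast
    have finS: "finite S"
      using finB inj_on_subset[OF inj S(1)] S(2) finite_imageD by blast
    have "\<exists>!c. c \<in> S \<rightarrow>\<^sub>E (UNIV :: real set) \<and> v = (\<Oplus>\<^bsub>V\<^esub>s\<in>S. c s \<odot>\<^bsub>V\<^esub> s)" if v: "v \<in> carrier V" for v
    proof (rule ex_ex1I)
      have "\<phi> v \<in> fun_space.span B" using v B(3) by blast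
      then obtain u where u: "\<phi> v = (\<Sum>b\<in>B. fscale (u b) b)"
        using fun_space.span_finite[OF finB] by auto
      have "\<phi> v = \<phi> (\<Oplus>\<^bsub>V\<^esub>s\<in>S. (\<lambda>s\<in>S. u (\<phi> s)) s \<odot>\<^bsub>V\<^esub> s)"
        unfolding u finsum[OF finS S(1)] S(2)[symmetric] sumimg[OF S(1)] by simp
      then have "v = (\<Oplus>\<^bsub>V\<^esub>s\<in>S. (\<lambda>s\<in>S. u (\<phi> s)) s \<odot>\<^bsub>V\<^esub> s)"
        using inj' v finsum_closed[OF S(1)] by blast
      then show "\<exists>c. c \<in> S \<rightarrow>\<^sub>E (UNIV :: real set) \<and> v = (\<Oplus>\<^bsub>V\<^esub>s\<in>S. c s \<odot>\<^bsub>V\<^esub> s)"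
        by (intro exI[of _ "\<lambda>s\<in>S. u (\<phi> s)"]) auto
    next
      fix c d :: "'a \<Rightarrow> real"
      assume c: "c \<in> S \<rightarrow>\<^sub>E UNIV \<and> v = (\<Oplus>\<^bsub>V\<^esub>s\<in>S. c s \<odot>\<^bsub>V\<^esub> s)"
        and d: "d \<in> S \<rightarrow>\<^sub>E UNIV \<and> v = (\<Oplus>\<^bsub>V\<^esub>s\<in>S. d s \<odot>\<^bsub>V\<^esub> s)"
      \<comment> \<open>Independence concerns the images in \<open>B\<close>, so the difference of
        the two coefficient families is moved along the inverse of \<open>\<phi>\<close> on
        \<open>S\<close>.\<close>
      define u where "u b = (let s = the_inv_into S \<phi> b in c s - d s)" for b
      have us: "u (\<phi> s) = c s - d s" if "s \<in> S" for s
        using that inj_on_subset[OF inj S(1)] by (simp add: u_def the_inv_into_f_f)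
      have "(\<Sum>s\<in>S. fscale (c s) (\<phi> s)) = (\<Sum>s\<in>S. fscale (d s) (\<phi> s))"
        using c d finsum[OF finS S(1)] by metis
      then have "(\<Sum>b\<in>B. fscale (u b) b) = 0"
        unfolding S(2)[symmetric] sumimg[OF S(1)]
        by (simp add: us fun_space.scale_left_diff_distrib sum_subtractf cong: sum.cong)
      then have "u b = 0" if "b \<in> B" for b
        using fun_space.independentD[OF B(2) finB subset_refl] that by blast
      then have "c s = d s" if "s \<in> S" for s
        using us[OF that] S(2) that by auto
      then show "c = d" using c d by (intro PiE_ext[of c S _ d]) auto
    qed
    then have "is_finite_basis V S"
      using finS S(1) unfolding is_finite_basis_def by (intro conjI ballI)
    then show ?thesis by blast
  qed
  then show ?thesis unfolding real_dim_def using card by (intro the_equality) auto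
qed

section \<open>Quotients of modules of functions\<close>

definition fun_coset :: "('x \<Rightarrow> real) set \<Rightarrow> ('x \<Rightarrow> real) \<Rightarrow> ('x \<Rightarrow> real) set" where
  "fun_coset B z = (\<lambda>b. b + z) ` B"

locale pointwise_module =
  fixes C :: "(real, 'x \<Rightarrow> real) module"
  assumes add_eq: "add C = (+)" and smult_eq: "smult C = fscale"

locale pointwise_quotient = pointwise_module C for C :: "(real, 'x \<Rightarrow> real) module" +
  fixes B :: "('x \<Rightarrow> real) set"
  assumes B_zero: "0 \<in> B" and B_add: "b \<in> B \<Longrightarrow> b' \<in> B \<Longrightarrow> b + b' \<in> B"
    and B_uminus: "b \<in> B \<Longrightarrow> - b \<in> B"
begin

lemma carrier_quotient: "carrier (quotient_module C B) = fun_coset B ` carrier C"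
  by (auto simp: quotient_module_def A_RCOSETS_def' a_r_coset_def' add_eq fun_coset_def)

lemma zero_quotient: "\<zero>\<^bsub>quotient_module C B\<^esub> = fun_coset B 0"
  by (simp add: quotient_module_def fun_coset_def)

lemma in_fun_coset_iff: "x \<in> fun_coset B z \<longleftrightarrow> x - z \<in> B"
  by (auto simp: fun_coset_def image_iff) (metis diff_add_cancel)

lemma fun_coset_eq_iff: "fun_coset B z = fun_coset B w \<longleftrightarrow> z - w \<in> B"
proof
  assume "fun_coset B z = fun_coset B w"
  then have "z \<in> fun_coset B w" using B_zero in_fun_coset_iff[of z z] by simp
  then show "z - w \<in> B" by (simp add: in_fun_coset_iff)
next
  assume zw: "z - w \<in> B"
  have "x - z \<in> B \<longleftrightarrow> x - w \<in> B" for x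
    using B_add[OF _ zw, of "x - z"] B_add[OF _ B_uminus[OF zw], of "x - w"] by auto
  then show "fun_coset B z = fun_coset B w" by (auto simp: in_fun_coset_iff)
qed

lemma add_quotient: "fun_coset B z \<oplus>\<^bsub>quotient_module C B\<^esub> fun_coset B w = fun_coset B (z + w)"
proof -
  have "fun_coset B z \<oplus>\<^bsub>quotient_module C B\<^esub> fun_coset B w =
      {x + y | x y. x \<in> fun_coset B z \<and> y \<in> fun_coset B w}"
    by (auto simp: quotient_module_def set_add_def' add_eq)
  also have "\<dots> = fun_coset B (z + w)"
  proof (intro equalityI subsetI)
    fix x assume "x \<in> {x + y | x y. x \<in> fun_coset B z \<and> y \<in> fun_coset B w}"
    then obtain u v where uv: "x = u + v" "u - z \<in> B" "v - w \<in> B" by (auto simp: in_fun_coset_iff)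
    moreover have "u + v - (z + w) = (u - z) + (v - w)" by (simp add: algebra_simps)
    ultimately show "x \<in> fun_coset B (z + w)" using B_add by (simp only: in_fun_coset_iff)
  next
    fix x assume "x \<in> fun_coset B (z + w)"
    then have "x - w \<in> fun_coset B z" by (simp add: in_fun_coset_iff algebra_simps)
    moreover have "w \<in> fun_coset B w" "x = (x - w) + w" by (simp_all add: in_fun_coset_iff B_zero)
    ultimately show "x \<in> {x + y | x y. x \<in> fun_coset B z \<and> y \<in> fun_coset B w}" by blast
  qed
  finally show ?thesis .
qed

lemma smult_quotient:
  assumes "\<And>b. b \<in> B \<Longrightarrow> fscale a b \<in> B"
  shows "a \<odot>\<^bsub>quotient_module C B\<^esub> fun_coset B z = fun_coset B (fscale a z)"
proof -
  have "a \<odot>\<^bsub>quotient_module C B\<^esub> fun_coset B z = (\<Union>x\<in>fun_coset B z. fun_coset B (fscale a x))"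
    by (simp add: quotient_module_def smult_eq a_r_coset_def' add_eq fun_coset_def UNION_singleton_eq_range)
  also have "\<dots> = fun_coset B (fscale a z)"
  proof -
    have "fun_coset B (fscale a x) = fun_coset B (fscale a z)" if "x \<in> fun_coset B z" for x
      using assms[of "x - z"] that
      by (simp add: fun_coset_eq_iff in_fun_coset_iff fun_space.scale_right_diff_distrib)
    moreover have "z \<in> fun_coset B z" by (simp add: in_fun_coset_iff B_zero)
    ultimately show ?thesis by blast
  qed
  finally show ?thesis .
qed

end

text \<open>First isomorphism theorem: \<open>\<Phi>\<close> is constant on the cosets of its kernel
  and embeds the quotient into functions.\<close>

lemma real_dim_quotient_kernel:
  fixes \<Phi> :: "('x \<Rightarrow> real) \<Rightarrow> 'y \<Rightarrow> real"
  assumes F: "pointwise_module F" "fun_space.subspace (carrier F)"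
    and \<Phi>: "Vector_Spaces.linear fscale fscale \<Phi>"
    and N: "N = {g \<in> carrier F. \<Phi> g = 0}"
    and fin: "finite T" "\<Phi> ` carrier F \<subseteq> fun_space.span T"
  shows "real_dim (quotient_module F N) = fun_space.dim (\<Phi> ` carrier F)"
proof -
  interpret \<Phi>: Vector_Spaces.linear fscale fscale \<Phi> by fact
  have subN: "fun_space.subspace N"
    unfolding N fun_space.subspace_def
    using F(2) by (auto simp: fun_space.subspace_def \<Phi>.add \<Phi>.scale)
  interpret pointwise_quotient F N
    using F(1) subN by (auto simp: pointwise_quotient_def pointwise_quotient_axioms_def
        fun_space.subspace_0 fun_space.subspace_add fun_space.subspace_neg)
  let ?V = "quotient_module F N"
  define \<phi> where "\<phi> X = \<Phi> (SOME x. x \<in> X)" for X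
  have \<phi>: "\<phi> (fun_coset N g) = \<Phi> g" for g
  proof -
    have "g \<in> fun_coset N g" by (simp add: in_fun_coset_iff B_zero)
    then have "(SOME x. x \<in> fun_coset N g) \<in> fun_coset N g"
      by (rule someI[of "\<lambda>x. x \<in> fun_coset N g"])
    then have "(SOME x. x \<in> fun_coset N g) - g \<in> N" by (simp add: in_fun_coset_iff)
    then have "\<Phi> ((SOME x. x \<in> fun_coset N g) - g) = 0" by (simp add: N)
    then show ?thesis by (simp add: \<phi>_def \<Phi>.diff)
  qed
  have img: "\<phi> ` carrier ?V = \<Phi> ` carrier F"
    by (simp add: carrier_quotient image_image \<phi>)
  have smult: "a \<odot>\<^bsub>?V\<^esub> fun_coset N z = fun_coset N (fscale a z)" for a z
    using subN by (intro smult_quotient) (rule fun_space.subspace_scale)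
  have "real_dim ?V = fun_space.dim (\<phi> ` carrier ?V)"
  proof (rule real_dim_eq_dim_image)
    show "inj_on \<phi> (carrier ?V)"
    proof (rule inj_onI)
      fix X Y assume "X \<in> carrier ?V" "Y \<in> carrier ?V" and eq: "\<phi> X = \<phi> Y"
      then obtain g h where gh: "X = fun_coset N g" "Y = fun_coset N h" "g \<in> carrier F" "h \<in> carrier F"
        by (auto simp: carrier_quotient)
      have "\<Phi> g = \<Phi> h" using eq gh \<phi> by simp
      then have "g - h \<in> N"
        using gh(3,4) F(2) by (simp add: N \<Phi>.diff fun_space.subspace_diff)
      then show "X = Y" by (simp add: gh fun_coset_eq_iff)
    qed
    show "\<zero>\<^bsub>?V\<^esub> \<in> carrier ?V" "\<phi> \<zero>\<^bsub>?V\<^esub> = 0"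
      using F(2) by (auto simp: zero_quotient carrier_quotient \<phi> fun_space.subspace_0)
    show "x \<oplus>\<^bsub>?V\<^esub> y \<in> carrier ?V" "\<phi> (x \<oplus>\<^bsub>?V\<^esub> y) = \<phi> x + \<phi> y"
      if "x \<in> carrier ?V" "y \<in> carrier ?V" for x y
      using that F(2)
      by (auto simp: add_quotient carrier_quotient \<phi> \<Phi>.add fun_space.subspace_add)
    show "a \<odot>\<^bsub>?V\<^esub> x \<in> carrier ?V" "\<phi> (a \<odot>\<^bsub>?V\<^esub> x) = fscale a (\<phi> x)"
      if "x \<in> carrier ?V" for a x
      using that F(2)
      by (auto simp: smult carrier_quotient \<phi> \<Phi>.scale fun_space.subspace_scale)
    show "finite T" by fact
    show "\<phi> ` carrier ?V \<subseteq> fun_space.span T" using fin img by simp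
  qed
  then show ?thesis by (simp add: img)
qed

section \<open>Free real modules and tensor symbols\<close>

lemma pointwise_free_module: "pointwise_module (free_module S Y)"
  by standard (auto simp: free_module_def fscale_def fun_eq_iff plus_fun_def)

lemma subspace_free_module:
  fixes Y :: "'a set"
  shows "fun_space.subspace (carrier (free_module UNIV Y))"
proof -
  have "finite {b. f b + g b \<noteq> 0}" if "finite {b. f b \<noteq> 0}" "finite {b. g b \<noteq> 0}" for f g :: "'a \<Rightarrow> real"
    by (rule finite_subset[OF _ finite_UnI[OF that]]) auto
  moreover have "finite {b. c * f b \<noteq> 0}" if "finite {b. f b \<noteq> 0}" for c and f :: "'a \<Rightarrow> real"
    by (rule finite_subset[OF _ that]) auto
  moreover have "carrier (free_module UNIV Y) = {f. finite {b. f b \<noteq> 0} \<and> (\<forall>b. f b \<noteq> 0 \<longrightarrow> b \<in> Y)}"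
    by (auto simp: free_module_def)
  ultimately show ?thesis
    unfolding fun_space.subspace_def
    by (simp add: fscale_apply) (metis add_0)
qed

text \<open>Over the field of all reals, submodules in the sense of module records are the subspaces
  for \<open>fscale\<close> inside the carrier.\<close>

lemma submodule_span_eq_span:
  assumes X: "X \<subseteq> carrier (free_module UNIV Y)"
  shows "submodule_span (real_subring UNIV) (free_module UNIV Y) X = fun_space.span X"
proof -
  let ?F = "free_module UNIV Y"
  interpret pointwise_module ?F by (rule pointwise_free_module)
  have zero_eq: "\<zero>\<^bsub>?F\<^esub> = 0" by (auto simp: free_module_def zero_fun_def)
  note sub = subspace_free_module[of Y]
  have span_sub: "fun_space.span X \<subseteq> carrier ?F" using X sub by (rule fun_space.span_minimal)
  \<comment> \<open>Inverses in the additive monoid of a record are definite descriptions and must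
    be identified with pointwise negation before closure can be checked.\<close>
  have inv: "inv\<^bsub>add_monoid ?F\<^esub> g = - g" if g: "g \<in> carrier ?F" for g
  proof -
    have "- g \<in> carrier ?F" using sub g by (rule fun_space.subspace_neg)
    then show ?thesis
      unfolding m_inv_def
      by (intro the_equality) (auto simp: add_eq zero_eq eq_neg_iff_add_eq_0 add.commute)
  qed
  have "submodule (fun_space.span X) (real_subring UNIV) ?F"
    by (intro submodule.intro subgroup.intro submodule_axioms.intro)
      (use span_sub inv in \<open>auto simp: add_eq zero_eq smult_eq fun_space.span_add fun_space.span_zero
        fun_space.span_scale fun_space.span_neg subset_iff\<close>)
  moreover have "fun_space.span X \<subseteq> H" if H: "submodule H (real_subring UNIV) ?F" "X \<subseteq> H" for H
  proof (rule fun_space.span_minimal[OF H(2)])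
    interpret submodule H "real_subring UNIV" ?F by (rule H)
    show "fun_space.subspace H"
      using one_closed m_closed smult_closed
      by (auto simp: fun_space.subspace_def add_eq zero_eq smult_eq real_subring_def)
  qed
  ultimately show ?thesis
    unfolding submodule_span_def using fun_space.span_superset[of X] by blast
qed

lemma inj_tensor_generator: "inj tensor_generator"
  by (rule injI) (metis (full_types) tensor_generator_def of_bool_eq(1,2) zero_neq_one)

lemma tensor_generator_in_free_module: "h \<in> Y \<Longrightarrow> tensor_generator h \<in> carrier (free_module UNIV Y)"
  by (auto simp: free_module_def tensor_generator_def)

text \<open>Symbols are indicator functions: evaluating a relation at \<open>h\<close> isolates the
  coefficient of the symbol of \<open>h\<close>.\<close>

lemma independent_tensor_generators: "fun_space.independent (tensor_generator ` Y)"
proof -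
  note inj = inj_tensor_generator
  show ?thesis
    unfolding fun_space.independent_explicit_module
  proof (intro allI impI)
    fix t u v assume t: "finite t" "t \<subseteq> tensor_generator ` Y" "(\<Sum>v\<in>t. fscale (u v) v) = 0" "v \<in> t"
    then obtain T where T: "t = tensor_generator ` T" "T \<subseteq> Y" unfolding subset_image_iff by blast
    then obtain h where h: "h \<in> T" "v = tensor_generator h" using t(4) by blast
    have "finite (tensor_generator ` T)" using t(1) T(1) by simp
    then have fT: "finite T" using inj_on_subset[OF inj] by (rule finite_imageD) simp
    have "0 = (\<Sum>v\<in>t. fscale (u v) v) h" using t(3) by simp
    also have "\<dots> = (\<Sum>x\<in>T. u (tensor_generator x) * tensor_generator x h)"
      unfolding T(1) sum_fun_apply
      using inj_on_subset[OF inj, of T] by (simp add: sum.reindex fscale_apply)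
    also have "\<dots> = (\<Sum>x\<in>T. if x = h then u (tensor_generator h) else 0)"
      by (intro sum.cong) (auto simp: tensor_generator_def)
    also have "\<dots> = u v" using fT h by simp
    finally show "u v = 0" by simp
  qed
qed

lemma free_module_expand:
  assumes "g \<in> carrier (free_module S Y)"
  shows "g = (\<Sum>h | g h \<noteq> 0. fscale (g h) (tensor_generator h))"
proof
  fix x
  have fin: "finite {h. g h \<noteq> 0}" using assms by (simp add: free_module_def)
  have "(\<Sum>h | g h \<noteq> 0. fscale (g h) (tensor_generator h)) x =
      (\<Sum>h | g h \<noteq> 0. if h = x then g x else 0)"
    unfolding sum_fun_apply by (intro sum.cong) (auto simp: tensor_generator_def fscale_apply)
  also have "\<dots> = g x" using fin by (simp add: sum.delta)
  finally show "g x = (\<Sum>h | g h \<noteq> 0. fscale (g h) (tensor_generator h)) x" by simp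
qed

text \<open>Intended for cocycles modulo coboundaries. \<open>C_values\<close> allows combinations
  with real coefficients to be compared at each argument by independence over
  \<open>Zsqrt3\<close>.\<close>

locale Zsqrt3_quotient = pointwise_quotient C B for C :: "(real, 'x \<Rightarrow> real) module" and B +
  assumes C_zero: "0 \<in> carrier C" and C_add: "z \<in> carrier C \<Longrightarrow> w \<in> carrier C \<Longrightarrow> z + w \<in> carrier C"
    and C_scale: "a \<in> Zsqrt3 \<Longrightarrow> z \<in> carrier C \<Longrightarrow> fscale a z \<in> carrier C"
    and C_values: "z \<in> carrier C \<Longrightarrow> z x \<in> Zsqrt3"
    and B_scale: "a \<in> Zsqrt3 \<Longrightarrow> b \<in> B \<Longrightarrow> fscale a b \<in> B"
    and B_subset: "B \<subseteq> carrier C"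
begin

abbreviation "Q \<equiv> quotient_module C B"
abbreviation "rels \<equiv> fun_space.span (tensor_relations Q)"

lemma C_sum: "(\<And>i. i \<in> I \<Longrightarrow> f i \<in> carrier C) \<Longrightarrow> sum f I \<in> carrier C"
  by (induction I rule: infinite_finite_induct) (auto intro: C_add C_zero)

lemma B_sum: "(\<And>i. i \<in> I \<Longrightarrow> f i \<in> B) \<Longrightarrow> sum f I \<in> B"
  by (induction I rule: infinite_finite_induct) (auto intro: B_add B_zero)

lemma relation_add:
  assumes "z \<in> carrier C" "w \<in> carrier C"
  shows "tensor_generator (fun_coset B (z + w)) - tensor_generator (fun_coset B z) -
    tensor_generator (fun_coset B w) \<in> rels"
proof (rule fun_space.span_base)
  have "tensor_generator (fun_coset B (z + w)) - tensor_generator (fun_coset B z) -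
      tensor_generator (fun_coset B w) = (\<lambda>t. tensor_generator (fun_coset B z \<oplus>\<^bsub>Q\<^esub> fun_coset B w) t -
      tensor_generator (fun_coset B z) t - tensor_generator (fun_coset B w) t)"
    by (simp add: add_quotient fun_eq_iff fscale_apply)
  moreover have "fun_coset B z \<in> carrier Q" "fun_coset B w \<in> carrier Q"
    using assms by (auto simp: carrier_quotient)
  ultimately show "tensor_generator (fun_coset B (z + w)) - tensor_generator (fun_coset B z) -
      tensor_generator (fun_coset B w) \<in> tensor_relations Q"
    unfolding tensor_relations_def by blast
qed

lemma relation_scale:
  assumes "z \<in> carrier C" "a \<in> Zsqrt3"
  shows "tensor_generator (fun_coset B (fscale a z)) - fscale a (tensor_generator (fun_coset B z)) \<in> rels"
proof (rule fun_space.span_base)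
  have "tensor_generator (fun_coset B (fscale a z)) - fscale a (tensor_generator (fun_coset B z)) =
    (\<lambda>t. tensor_generator (a \<odot>\<^bsub>Q\<^esub> fun_coset B z) t - a * tensor_generator (fun_coset B z) t)"
    using smult_quotient[of a z] B_scale[OF assms(2)] by (simp add: fun_eq_iff fscale_apply)
  moreover have "fun_coset B z \<in> carrier Q"
    using assms by (auto simp: carrier_quotient)
  ultimately show "tensor_generator (fun_coset B (fscale a z)) - fscale a (tensor_generator (fun_coset B z))
      \<in> tensor_relations Q"
    unfolding tensor_relations_def using assms(2) by blast
qed

lemma relation_zero: "tensor_generator (fun_coset B 0) \<in> rels"
  using fun_space.span_neg[OF relation_add[OF C_zero C_zero]] by simp

text \<open>Modulo the relations, passing to symbols is \<open>Zsqrt3\<close>-linear; the empty sum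
  uses that the symbol of the zero coset is a consequence of the relations.\<close>

lemma relation_sum:
  assumes "finite I" "\<And>i. i \<in> I \<Longrightarrow> z i \<in> carrier C" "\<And>i. i \<in> I \<Longrightarrow> a i \<in> Zsqrt3"
  shows "tensor_generator (fun_coset B (\<Sum>i\<in>I. fscale (a i) (z i))) -
    (\<Sum>i\<in>I. fscale (a i) (tensor_generator (fun_coset B (z i)))) \<in> rels"
  using assms
proof (induction I)
  case empty
  then show ?case using relation_zero by (simp only: sum.empty diff_zero)
next
  case (insert i I)
  let ?d = "\<lambda>z. tensor_generator (fun_coset B z)"
  let ?z = "\<Sum>i\<in>I. fscale (a i) (z i)" and ?t = "\<Sum>i\<in>I. fscale (a i) (?d (z i))"
  have z: "?z \<in> carrier C" using insert.prems by (intro C_sum C_scale) auto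
  have IH: "?d ?z - ?t \<in> rels" using insert.IH insert.prems by blast
  have zi: "z i \<in> carrier C" "a i \<in> Zsqrt3" using insert.prems by auto
  have "(?d (fscale (a i) (z i) + ?z) - ?d (fscale (a i) (z i)) - ?d ?z) +
      (?d (fscale (a i) (z i)) - fscale (a i) (?d (z i))) + (?d ?z - ?t) \<in> rels"
    by (intro fun_space.span_add relation_add relation_scale C_scale z IH zi)
  also have "(?d (fscale (a i) (z i) + ?z) - ?d (fscale (a i) (z i)) - ?d ?z) +
      (?d (fscale (a i) (z i)) - fscale (a i) (?d (z i))) + (?d ?z - ?t) =
      ?d (fscale (a i) (z i) + ?z) - (fscale (a i) (?d (z i)) + ?t)"
    by (rule ext) simp
  finally show ?case by (simp only: sum.insert[OF insert.hyps])
qed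

text \<open>
  Injectivity of \<open>Q \<otimes> \<real> \<rightarrow> span (carrier C) / span B\<close>: the real coefficients of an element of the
  kernel lie in a free \<open>Zsqrt3\<close>-module of finite rank, and the coordinates vanish one by one.
\<close>

lemma in_relations:
  assumes g: "g \<in> carrier (free_module UNIV (carrier Q))"
    and rep: "\<And>h. h \<in> carrier Q \<Longrightarrow> rep h \<in> carrier C \<and> fun_coset B (rep h) = h"
    and sum: "(\<Sum>h | g h \<noteq> 0. fscale (g h) (rep h)) \<in> fun_space.span B"
  shows "g \<in> rels"
proof -
  define D where "D = {h. g h \<noteq> 0}"
  have D: "finite D" "D \<subseteq> carrier Q" using g by (auto simp: free_module_def D_def)
  obtain B0 s where B0: "finite B0" "B0 \<subseteq> B"
    and s: "(\<Sum>h\<in>D. fscale (g h) (rep h)) = (\<Sum>b\<in>B0. fscale (s b) b)"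
    using sum unfolding D_def[symmetric] fun_space.span_explicit by auto
  obtain R where R: "finite R" "Zsqrt3_independent R"
    "\<And>t. t \<in> g ` D \<union> s ` B0 \<Longrightarrow> \<exists>a. (\<forall>r\<in>R. a r \<in> Zsqrt3) \<and> t = (\<Sum>r\<in>R. a r * r)"
    using finite_in_free_Zsqrt3_module[of "g ` D \<union> s ` B0"] D(1) B0(1) by blast
  have "\<forall>h\<in>D. \<exists>a. (\<forall>r\<in>R. a r \<in> Zsqrt3) \<and> g h = (\<Sum>r\<in>R. a r * r)" using R(3) by blast
  from bchoice[OF this] obtain a
    where "\<forall>h\<in>D. (\<forall>r\<in>R. a h r \<in> Zsqrt3) \<and> g h = (\<Sum>r\<in>R. a h r * r)" ..
  then have a: "\<And>h r. h \<in> D \<Longrightarrow> r \<in> R \<Longrightarrow> a h r \<in> Zsqrt3"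
    "\<And>h. h \<in> D \<Longrightarrow> g h = (\<Sum>r\<in>R. a h r * r)" by blast+
  have "\<forall>b\<in>B0. \<exists>c. (\<forall>r\<in>R. c r \<in> Zsqrt3) \<and> s b = (\<Sum>r\<in>R. c r * r)" using R(3) by blast
  from bchoice[OF this] obtain c
    where "\<forall>b\<in>B0. (\<forall>r\<in>R. c b r \<in> Zsqrt3) \<and> s b = (\<Sum>r\<in>R. c b r * r)" ..
  then have c: "\<And>b r. b \<in> B0 \<Longrightarrow> r \<in> R \<Longrightarrow> c b r \<in> Zsqrt3"
    "\<And>b. b \<in> B0 \<Longrightarrow> s b = (\<Sum>r\<in>R. c b r * r)" by blast+
  \<comment> \<open>\<open>w r\<close> and \<open>y r\<close> are the coordinates at
    \<open>r\<close> of the combination of representatives and of its expression through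
    \<open>B0\<close>. Their coefficients are back in \<open>Zsqrt3\<close>, so \<open>w r\<close>
    lies in the carrier and \<open>y r\<close> in \<open>B\<close>.\<close>
  define w where "w r = (\<Sum>h\<in>D. fscale (a h r) (rep h))" for r
  define y where "y r = (\<Sum>b\<in>B0. fscale (c b r) b)" for r
  have wC: "w r \<in> carrier C" if "r \<in> R" for r
    unfolding w_def
  proof (intro C_sum C_scale)
    fix h assume "h \<in> D"
    then show "a h r \<in> Zsqrt3" "rep h \<in> carrier C" using a(1) that rep D(2) by blast+
  qed
  have yB: "y r \<in> B" if "r \<in> R" for r
    unfolding y_def
  proof (intro B_sum B_scale)
    fix b assume "b \<in> B0"
    then show "c b r \<in> Zsqrt3" "b \<in> B" using c(1) that B0(2) by blast+
  qed
  have "w r = y r" if r: "r \<in> R" for r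
  proof
    fix x
    have "(\<Sum>r\<in>R. w r x * r) = (\<Sum>h\<in>D. fscale (g h) (rep h)) x"
    proof -
      have "(\<Sum>h\<in>D. fscale (g h) (rep h)) x = (\<Sum>h\<in>D. \<Sum>r\<in>R. a h r * rep h x * r)"
        unfolding sum_fun_apply
        by (intro sum.cong refl) (simp add: fscale_apply a(2) sum_distrib_right sum_distrib_left mult_ac)
      also have "\<dots> = (\<Sum>r\<in>R. w r x * r)"
        by (subst sum.swap) (simp add: w_def sum_fun_apply fscale_apply sum_distrib_right)
      finally show ?thesis by simp
    qed
    moreover have "(\<Sum>r\<in>R. y r x * r) = (\<Sum>b\<in>B0. fscale (s b) b) x"
    proof -
      have "(\<Sum>b\<in>B0. fscale (s b) b) x = (\<Sum>b\<in>B0. \<Sum>r\<in>R. c b r * b x * r)"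
        unfolding sum_fun_apply
        by (intro sum.cong refl) (simp add: fscale_apply c(2) sum_distrib_right sum_distrib_left mult_ac)
      also have "\<dots> = (\<Sum>r\<in>R. y r x * r)"
        by (subst sum.swap) (simp add: y_def sum_fun_apply fscale_apply sum_distrib_right)
      finally show ?thesis by simp
    qed
    ultimately have "(\<Sum>r\<in>R. (w r x - y r x) * r) = 0"
      using s by (simp add: left_diff_distrib sum_subtractf)
    moreover have "\<forall>r\<in>R. w r x - y r x \<in> Zsqrt3"
    proof
      fix r assume "r \<in> R"
      then have "w r x \<in> Zsqrt3" "y r x \<in> Zsqrt3" using wC yB B_subset C_values by blast+
      then show "w r x - y r x \<in> Zsqrt3" using Zsqrt3_add[OF _ Zsqrt3_uminus] by fastforce
    qed
    ultimately have "w r x - y r x = 0"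
      using R(2)[unfolded Zsqrt3_independent_def, THEN spec, of "\<lambda>r. w r x - y r x"] r by blast
    then show "w r x = y r x" by simp
  qed
  then have "fun_coset B (w r) = fun_coset B 0" if "r \<in> R" for r
    using yB[OF that] that by (simp add: fun_coset_eq_iff)
  moreover have "tensor_generator (fun_coset B (w r)) -
      (\<Sum>h\<in>D. fscale (a h r) (tensor_generator h)) \<in> rels" if "r \<in> R" for r
  proof -
    have "(\<Sum>h\<in>D. fscale (a h r) (tensor_generator h)) =
        (\<Sum>h\<in>D. fscale (a h r) (tensor_generator (fun_coset B (rep h))))"
      using rep D(2) by (intro sum.cong refl) auto
    then show ?thesis
      unfolding w_def using relation_sum[OF D(1), of rep "\<lambda>h. a h r"] rep D(2) a(1) that by auto
  qed
  ultimately have "(\<Sum>h\<in>D. fscale (a h r) (tensor_generator h)) \<in> rels" if "r \<in> R" for r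
    using fun_space.span_diff[OF relation_zero] that by fastforce
  \<comment> \<open>Weighting the coordinate relations by the reals \<open>r\<close> and adding them
    up restores the coefficients of \<open>g\<close>.\<close>
  then have "(\<Sum>r\<in>R. fscale r (\<Sum>h\<in>D. fscale (a h r) (tensor_generator h))) \<in> rels"
    by (intro fun_space.span_sum[of R] fun_space.span_scale[of "sum _ D"])
  also have "(\<Sum>r\<in>R. fscale r (\<Sum>h\<in>D. fscale (a h r) (tensor_generator h))) =
      (\<Sum>h\<in>D. fscale (g h) (tensor_generator h))"
    unfolding fun_space.scale_sum_right
    by (subst sum.swap, intro sum.cong refl)
      (simp add: a(2) fun_space.scale_sum_left mult.commute)
  also have "\<dots> = g" using free_module_expand[OF g] by (simp only: D_def)
  finally show ?thesis .
qed

text \<open>Here \<open>fun_space.dim\<close> of a set is the dimension of its real span. The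
  tensored quotient is identified with the span of the carrier modulo the span of \<open>B\<close>,
  realized as the image of a linear map \<open>P\<close> with that kernel; rank-nullity for
  \<open>P\<close> gives the formula.\<close>

theorem real_dim_tensor_reals:
  assumes "finite T" "carrier C \<subseteq> fun_space.span T"
  shows "real_dim (tensor_reals Q) + fun_space.dim B = fun_space.dim (carrier C)"
proof -
  note [simp del] = zero_fun_apply plus_fun_apply minus_apply
  let ?Z = "carrier C" and ?F = "free_module UNIV (carrier Q)"
  obtain \<beta> where \<beta>: "\<beta> \<subseteq> B" "fun_space.independent \<beta>" "B \<subseteq> fun_space.span \<beta>"
    using fun_space.maximal_independent_subset by blast
  have "\<beta> \<subseteq> ?Z" using \<beta>(1) B_subset by blast
  then obtain \<gamma> where \<gamma>: "\<beta> \<subseteq> \<gamma>" "\<gamma> \<subseteq> ?Z" "fun_space.independent \<gamma>" "?Z \<subseteq> fun_space.span \<gamma>"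
    by (rule fun_space.maximal_independent_subset_extend[OF _ \<beta>(2)])
  \<comment> \<open>On the span of the carrier this is the projection along the span of
    \<open>B\<close>; its image serves in place of a second quotient.\<close>
  obtain P where P: "Vector_Spaces.linear fscale fscale P" "\<And>x. x \<in> \<gamma> \<Longrightarrow> P x = (if x \<in> \<beta> then 0 else x)"
    using fun_spaces.linear_independent_extend[OF \<gamma>(3), of "\<lambda>x. if x \<in> \<beta> then 0 else x"] by blast
  interpret P: Vector_Spaces.linear fscale fscale P by (rule P)
  have P\<beta>: "P x = 0" if "x \<in> fun_space.span \<beta>" for x
  proof (rule P.eq_0_on_span[OF _ that])
    show "P y = 0" if "y \<in> \<beta>" for y
      using P(2)[of y] \<gamma>(1) that by auto
  qed
  have P\<delta>: "P x = x" if "x \<in> fun_space.span (\<gamma> - \<beta>)" for x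
    using that
  proof (induction rule: fun_space.span_induct_alt)
    case base
    show ?case by (rule P.zero)
  next
    case (step c x y)
    then show ?case using P(2) by (simp add: P.add P.scale)
  qed
  have decomp: "\<exists>y d. x = y + d \<and> y \<in> fun_space.span \<beta> \<and> d \<in> fun_space.span (\<gamma> - \<beta>)"
    if "x \<in> fun_space.span ?Z" for x
  proof -
    have "x \<in> fun_space.span (\<beta> \<union> (\<gamma> - \<beta>))"
      using that \<gamma>(1,4) fun_space.span_minimal[OF \<gamma>(4) fun_space.subspace_span] by (auto simp: Un_absorb1)
    then show ?thesis unfolding fun_space.span_Un by blast
  qed
  have spanB: "fun_space.span B = fun_space.span \<beta>"
    using fun_space.span_mono[OF \<beta>(1)] fun_space.span_minimal[OF \<beta>(3) fun_space.subspace_span]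
    by (rule subset_antisym[rotated])
  have ker: "x \<in> fun_space.span B \<longleftrightarrow> P x = 0" if x: "x \<in> fun_space.span ?Z" for x
  proof
    assume "P x = 0"
    obtain y d where yd: "x = y + d" "y \<in> fun_space.span \<beta>" "d \<in> fun_space.span (\<gamma> - \<beta>)"
      using decomp[OF x] by blast
    then have "d = 0" using \<open>P x = 0\<close> P\<beta> P\<delta> by (simp add: P.add)
    then show "x \<in> fun_space.span B" using yd spanB by simp
  qed (use P\<beta> spanB in auto)
  define rep where "rep h = (SOME z. z \<in> ?Z \<and> fun_coset B z = h)" for h
  have rep: "rep h \<in> ?Z \<and> fun_coset B (rep h) = h" if "h \<in> carrier Q" for h
  proof -
    have "\<exists>z. z \<in> ?Z \<and> fun_coset B z = h" using that by (auto simp: carrier_quotient)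
    then show ?thesis unfolding rep_def by (rule someI_ex)
  qed
  have Prep: "P (rep (fun_coset B z)) = P z" if "z \<in> ?Z" for z
  proof -
    have "fun_coset B z \<in> carrier Q" using that by (auto simp: carrier_quotient)
    then have "rep (fun_coset B z) - z \<in> B" using rep fun_coset_eq_iff by blast
    then have "P (rep (fun_coset B z) - z) = 0" using P\<beta> \<beta>(3) by blast
    then show ?thesis by (simp add: P.diff)
  qed
  note inj = inj_tensor_generator
  \<comment> \<open>\<open>P\<close> of a representative depends only on the coset, which prescribes
    the map on symbols; as symbols are independent, it extends linearly.\<close>
  obtain \<Phi> where \<Phi>: "Vector_Spaces.linear fscale fscale \<Phi>"
    "\<And>x. x \<in> tensor_generator ` UNIV \<Longrightarrow> \<Phi> x = P (rep (inv_into UNIV tensor_generator x))"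
    using fun_spaces.linear_independent_extend[OF independent_tensor_generators,
        of UNIV "\<lambda>x. P (rep (inv_into UNIV tensor_generator x))"] by blast
  interpret \<Phi>: Vector_Spaces.linear fscale fscale \<Phi> by (rule \<Phi>)
  have \<Phi>gen: "\<Phi> (tensor_generator h) = P (rep h)" for h
    using \<Phi>(2)[of "tensor_generator h"] by (simp add: inv_f_f[OF inj])
  have \<Phi>g: "\<Phi> g = P (\<Sum>h | g h \<noteq> 0. fscale (g h) (rep h))" if "g \<in> carrier ?F" for g
    by (subst free_module_expand[OF that]) (simp add: \<Phi>.sum \<Phi>.scale \<Phi>gen P.sum P.scale)
  have inspan: "(\<Sum>h | g h \<noteq> 0. fscale (g h) (rep h)) \<in> fun_space.span ?Z" if "g \<in> carrier ?F" for g
    using that rep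
    by (auto intro!: fun_space.span_sum fun_space.span_scale intro: fun_space.span_base simp: free_module_def)
  have relF: "tensor_relations Q \<subseteq> carrier ?F"
  proof -
    have "x \<oplus>\<^bsub>Q\<^esub> y \<in> carrier Q" if "x \<in> carrier Q" "y \<in> carrier Q" for x y
      using that C_add by (auto simp: carrier_quotient add_quotient)
    moreover have "a \<odot>\<^bsub>Q\<^esub> x \<in> carrier Q" if "a \<in> Zsqrt3" "x \<in> carrier Q" for a x
      using that C_scale smult_quotient[of a] B_scale by (auto simp: carrier_quotient)
    moreover have "tensor_generator h \<in> carrier ?F" if "h \<in> carrier Q" for h
      using that by (rule tensor_generator_in_free_module)
    ultimately have
      "tensor_generator (x \<oplus>\<^bsub>Q\<^esub> y) - tensor_generator x - tensor_generator y \<in> carrier ?F"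
      "a \<in> Zsqrt3 \<Longrightarrow> tensor_generator (a \<odot>\<^bsub>Q\<^esub> x) - fscale a (tensor_generator x) \<in> carrier ?F"
      if "x \<in> carrier Q" "y \<in> carrier Q" for x y a
      using that
      by (auto intro!: fun_space.subspace_diff[OF subspace_free_module]
          fun_space.subspace_scale[OF subspace_free_module])
    then show ?thesis
      unfolding tensor_relations_def by (auto simp: fun_diff_def fscale_def)
  qed
  have N: "submodule_span (real_subring UNIV) ?F (tensor_relations Q) = {g \<in> carrier ?F. \<Phi> g = 0}"
    unfolding submodule_span_eq_span[OF relF]
  proof (intro equalityI subsetI)
    fix g assume g: "g \<in> rels"
    have "\<Phi> x = 0" if x: "x \<in> tensor_relations Q" for x
    proof -
      have "\<Phi> (tensor_generator (x \<oplus>\<^bsub>Q\<^esub> y) - tensor_generator x - tensor_generator y) = 0"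
        if "x \<in> carrier Q" "y \<in> carrier Q" for x y
        using that by (auto simp: carrier_quotient add_quotient \<Phi>.diff \<Phi>gen Prep C_add P.add)
      moreover have "\<Phi> (tensor_generator (a \<odot>\<^bsub>Q\<^esub> x) - fscale a (tensor_generator x)) = 0"
        if "x \<in> carrier Q" "a \<in> Zsqrt3" for a x
        using that B_scale C_scale
        by (auto simp: carrier_quotient smult_quotient \<Phi>.diff \<Phi>.scale \<Phi>gen Prep P.scale)
      ultimately show ?thesis
        using x unfolding tensor_relations_def by (auto simp: fun_diff_def fscale_def)
    qed
    then show "g \<in> {g \<in> carrier ?F. \<Phi> g = 0}"
      using g \<Phi>.eq_0_on_span fun_space.span_minimal[OF relF subspace_free_module] by blast
  next
    \<comment> \<open>This inclusion is the injectivity of the comparison map and rests on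
      \<open>in_relations\<close>.\<close>
    fix g assume g: "g \<in> {g \<in> carrier ?F. \<Phi> g = 0}"
    then have "(\<Sum>h | g h \<noteq> 0. fscale (g h) (rep h)) \<in> fun_space.span B"
      using \<Phi>g ker[OF inspan] by auto
    then show "g \<in> rels" using in_relations[of g rep] g rep by blast
  qed
  have img: "\<Phi> ` carrier ?F = P ` fun_space.span ?Z"
  proof (intro equalityI subsetI)
    fix x assume "x \<in> \<Phi> ` carrier ?F"
    then show "x \<in> P ` fun_space.span ?Z" using \<Phi>g inspan by blast
  next
    fix x assume "x \<in> P ` fun_space.span ?Z"
    then have "x \<in> fun_space.span (P ` ?Z)" by (simp add: P.span_image)
    moreover have "P ` ?Z \<subseteq> \<Phi> ` carrier ?F"
    proof
      fix p assume "p \<in> P ` ?Z"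
      then obtain z where z: "z \<in> ?Z" "p = P z" by blast
      then have "fun_coset B z \<in> carrier Q" by (auto simp: carrier_quotient)
      then have "tensor_generator (fun_coset B z) \<in> carrier ?F" by (rule tensor_generator_in_free_module)
      moreover have "\<Phi> (tensor_generator (fun_coset B z)) = p" using z by (simp add: \<Phi>gen Prep)
      ultimately show "p \<in> \<Phi> ` carrier ?F" by blast
    qed
    ultimately show "x \<in> \<Phi> ` carrier ?F"
      using fun_space.span_minimal[OF _ \<Phi>.subspace_image[OF subspace_free_module]] by blast
  qed
  have "real_dim (tensor_reals Q) = fun_space.dim (\<Phi> ` carrier ?F)"
    unfolding tensor_reals_def Let_def
  proof (rule real_dim_quotient_kernel[OF pointwise_free_module subspace_free_module \<Phi>(1) N])
    show "finite (P ` T)" using assms by simp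
    have "fun_space.span ?Z \<subseteq> fun_space.span T"
      using fun_space.span_minimal[OF assms(2) fun_space.subspace_span] .
    then show "\<Phi> ` carrier ?F \<subseteq> fun_space.span (P ` T)"
      unfolding img P.span_image by blast
  qed
  moreover have "fun_space.dim (fun_space.span ?Z) =
      fun_space.dim {v \<in> fun_space.span ?Z. P v = 0} + fun_space.dim (P ` fun_space.span ?Z)"
    by (rule fun_spaces.rank_nullity[OF P(1) fun_space.subspace_span assms(1)])
      (rule fun_space.span_minimal[OF assms(2) fun_space.subspace_span])
  moreover have "{v \<in> fun_space.span ?Z. P v = 0} = fun_space.span B"
    using ker fun_space.span_mono[OF B_subset] by auto
  ultimately show ?thesis by (simp add: img)
qed

end


section \<open>The partial dual cube\<close>

definition cube_composite ::
    "('e, 'b) cube \<Rightarrow> 'e set \<Rightarrow> 'e set \<Rightarrow> 'e set \<Rightarrow> 'b \<Rightarrow> 'b \<Rightarrow> real" where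
  "cube_composite K A B C x z = (\<Sum>y\<in>basis K B. entry K A B x y * entry K B C y z)"

text \<open>Matrix form of the interchange law for tensor products of maps; it lets anticommutation
  be settled factor by factor.\<close>

lemma cube_composite_tensor:
  "cube_composite (K \<otimes>\<^sub>c L) A B C (x, x') (z, z') = cube_composite K A B C x z * cube_composite L A B C x' z'"
proof -
  have "cube_composite (K \<otimes>\<^sub>c L) A B C (x, x') (z, z') =
      (\<Sum>(y, y')\<in>basis K B \<times> basis L B.
        (entry K A B x y * entry K B C y z) * (entry L A B x' y' * entry L B C y' z'))"
    unfolding cube_composite_def cube_tensor_def
    by (auto intro!: sum.cong simp: mult_ac)
  also have "\<dots> = cube_composite K A B C x z * cube_composite L A B C x' z'"
    by (simp add: cube_composite_def sum_product sum.cartesian_product)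
  finally show ?thesis .
qed

lemma in_takeWhile_swap:
  "e \<in> set es \<Longrightarrow> f \<in> set es \<Longrightarrow> e \<noteq> f \<Longrightarrow>
    e \<in> set (takeWhile (\<lambda>x. x \<noteq> f) es) \<longleftrightarrow> f \<notin> set (takeWhile (\<lambda>x. x \<noteq> e) es)"
  by (induction es) (auto dest: set_takeWhileD)

lemma length_filter_insert:
  "distinct xs \<Longrightarrow> e \<notin> A \<Longrightarrow>
    length (filter (\<lambda>x. x \<in> insert e A) xs) = length (filter (\<lambda>x. x \<in> A) xs) + of_bool (e \<in> set xs)"
proof (induction xs)
  case (Cons x xs)
  then show ?case by (cases "x = e") auto
qed simp

lemma edge_cond_iff: "edge_cond G A B \<longleftrightarrow> B \<subseteq> edges G \<and> (\<exists>e\<in>B. A = B - {e})"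
  by (auto simp: edge_cond_def)

lemma new_edge_insert [simp]: "e \<notin> A \<Longrightarrow> new_edge A (insert e A) = e"
  by (simp add: insert_Diff_if)

lemma surgery_entry_Zsqrt3: "surgery_entry e X Y \<phi> \<psi> \<in> Zsqrt3"
  unfolding surgery_entry_def mult_const_def comult_const_def half_genus_const_def
  by (auto intro!: Zsqrt3_mult split: prod.split)

locale ordered_ribbon_graph = ribbon_graph G for G :: "('e, 'v) rgraph" +
  fixes es :: "'e list"
  assumes ordering: "edge_ordering G es"
begin

abbreviation "K \<equiv> pd_cube G es"

lemma basis_pd_cube: "basis K A = ((UNIV \<times> {l. length l = card A \<and> set l \<subseteq> {..1}}) \<times>
    M_power_basis (face_disks G A)) \<times> M_power_basis (face_disks G (edges G - A))"
  by (simp add: pd_cube_def cube_tensor_def S_cube_def F_cube_def V_cube_def W_cube_def)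

lemma bideg_pd_cube: "bideg K A (((u, l), \<phi>), \<psi>) = (int (sum_list l),
    M_power_deg (face_disks G A) \<phi> + M_power_deg (face_disks G (edges G - A)) \<psi>)"
  by (simp add: pd_cube_def cube_tensor_def S_cube_def F_cube_def V_cube_def W_cube_def)

lemma entry_pd_cube: "entry K A B (((u, l), \<phi>), \<psi>) (((u', l'), \<phi>'), \<psi>') =
    entry (S_cube es) A B u u' * of_bool (l' = 0 # l) *
    surgery_entry (new_edge A B) (face_disks G A) (face_disks G B) \<phi> \<phi>' *
    surgery_entry (new_edge A B) (face_disks G (edges G - A)) (face_disks G (edges G - B)) \<psi> \<psi>'"
  by (simp add: pd_cube_def cube_tensor_def F_cube_def V_cube_def W_cube_def)

lemma finite_basis: "finite (basis K A)"
proof -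
  have "finite {l. set l \<subseteq> {..1::nat} \<and> length l = card A}" by (rule finite_lists_length_eq) simp
  moreover have "{l. length l = card A \<and> set l \<subseteq> {..1::nat}} = {l. set l \<subseteq> {..1} \<and> length l = card A}"
    by auto
  ultimately show ?thesis
    unfolding basis_pd_cube by (intro finite_cartesian_product finite_M_power_basis finite_face_disks) simp_all
qed

lemma entry_Zsqrt3: "entry K A B b b' \<in> Zsqrt3"
proof -
  have "entry (S_cube es) A B u u' \<in> Zsqrt3" for u u'
    using Zsqrt3_power[OF Zsqrt3_uminus[OF Zsqrt3_1]] by (simp add: S_cube_def)
  then show ?thesis
    by (cases b; cases b'; auto simp: entry_pd_cube intro!: Zsqrt3_mult surgery_entry_Zsqrt3)
qed

lemma surgery_complement:
  assumes "e \<in> edges G" "e \<notin> A"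
  shows "surgery e (face_disks G (edges G - A)) (face_disks G (edges G - insert e A))"
proof -
  have "edges G - A = insert e (edges G - insert e A)" using assms by auto
  then show ?thesis
    using surgery_sym[OF surgery_insert[OF assms(1), of "edges G - insert e A"]] by simp
qed

lemma entry_degree:
  assumes "edge_cond G A B" "b \<in> basis K A" "b' \<in> basis K B" "entry K A B b b' \<noteq> 0"
  shows "bideg K B b' = bideg K A b + (0, - 2)"
proof -
  obtain e where e: "e \<in> edges G" "e \<notin> A" "B = insert e A"
    using assms(1) by (auto simp: edge_cond_def)
  obtain u l \<phi> \<psi> where b: "b = (((u, l), \<phi>), \<psi>)" by (metis surj_pair)
  obtain u' l' \<phi>' \<psi>' where b': "b' = (((u', l'), \<phi>'), \<psi>')" by (metis surj_pair)
  have ne: "l' = 0 # l"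
    "surgery_entry e (face_disks G A) (face_disks G B) \<phi> \<phi>' \<noteq> 0"
    "surgery_entry e (face_disks G (edges G - A)) (face_disks G (edges G - B)) \<psi> \<psi>' \<noteq> 0"
    using assms(4) e unfolding b b' entry_pd_cube by (auto split: if_splits)
  have "M_power_deg (face_disks G B) \<phi>' = M_power_deg (face_disks G A) \<phi> - 1"
    using surgery_entry_degree[OF surgery_insert[OF e(1,2)] _ _ ne(2)[unfolded e(3)]] assms(2,3)
    by (simp add: b b' basis_pd_cube e(3))
  moreover have "M_power_deg (face_disks G (edges G - B)) \<psi>' = M_power_deg (face_disks G (edges G - A)) \<psi> - 1"
    using surgery_entry_degree[OF surgery_complement[OF e(1,2)] _ _ ne(3)[unfolded e(3)]] assms(2,3)
    by (simp add: b b' basis_pd_cube e(3))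
  ultimately show ?thesis
    by (simp add: b b' bideg_pd_cube ne(1))
qed

text \<open>Of two edges one precedes the other in the ordering. Adding the earlier one first raises
  the count for the later one by one; adding the later one first leaves the count for the earlier
  unchanged. So the two routes have opposite signs.\<close>

lemma S_composite_anticommute:
  assumes A: "A \<subseteq> edges G" and e: "e \<in> edges G" "e \<notin> A" and f: "f \<in> edges G" "f \<notin> A" "e \<noteq> f"
  shows "cube_composite (S_cube es) A (insert e A) (insert f (insert e A)) u v =
    - cube_composite (S_cube es) A (insert f A) (insert e (insert f A)) u v"
proof -
  define m where "m A e = length (filter (\<lambda>x. x \<in> A) (takeWhile (\<lambda>x. x \<noteq> e) es))" for A e
  have es: "distinct es" "set es = edges G" using ordering by (auto simp: edge_ordering_def)
  have comp: "cube_composite (S_cube es) A (insert e A) (insert f (insert e A)) u v =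
      (- 1) ^ (m A e + m (insert e A) f)"
    if "e \<notin> A" "f \<notin> A" "e \<noteq> f" for e f and u v :: unit
  proof -
    have 1: "new_edge (insert e A) (insert f (insert e A)) = f" using that by simp
    have 2: "new_edge A (insert e A) = e" using that by simp
    show ?thesis
      unfolding cube_composite_def S_cube_def m_def cube.simps 1 2
      by (simp add: UNIV_unit power_add)
  qed
  have dist: "distinct (takeWhile (\<lambda>x. x \<noteq> e) es)" "distinct (takeWhile (\<lambda>x. x \<noteq> f) es)"
    using es(1) by simp_all
  have swap: "e \<in> set (takeWhile (\<lambda>x. x \<noteq> f) es) \<longleftrightarrow> f \<notin> set (takeWhile (\<lambda>x. x \<noteq> e) es)"
    using in_takeWhile_swap[of e es f] e f es(2) by simp
  have "m (insert e A) f = m A f + of_bool (e \<in> set (takeWhile (\<lambda>x. x \<noteq> f) es))"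
    "m (insert f A) e = m A e + of_bool (f \<in> set (takeWhile (\<lambda>x. x \<noteq> e) es))"
    unfolding m_def by (rule length_filter_insert[OF dist(2) e(2)], rule length_filter_insert[OF dist(1) f(2)])
  then show ?thesis
    using comp[of e f] comp[of f e] e f swap by (simp add: power_add)
qed

text \<open>The result does not involve the edges added, so both routes agree on this
  factor.\<close>

lemma F_composite:
  assumes "finite A" "e \<notin> A" "length l = card A" "set l \<subseteq> {..1}"
  shows "cube_composite F_cube A (insert e A) C l l' = of_bool (l' = 0 # 0 # l)"
proof -
  have fin: "finite {l. length l = card (insert e A) \<and> set l \<subseteq> {..1::nat}}"
    using finite_lists_length_eq[of "{..1::nat}" "card (insert e A)"] by (simp add: conj_commute)
  have "cube_composite F_cube A (insert e A) C l l' =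
      (\<Sum>y\<in>{l. length l = card (insert e A) \<and> set l \<subseteq> {..1}}. if y = 0 # l then of_bool (l' = 0 # 0 # l) else 0)"
    unfolding cube_composite_def F_cube_def cube.simps by (intro sum.cong refl) auto
  also have "\<dots> = of_bool (l' = 0 # 0 # l)"
    using fin assms by (simp add: sum.delta')
  finally show ?thesis .
qed

lemma V_composite:
  "e \<notin> A \<Longrightarrow> f \<notin> insert e A \<Longrightarrow>
    cube_composite (V_cube G) A (insert e A) (insert f (insert e A)) \<phi> \<psi> =
    surgery_composite e f (face_disks G A) (face_disks G (insert e A)) (face_disks G (insert f (insert e A))) \<phi> \<psi>"
  unfolding cube_composite_def V_cube_def surgery_composite_def cube.simps new_edge_insert ..

lemma W_composite:
  "e \<notin> A \<Longrightarrow> f \<notin> insert e A \<Longrightarrow>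
    cube_composite (W_cube G) A (insert e A) (insert f (insert e A)) \<phi> \<psi> =
    surgery_composite e f (face_disks G (edges G - A)) (face_disks G (edges G - insert e A))
      (face_disks G (edges G - insert f (insert e A))) \<phi> \<psi>"
  unfolding cube_composite_def W_cube_def surgery_composite_def cube.simps new_edge_insert ..

text \<open>The S-factor contributes the sign and the other three agree on both routes, the W-factor
  because adding an edge to \<open>A\<close> is a surgery at that edge on the complement.\<close>

lemma pd_composite_anticommute:
  assumes A: "A \<subseteq> edges G" and e: "e \<in> edges G" "e \<notin> A" and f: "f \<in> edges G" "f \<notin> A" "e \<noteq> f"
    and b: "b \<in> basis K A" and b': "b' \<in> basis K (insert e (insert f A))"
  shows "cube_composite K A (insert e A) (insert e (insert f A)) b b' =
    - cube_composite K A (insert f A) (insert e (insert f A)) b b'"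
proof -
  have finA: "finite A" using A finite_edges finite_subset by blast
  have ef: "insert e (insert f A) = insert f (insert e A)" by auto
  obtain u l \<phi> \<psi> where b_eq: "b = (((u, l), \<phi>), \<psi>)" by (metis surj_pair)
  obtain u' l' \<phi>' \<psi>' where b'_eq: "b' = (((u', l'), \<phi>'), \<psi>')" by (metis surj_pair)
  have l: "length l = card A" "set l \<subseteq> {..1}"
    and V: "\<phi> \<in> M_power_basis (face_disks G A)" "\<phi>' \<in> M_power_basis (face_disks G (insert f (insert e A)))"
    and W: "\<psi> \<in> M_power_basis (face_disks G (edges G - A))"
      "\<psi>' \<in> M_power_basis (face_disks G (edges G - insert f (insert e A)))"
    using b b' unfolding b_eq b'_eq basis_pd_cube ef by auto
  have ne: "f \<notin> insert e A" "e \<notin> insert f A" using e f by auto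
  have comV: "surgery_composite e f (face_disks G A) (face_disks G (insert e A)) (face_disks G (insert f (insert e A))) \<phi> \<phi>' =
      surgery_composite f e (face_disks G A) (face_disks G (insert f A)) (face_disks G (insert f (insert e A))) \<phi> \<phi>'"
  proof (rule surgery_composite_commute[OF _ _ _ _ V])
    show "surgery e (face_disks G (insert f A)) (face_disks G (insert f (insert e A)))"
      using surgery_insert[of e "insert f A"] e f unfolding ef by auto
  qed (use e f in \<open>auto intro!: surgery_insert\<close>)
  have comW: "surgery_composite e f (face_disks G (edges G - A)) (face_disks G (edges G - insert e A))
        (face_disks G (edges G - insert f (insert e A))) \<psi> \<psi>' =
      surgery_composite f e (face_disks G (edges G - A)) (face_disks G (edges G - insert f A))
        (face_disks G (edges G - insert f (insert e A))) \<psi> \<psi>'"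
  proof (rule surgery_composite_commute[OF _ _ _ _ W])
    show "surgery e (face_disks G (edges G - insert f A)) (face_disks G (edges G - insert f (insert e A)))"
      using surgery_complement[of e "insert f A"] e f unfolding ef by auto
  qed (use e f in \<open>auto intro!: surgery_complement\<close>)
  have "cube_composite (V_cube G) A (insert e A) (insert f (insert e A)) \<phi> \<phi>' =
      cube_composite (V_cube G) A (insert f A) (insert f (insert e A)) \<phi> \<phi>'"
    using comV V_composite[OF e(2) ne(1)] V_composite[OF f(2) ne(2), unfolded ef] by simp
  moreover have "cube_composite (W_cube G) A (insert e A) (insert f (insert e A)) \<psi> \<psi>' =
      cube_composite (W_cube G) A (insert f A) (insert f (insert e A)) \<psi> \<psi>'"
    using comW W_composite[OF e(2) ne(1)] W_composite[OF f(2) ne(2), unfolded ef] by simp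
  ultimately show ?thesis
    unfolding b_eq b'_eq pd_cube_def cube_composite_tensor
    using S_composite_anticommute[OF A e f, of u u']
    by (simp only: F_composite[OF finA e(2) l] F_composite[OF finA f(2) l] ef mult_minus_left)
qed

lemma coboundary_apply:
  "b' \<in> basis K B \<Longrightarrow> coboundary G es f (B, b') =
    (\<Sum>A | edge_cond G A B. \<Sum>b\<in>basis K A. f (A, b) * entry K A B b b')"
  "b' \<notin> basis K B \<Longrightarrow> coboundary G es f (B, b') = 0"
  by (simp_all add: coboundary_def)

lemma linear_coboundary: "Vector_Spaces.linear fscale fscale (coboundary G es)"
proof (rule Vector_Spaces.linear.intro, unfold_locales)
  show "coboundary G es (f + g) = coboundary G es f + coboundary G es g" for f g
  proof
    fix x show "coboundary G es (f + g) x = (coboundary G es f + coboundary G es g) x"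
      by (cases x) (simp add: coboundary_def sum.distrib distrib_right)
  qed
  show "coboundary G es (fscale a f) = fscale a (coboundary G es f)" for a f
  proof
    fix x show "coboundary G es (fscale a f) x = fscale a (coboundary G es f) x"
      by (cases x) (simp add: coboundary_def fscale_apply sum_distrib_left mult.assoc)
  qed
qed

text \<open>The value at \<open>C\<close> is a sum over ordered pairs of edges removed from
  \<open>C\<close>; exchanging the two edges is an involution that changes the sign of the
  terms.\<close>

lemma coboundary_coboundary: "coboundary G es (coboundary G es f) = 0"
proof
  fix x :: "'e set \<times> ('e, 'v) pd_basis"
  obtain C c where x: "x = (C, c)" by (cases x)
  show "coboundary G es (coboundary G es f) x = 0 x"
  proof (cases "c \<in> basis K C \<and> C \<subseteq> edges G")
    case False
    then show ?thesis
      by (auto simp: x coboundary_def edge_cond_iff)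
  next
    case True
    then have c: "c \<in> basis K C" and C: "C \<subseteq> edges G" by auto
    have finC: "finite C" using C finite_edges finite_subset by blast
    \<comment> \<open>Contribution of the route on which \<open>e'\<close> is added first and
      \<open>e\<close> last.\<close>
    define T where "T e e' = (\<Sum>a\<in>basis K (C - {e} - {e'}).
      f (C - {e} - {e'}, a) * cube_composite K (C - {e} - {e'}) (C - {e}) C a c)" for e e'
    have conds: "{A. edge_cond G A B} = (\<lambda>e. B - {e}) ` B" if "B \<subseteq> edges G" for B
      using that by (auto simp: edge_cond_iff)
    have inj: "inj_on (\<lambda>e. B - {e}) B" for B :: "'e set"
      by (auto intro!: inj_onI)
    have "coboundary G es (coboundary G es f) x =
        (\<Sum>e\<in>C. \<Sum>b\<in>basis K (C - {e}). coboundary G es f (C - {e}, b) * entry K (C - {e}) C b c)"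
      unfolding x coboundary_apply(1)[OF c] conds[OF C] by (simp add: sum.reindex[OF inj])
    also have "\<dots> = (\<Sum>e\<in>C. \<Sum>e'\<in>C - {e}. T e e')"
    proof (intro sum.cong refl)
      fix e assume e: "e \<in> C"
      then have B: "C - {e} \<subseteq> edges G" using C by auto
      have "(\<Sum>b\<in>basis K (C - {e}). coboundary G es f (C - {e}, b) * entry K (C - {e}) C b c) =
          (\<Sum>b\<in>basis K (C - {e}). \<Sum>e'\<in>C - {e}. \<Sum>a\<in>basis K (C - {e} - {e'}).
            f (C - {e} - {e'}, a) * (entry K (C - {e} - {e'}) (C - {e}) a b * entry K (C - {e}) C b c))"
      proof (intro sum.cong refl)
        fix b assume "b \<in> basis K (C - {e})"
        then show "coboundary G es f (C - {e}, b) * entry K (C - {e}) C b c =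
          (\<Sum>e'\<in>C - {e}. \<Sum>a\<in>basis K (C - {e} - {e'}).
            f (C - {e} - {e'}, a) * (entry K (C - {e} - {e'}) (C - {e}) a b * entry K (C - {e}) C b c))"
          unfolding coboundary_apply(1)[OF \<open>b \<in> basis K (C - {e})\<close>] conds[OF B] sum.reindex[OF inj]
          by (simp add: sum_distrib_right mult.assoc)
      qed
      also have "\<dots> = (\<Sum>e'\<in>C - {e}. \<Sum>b\<in>basis K (C - {e}). \<Sum>a\<in>basis K (C - {e} - {e'}).
            f (C - {e} - {e'}, a) * (entry K (C - {e} - {e'}) (C - {e}) a b * entry K (C - {e}) C b c))"
        by (rule sum.swap)
      also have "\<dots> = (\<Sum>e'\<in>C - {e}. T e e')"
        unfolding T_def cube_composite_def sum_distrib_left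
        by (intro sum.cong refl sum.swap)
      finally show "(\<Sum>b\<in>basis K (C - {e}). coboundary G es f (C - {e}, b) * entry K (C - {e}) C b c) =
        (\<Sum>e'\<in>C - {e}. T e e')" .
    qed
    also have "\<dots> = (\<Sum>(e, e')\<in>Sigma C (\<lambda>e. C - {e}). T e e')"
      using finC by (subst sum.Sigma) auto
    also have "\<dots> = 0"
    proof (rule sum_involution_eq_0[where h = "\<lambda>(e, e'). (e', e)"])
      fix p assume p: "p \<in> Sigma C (\<lambda>e. C - {e})"
      obtain e e' where ee: "p = (e, e')" "e \<in> C" "e' \<in> C" "e \<noteq> e'" using p by auto
      define A where "A = C - {e} - {e'}"
      have A: "C - {e'} - {e} = A" "C - {e} = insert e' A" "C - {e'} = insert e A"
        "C = insert e (insert e' A)" "A \<subseteq> edges G" "e \<notin> A" "e' \<notin> A" "e \<in> edges G" "e' \<in> edges G"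
        using ee C by (auto simp: A_def)
      have del: "insert e A - {e} = A" "insert e' A - {e'} = A" using A(6,7) by auto
      have "T e' e = - T e e'"
        unfolding T_def A(2) A(3) del sum_negf[symmetric]
      proof (rule sum.cong[OF refl])
        fix a assume "a \<in> basis K A"
        then show "f (A, a) * cube_composite K A (insert e A) C a c =
            - (f (A, a) * cube_composite K A (insert e' A) C a c)"
          using pd_composite_anticommute[OF A(5) A(8) A(6) A(9) A(7) ee(4), of a c] c A(4) by simp
      qed
      then show "(case (case p of (e, e') \<Rightarrow> (e', e)) of (e, e') \<Rightarrow> T e e') + (case p of (e, e') \<Rightarrow> T e e') = 0"
        by (simp add: ee(1))
    qed auto
    finally show ?thesis by simp
  qed
qed

section \<open>The complex in a fixed bi-degree\<close>

definition generators :: "nat \<Rightarrow> int \<times> int \<Rightarrow> ('e set \<times> ('e, 'v) pd_basis) set" where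
  "generators i mk = {(A, b). A \<subseteq> edges G \<and> card A = i \<and> b \<in> basis K A \<and>
     bideg K A b = (fst mk, snd mk - 2 * int i)}"

lemma cochains_eq: "cochains G es i mk = free_module Zsqrt3 (generators i mk)"
  by (cases mk) (simp add: cochains_def generators_def)

text \<open>The fall of the internal degree by 2 along each cube map is offset by the shift by - 2
  i, so the coboundary preserves the bi-degree.\<close>

lemma coboundary_support:
  assumes f: "{x. f x \<noteq> 0} \<subseteq> generators i mk"
  shows "{x. coboundary G es f x \<noteq> 0} \<subseteq> generators (Suc i) mk"
proof
  fix x assume x: "x \<in> {x. coboundary G es f x \<noteq> 0}"
  obtain B b' where x_eq: "x = (B, b')" by (cases x)
  have b': "b' \<in> basis K B" using x coboundary_apply(2)[of b' B f] by (auto simp: x_eq)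
  have "(\<Sum>A | edge_cond G A B. \<Sum>b\<in>basis K A. f (A, b) * entry K A B b b') \<noteq> 0"
    using x unfolding x_eq mem_Collect_eq coboundary_apply(1)[OF b'] .
  then obtain A where A: "edge_cond G A B" "(\<Sum>b\<in>basis K A. f (A, b) * entry K A B b b') \<noteq> 0"
    by (auto elim: sum.not_neutral_contains_not_neutral)
  then obtain b where b: "b \<in> basis K A" "f (A, b) * entry K A B b b' \<noteq> 0"
    by (auto elim: sum.not_neutral_contains_not_neutral)
  then have gen: "(A, b) \<in> generators i mk" and ent: "entry K A B b b' \<noteq> 0" using f by auto
  obtain e where e: "e \<in> edges G" "e \<notin> A" "B = insert e A" "A \<subseteq> edges G"
    using A(1) by (auto simp: edge_cond_def)
  then have "finite A" using finite_edges finite_subset by blast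
  then have "card B = Suc i" using e gen by (simp add: generators_def)
  moreover have "bideg K B b' = (fst mk, snd mk - 2 * int (Suc i))"
    using entry_degree[OF A(1) b(1) b' ent] gen by (simp add: generators_def)
  ultimately show "x \<in> generators (Suc i) mk"
    using e b' by (auto simp: x_eq generators_def)
qed

lemma finite_all_generators: "finite {(A, b). A \<subseteq> edges G \<and> b \<in> basis K A}"
proof -
  have "{(A, b). A \<subseteq> edges G \<and> b \<in> basis K A} = Sigma (Pow (edges G)) (basis K)" by auto
  then show ?thesis using finite_edges finite_basis by simp
qed

lemma finite_generators: "finite (generators i mk)"
  by (rule finite_subset[OF _ finite_all_generators]) (auto simp: generators_def)

lemma coboundary_Zsqrt3:
  assumes "\<And>x. f x \<in> Zsqrt3"
  shows "coboundary G es f x \<in> Zsqrt3"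
  using assms entry_Zsqrt3
  by (cases x) (auto simp: coboundary_def intro!: Zsqrt3_sum Zsqrt3_mult)

end


section \<open>Cohomology and the graded Euler characteristic\<close>

lemma free_module_carrier_iff:
  "finite Y \<Longrightarrow> f \<in> carrier (free_module S Y) \<longleftrightarrow> range f \<subseteq> S \<and> {x. f x \<noteq> 0} \<subseteq> Y"
  by (auto simp: free_module_def intro: finite_subset)

lemma span_free_module:
  assumes "0 \<in> S" "1 \<in> S"
  shows "fun_space.span (carrier (free_module S Y)) = carrier (free_module UNIV Y)"
    and "fun_space.span (tensor_generator ` Y) = carrier (free_module UNIV Y)"
proof -
  have "tensor_generator ` Y \<subseteq> carrier (free_module S Y)"
    using assms by (auto simp: free_module_def tensor_generator_def of_bool_def split: if_splits)
  then have 1: "fun_space.span (tensor_generator ` Y) \<subseteq> fun_space.span (carrier (free_module S Y))"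
    by (rule fun_space.span_mono)
  have "carrier (free_module S Y) \<subseteq> carrier (free_module UNIV Y)"
    by (auto simp: free_module_def)
  then have 2: "fun_space.span (carrier (free_module S Y)) \<subseteq> carrier (free_module UNIV Y)"
    using subspace_free_module by (rule fun_space.span_minimal)
  have 3: "carrier (free_module UNIV Y) \<subseteq> fun_space.span (tensor_generator ` Y)"
  proof
    fix g assume g: "g \<in> carrier (free_module UNIV Y)"
    then have "{h. g h \<noteq> 0} \<subseteq> Y" by (simp add: free_module_def)
    then have "(\<Sum>h | g h \<noteq> 0. fscale (g h) (tensor_generator h)) \<in> fun_space.span (tensor_generator ` Y)"
      by (intro fun_space.span_sum fun_space.span_scale fun_space.span_base) auto
    then show "g \<in> fun_space.span (tensor_generator ` Y)" using free_module_expand[OF g] by simp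
  qed
  show "fun_space.span (carrier (free_module S Y)) = carrier (free_module UNIV Y)"
    "fun_space.span (tensor_generator ` Y) = carrier (free_module UNIV Y)"
    using 1 2 3 by blast+
qed

lemma dim_free_module: "fun_space.dim (carrier (free_module UNIV Y)) = card Y"
  using fun_space.dim_span_eq_card_independent[OF independent_tensor_generators[of Y]]
  by (simp add: span_free_module(2)[of UNIV] card_image inj_on_subset[OF inj_tensor_generator])

lemma alternating_sum_telescope:
  fixes b :: "nat \<Rightarrow> int"
  shows "(\<Sum>i\<le>n. (- 1) ^ i * (b (Suc i) + b i)) = b 0 + (- 1) ^ n * b (Suc n)"
  by (induction n) (auto simp: algebra_simps)

context ordered_ribbon_graph
begin

abbreviation "\<delta> \<equiv> coboundary G es"
abbreviation "real_cochains i mk \<equiv> carrier (free_module UNIV (generators i mk))"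

interpretation d: Vector_Spaces.linear fscale fscale \<delta>
  by (rule linear_coboundary)

lemma coboundary_cochains:
  assumes "f \<in> carrier (cochains G es i mk)"
  shows "\<delta> f \<in> carrier (cochains G es (Suc i) mk)"
proof -
  have "f x \<in> Zsqrt3" for x
    using assms by (auto simp: cochains_eq free_module_carrier_iff finite_generators)
  then have "range (\<delta> f) \<subseteq> Zsqrt3" using coboundary_Zsqrt3 by blast
  then show ?thesis
    using coboundary_support[of f i mk] assms
    by (simp add: cochains_eq free_module_carrier_iff finite_generators)
qed

lemma cochains_subset_real: "carrier (cochains G es i mk) \<subseteq> real_cochains i mk"
  by (auto simp: cochains_eq free_module_def)

lemma cochains_closed:
  shows "0 \<in> carrier (cochains G es i mk)"
    and "f \<in> carrier (cochains G es i mk) \<Longrightarrow> g \<in> carrier (cochains G es i mk) \<Longrightarrow>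
      f + g \<in> carrier (cochains G es i mk)"
    and "a \<in> Zsqrt3 \<Longrightarrow> f \<in> carrier (cochains G es i mk) \<Longrightarrow> fscale a f \<in> carrier (cochains G es i mk)"
    and "f \<in> carrier (cochains G es i mk) \<Longrightarrow> f x \<in> Zsqrt3"
proof -
  note iff = cochains_eq free_module_carrier_iff[OF finite_generators]
  show "0 \<in> carrier (cochains G es i mk)" by (auto simp: iff)
  show "f x \<in> Zsqrt3" if "f \<in> carrier (cochains G es i mk)" using that by (auto simp: iff)
  show "f + g \<in> carrier (cochains G es i mk)"
    if "f \<in> carrier (cochains G es i mk)" "g \<in> carrier (cochains G es i mk)"
  proof -
    have "f x + g x \<in> Zsqrt3" for x using that by (auto simp: iff intro!: Zsqrt3_add)
    moreover have "{x. f x + g x \<noteq> 0} \<subseteq> {x. f x \<noteq> 0} \<union> {x. g x \<noteq> 0}" by auto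
    ultimately show ?thesis using that unfolding iff by (auto simp: iff)
  qed
  show "fscale a f \<in> carrier (cochains G es i mk)"
    if "a \<in> Zsqrt3" "f \<in> carrier (cochains G es i mk)"
    using that by (auto simp: iff fscale_apply intro!: Zsqrt3_mult)
qed

text \<open>Kernels commute with the extension of scalars. The values of a real cocycle lie in a
  free \<open>Zsqrt3\<close>-module of finite rank; since \<open>\<delta>\<close> has entries in
  \<open>Zsqrt3\<close>, each coordinate function is itself a cocycle over
  \<open>Zsqrt3\<close>.\<close>

lemma span_cocycles: "fun_space.span (cocycles G es i mk) = {f \<in> real_cochains i mk. \<delta> f = 0}"
proof (intro equalityI subsetI)
  fix f assume "f \<in> fun_space.span (cocycles G es i mk)"
  moreover have "fun_space.subspace {f \<in> real_cochains i mk. \<delta> f = 0}"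
    using subspace_free_module[of "generators i mk"]
    by (auto simp: fun_space.subspace_def d.add d.scale)
  moreover have "cocycles G es i mk \<subseteq> {f \<in> real_cochains i mk. \<delta> f = 0}"
    using cochains_subset_real[of i mk] by (auto simp: cocycles_def zero_fun_def)
  ultimately show "f \<in> {f \<in> real_cochains i mk. \<delta> f = 0}"
    using fun_space.span_minimal by blast
next
  fix f assume f: "f \<in> {f \<in> real_cochains i mk. \<delta> f = 0}"
  define D where "D = generators i mk"
  have D: "finite D" "{x. f x \<noteq> 0} \<subseteq> D"
    using f finite_generators by (auto simp: D_def free_module_carrier_iff)
  obtain R where R: "finite R" "Zsqrt3_independent R"
    "\<And>t. t \<in> f ` D \<Longrightarrow> \<exists>a. (\<forall>r\<in>R. a r \<in> Zsqrt3) \<and> t = (\<Sum>r\<in>R. a r * r)"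
    using finite_in_free_Zsqrt3_module[of "f ` D"] D(1) by blast
  have "\<forall>x\<in>D. \<exists>a. (\<forall>r\<in>R. a r \<in> Zsqrt3) \<and> f x = (\<Sum>r\<in>R. a r * r)" using R(3) by blast
  from bchoice[OF this] obtain a
    where a: "\<forall>x\<in>D. (\<forall>r\<in>R. a x r \<in> Zsqrt3) \<and> f x = (\<Sum>r\<in>R. a x r * r)" ..
  define g where "g r x = (if x \<in> D then a x r else 0)" for r x
  have f_eq: "f = (\<Sum>r\<in>R. fscale r (g r))"
  proof
    fix x
    have "(\<Sum>r\<in>R. fscale r (g r)) x = (\<Sum>r\<in>R. g r x * r)"
      by (simp add: sum_fun_apply fscale_apply mult.commute)
    also have "\<dots> = f x"
      using a D(2) by (cases "x \<in> D") (auto simp: g_def)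
    finally show "f x = (\<Sum>r\<in>R. fscale r (g r)) x" by simp
  qed
  have g: "g r \<in> carrier (cochains G es i mk)" if "r \<in> R" for r
    using that a by (auto simp: cochains_eq free_module_carrier_iff finite_generators g_def D_def)
  have "\<delta> (g r) = 0" if r: "r \<in> R" for r
  proof
    fix x
    have "(\<Sum>r\<in>R. \<delta> (g r) x * r) = \<delta> f x"
      by (subst f_eq) (simp add: d.sum d.scale sum_fun_apply fscale_apply mult.commute)
    also have "\<dots> = 0" using f by simp
    finally have "(\<Sum>r\<in>R. \<delta> (g r) x * r) = 0" .
    moreover have "\<forall>r\<in>R. \<delta> (g r) x \<in> Zsqrt3"
      using coboundary_Zsqrt3 cochains_closed(4)[OF g] by blast
    ultimately show "\<delta> (g r) x = 0 x"
      using R(2)[unfolded Zsqrt3_independent_def, THEN spec, of "\<lambda>r. \<delta> (g r) x"] r by simp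
  qed
  then have "g r \<in> cocycles G es i mk" if "r \<in> R" for r
    using g that by (simp add: cocycles_def zero_fun_def)
  then show "f \<in> fun_space.span (cocycles G es i mk)"
    unfolding f_eq by (intro fun_space.span_sum fun_space.span_scale fun_space.span_base) auto
qed

lemma coboundaries_subset: "coboundaries G es i mk \<subseteq> cocycles G es i mk"
proof (cases i)
  case 0
  have "\<delta> 0 = 0" by (rule d.zero)
  then show ?thesis
    using cochains_closed(1)[of 0 mk] by (simp add: 0 coboundaries_def cocycles_def zero_fun_def)
next
  case (Suc j)
  have "\<delta> (\<delta> f) = (\<lambda>_. 0)" for f using coboundary_coboundary[of f] by (simp add: zero_fun_def)
  then show ?thesis
    using coboundary_cochains[of _ j mk] by (auto simp: Suc coboundaries_def cocycles_def)
qed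

text \<open>Turns cohomology over \<open>Zsqrt3\<close> into linear algebra over the reals. The work
  is to verify the \<open>Zsqrt3_quotient\<close> conditions, where degree 0 is separate because its
  coboundaries are zero by definition.\<close>

lemma real_dim_cohomology:
  "real_dim (tensor_reals (cohomology G es i mk)) + fun_space.dim (coboundaries G es i mk) =
    fun_space.dim {f \<in> real_cochains i mk. \<delta> f = 0}"
proof -
  let ?C = "(cochains G es i mk)\<lparr>carrier := cocycles G es i mk\<rparr>" and ?B = "coboundaries G es i mk"
  note [simp del] = zero_fun_apply plus_fun_apply minus_apply
  interpret Zsqrt3_quotient ?C ?B
  proof
    show "add ?C = (+)" "smult ?C = fscale"
      using pointwise_free_module[of Zsqrt3 "generators i mk"]
      by (simp_all add: cochains_eq pointwise_module_def)
    show B0: "0 \<in> ?B"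
    proof (cases i)
      case 0
      then show ?thesis by (simp add: coboundaries_def zero_fun_def[symmetric])
    next
      case (Suc j)
      have "\<delta> 0 \<in> \<delta> ` carrier (cochains G es j mk)" using cochains_closed(1) by (rule imageI)
      then show ?thesis by (simp add: Suc coboundaries_def d.zero)
    qed
    show Badd: "b + b' \<in> ?B" if "b \<in> ?B" "b' \<in> ?B" for b b'
    proof (cases i)
      case 0
      then show ?thesis using that by (simp add: coboundaries_def zero_fun_def[symmetric])
    next
      case (Suc j)
      with that obtain f g where "b = \<delta> f" "b' = \<delta> g" "f \<in> carrier (cochains G es j mk)"
        "g \<in> carrier (cochains G es j mk)" by (auto simp: coboundaries_def)
      then show ?thesis
        using cochains_closed(2)[of f j mk g] by (auto simp: Suc coboundaries_def d.add[symmetric])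
    qed
    show Bscale: "fscale a b \<in> ?B" if "a \<in> Zsqrt3" "b \<in> ?B" for a b
    proof (cases i)
      case 0
      then show ?thesis using that by (simp add: coboundaries_def zero_fun_def[symmetric])
    next
      case (Suc j)
      with that obtain f where "b = \<delta> f" "f \<in> carrier (cochains G es j mk)"
        by (auto simp: coboundaries_def)
      then show ?thesis
        using cochains_closed(3)[OF that(1), of f j mk] by (auto simp: Suc coboundaries_def d.scale[symmetric])
    qed
    show "- b \<in> ?B" if "b \<in> ?B" for b
    proof -
      have "fscale (- 1) b = - b" by (rule ext) (simp add: fscale_apply)
      then show ?thesis using Bscale[OF Zsqrt3_uminus[OF Zsqrt3_1] that] by simp
    qed
    show "0 \<in> carrier ?C" using B0 coboundaries_subset[of i mk] by auto
    show "z + w \<in> carrier ?C" if "z \<in> carrier ?C" "w \<in> carrier ?C" for z w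
      using that cochains_closed(2)[of z i mk w]
      by (simp add: cocycles_def zero_fun_def[symmetric] d.add)
    show "fscale a z \<in> carrier ?C" if "a \<in> Zsqrt3" "z \<in> carrier ?C" for a z
      using that cochains_closed(3)[of a z i mk]
      by (simp add: cocycles_def zero_fun_def[symmetric] d.scale)
    show "z x \<in> Zsqrt3" if "z \<in> carrier ?C" for z x
      using that cochains_closed(4)[of z i mk x] by (simp add: cocycles_def)
    show "?B \<subseteq> carrier ?C" using coboundaries_subset[of i mk] by simp
  qed
  have "cocycles G es i mk \<subseteq> fun_space.span (tensor_generator ` generators i mk)"
    using cochains_subset_real[of i mk] unfolding span_free_module(2)[of UNIV, simplified]
    by (auto simp: cocycles_def)
  then have "real_dim (tensor_reals (quotient_module ?C ?B)) + fun_space.dim ?B = fun_space.dim (cocycles G es i mk)"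
    using real_dim_tensor_reals[of "tensor_generator ` generators i mk"] finite_generators by simp
  also have "\<dots> = fun_space.dim {f \<in> real_cochains i mk. \<delta> f = 0}"
    using fun_space.dim_span[of "cocycles G es i mk"] by (simp add: span_cocycles)
  finally show ?thesis by (simp add: cohomology_def)
qed

text \<open>Indexed by the target: the rank of the differential into degree \<open>i\<close>. The
  differential leaving degree \<open>i\<close> has index \<open>Suc i\<close>.\<close>

definition boundary_rank :: "int \<times> int \<Rightarrow> nat \<Rightarrow> nat" where
  "boundary_rank mk i = fun_space.dim (coboundaries G es i mk)"

lemma boundary_rank_0: "boundary_rank mk 0 = 0"
proof -
  have "coboundaries G es 0 mk = {0}" by (simp add: coboundaries_def zero_fun_def)
  then show ?thesis
    unfolding boundary_rank_def using fun_space.dim_unique[of "{}" "{0}" 0] fun_space.independent_empty by simp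
qed

lemma card_generators:
  "card (generators i mk) = fun_space.dim {f \<in> real_cochains i mk. \<delta> f = 0} + boundary_rank mk (Suc i)"
proof -
  have "fun_space.dim (real_cochains i mk) =
      fun_space.dim {f \<in> real_cochains i mk. \<delta> f = 0} + fun_space.dim (\<delta> ` real_cochains i mk)"
  proof (rule fun_spaces.rank_nullity[OF linear_coboundary subspace_free_module])
    show "finite (tensor_generator ` generators i mk)" using finite_generators by simp
  qed (simp add: span_free_module(2)[of UNIV])
  moreover have "fun_space.dim (\<delta> ` real_cochains i mk) = boundary_rank mk (Suc i)"
  proof -
    have "\<delta> ` real_cochains i mk = fun_space.span (coboundaries G es (Suc i) mk)"
      using span_free_module(1)[of Zsqrt3 "generators i mk"]
      by (simp add: coboundaries_def d.span_image cochains_eq)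
    then show ?thesis by (simp add: boundary_rank_def)
  qed
  ultimately show ?thesis by (simp add: dim_free_module)
qed

lemma boundary_rank_top: "boundary_rank mk (Suc (card (edges G))) = 0"
proof -
  have "f = 0" if "f \<in> carrier (cochains G es (Suc (card (edges G))) mk)" for f
  proof
    fix x
    have "generators (Suc (card (edges G))) mk = {}"
    proof (rule equals0I)
      fix y assume "y \<in> generators (Suc (card (edges G))) mk"
      then obtain A where "A \<subseteq> edges G" "card A = Suc (card (edges G))"
        unfolding generators_def by blast
      then show False using card_mono[OF finite_edges, of A] by simp
    qed
    then have "{x. f x \<noteq> 0} \<subseteq> {}" using that by (simp add: cochains_eq free_module_def)
    then show "f x = 0 x" by (auto simp del: split_paired_All)
  qed
  then have "coboundaries G es (Suc (card (edges G))) mk \<subseteq> {0}"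
    using coboundary_cochains[of _ "card (edges G)" mk] by (auto simp: coboundaries_def)
  then show ?thesis
    unfolding boundary_rank_def
    using fun_space.dim_unique[of "{}" _ 0] fun_space.independent_empty by simp
qed

text \<open>Euler-Poincare principle: each rank occurs in two neighbouring degrees with opposite
  signs, and the ranks at both ends vanish.\<close>

lemma alternating_real_dim_cohomology:
  "(\<Sum>i\<le>card (edges G). (- 1) ^ i * int (real_dim (tensor_reals (cohomology G es i mk)))) =
    (\<Sum>i\<le>card (edges G). (- 1) ^ i * int (card (generators i mk)))"
proof -
  let ?b = "\<lambda>i. int (boundary_rank mk i)"
  have "int (card (generators i mk)) = int (real_dim (tensor_reals (cohomology G es i mk))) + (?b (Suc i) + ?b i)" for i
    using card_generators[of i mk] real_dim_cohomology[of i mk] by (simp add: boundary_rank_def)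
  then have "(\<Sum>i\<le>card (edges G). (- 1) ^ i * int (card (generators i mk))) =
      (\<Sum>i\<le>card (edges G). (- 1) ^ i * int (real_dim (tensor_reals (cohomology G es i mk)))) +
      (\<Sum>i\<le>card (edges G). (- 1) ^ i * (?b (Suc i) + ?b i))"
    by (simp add: distrib_left sum.distrib)
  moreover have "(\<Sum>i\<le>card (edges G). (- 1) ^ i * (?b (Suc i) + ?b i)) = 0"
    using alternating_sum_telescope[of ?b "card (edges G)"]
    by (simp add: boundary_rank_0 boundary_rank_top)
  ultimately show ?thesis by simp
qed

text \<open>The sum over all bi-degrees in \<open>qdim\<close> needs finite support; the bi-degrees
  of basis vectors, shifted back by 2 i, provide it.\<close>

lemma lookup_qdim_cohomology:
  "Poly_Mapping.lookup (qdim (cohomology G es i)) mk = int (real_dim (tensor_reals (cohomology G es i mk)))"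
proof -
  let ?h = "\<lambda>mk. int (real_dim (tensor_reals (cohomology G es i mk)))"
  let ?M = "(\<lambda>(A, b). (fst (bideg K A b), snd (bideg K A b) + 2 * int i)) ` {(A, b). A \<subseteq> edges G \<and> b \<in> basis K A}"
  have zero: "?h mk = 0" if "mk \<notin> ?M" for mk
  proof -
    have "generators i mk = {}"
    proof (rule equals0I)
      fix x assume "x \<in> generators i mk"
      then have "x \<in> {(A, b). A \<subseteq> edges G \<and> b \<in> basis K A}"
        "mk = (\<lambda>(A, b). (fst (bideg K A b), snd (bideg K A b) + 2 * int i)) x"
        by (auto simp: generators_def)
      then show False using that by blast
    qed
    then show ?thesis using card_generators[of i mk] real_dim_cohomology[of i mk] by simp
  qed
  let ?M' = "insert mk ?M"
  have fin: "finite ?M'" using finite_all_generators by simp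
  have "qdim (cohomology G es i) = (\<Sum>mk\<in>?M'. Poly_Mapping.single mk (?h mk))"
    unfolding qdim_def
    by (rule Sum_any.expand_superset[OF fin]) (use zero in fastforce)
  then have "Poly_Mapping.lookup (qdim (cohomology G es i)) mk =
      (\<Sum>l\<in>?M'. if l = mk then ?h mk else 0)"
    by (auto simp: lookup_sum lookup_single when_def intro!: sum.cong)
  also have "\<dots> = ?h mk" using fin by (simp only: sum.delta) simp
  finally show ?thesis .
qed

lemma lookup_graded_euler_char:
  "Poly_Mapping.lookup (graded_euler_char G es) mk =
    (\<Sum>i\<le>card (edges G). (- 1) ^ i * int (card (generators i mk)))"
proof -
  have *: "Poly_Mapping.lookup ((- 1) ^ i * p) mk = (- 1) ^ i * Poly_Mapping.lookup p mk" for i and p :: laurent2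
    by (cases "even i") (simp_all add: uminus_poly_mapping.rep_eq)
  show ?thesis
    unfolding graded_euler_char_def alternating_real_dim_cohomology[symmetric]
    by (simp add: lookup_sum * lookup_qdim_cohomology atLeast0AtMost)
qed

end


section \<open>Partial duals\<close>

lemma rtrancl_conjugate:
  assumes "\<And>x y. (x, y) \<in> R \<longleftrightarrow> (h x, h y) \<in> S" "\<And>x. h (h x) = x"
  shows "(x, y) \<in> R\<^sup>* \<longleftrightarrow> (h x, h y) \<in> S\<^sup>*"
proof
  assume "(x, y) \<in> R\<^sup>*"
  then show "(h x, h y) \<in> S\<^sup>*"
    by (induction rule: rtrancl_induct) (use assms(1) in \<open>auto intro: rtrancl_into_rtrancl\<close>)
next
  assume "(h x, h y) \<in> S\<^sup>*"
  then have "(x, h (h y)) \<in> R\<^sup>*"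
  proof (induction rule: rtrancl_induct)
    case base
    then show ?case by (simp add: assms(2))
  next
    case (step y z)
    then show ?case using assms by (metis rtrancl_into_rtrancl)
  qed
  then show "(x, y) \<in> R\<^sup>*" by (simp add: assms(2))
qed

text \<open>The involution carries the classes of one relation bijectively onto those of the other;
  it will be \<open>dual_corner A\<close>.\<close>

lemma card_classes_conjugate:
  assumes RS: "\<And>x y. (x, y) \<in> R \<longleftrightarrow> (h x, h y) \<in> S" and h: "\<And>x. h (h x) = x"
    and C: "\<And>x. h x \<in> C \<longleftrightarrow> x \<in> C"
  shows "card ((\<lambda>x. R\<^sup>* `` {x}) ` C) = card ((\<lambda>x. S\<^sup>* `` {x}) ` C)"
proof -
  have cls: "R\<^sup>* `` {x} = h ` (S\<^sup>* `` {h x})" for x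
  proof (intro equalityI subsetI)
    fix y assume "y \<in> R\<^sup>* `` {x}"
    then have "h y \<in> S\<^sup>* `` {h x}" using rtrancl_conjugate[OF RS h] by blast
    then have "h (h y) \<in> h ` (S\<^sup>* `` {h x})" by (rule imageI)
    then show "y \<in> h ` (S\<^sup>* `` {h x})" by (simp add: h)
  next
    fix y assume "y \<in> h ` (S\<^sup>* `` {h x})"
    then obtain z where "(h x, z) \<in> S\<^sup>*" "y = h z" by blast
    then show "y \<in> R\<^sup>* `` {x}" using rtrancl_conjugate[OF RS h, of x y] by (simp add: h)
  qed
  have hC: "h ` C = C"
  proof (intro equalityI subsetI)
    fix x assume "x \<in> C"
    then have "h (h x) \<in> h ` C" using C by blast
    then show "x \<in> h ` C" by (simp add: h)
  qed (use C in auto)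
  have "(\<lambda>x. R\<^sup>* `` {x}) ` C = (`) h ` (\<lambda>x. S\<^sup>* `` {x}) ` (h ` C)"
    by (simp add: cls image_image)
  moreover have "inj h" using h by (rule inj_on_inverseI)
  then have "inj ((`) h)" by (intro injI) (simp add: inj_image_eq_iff)
  ultimately show ?thesis unfolding hC by (simp add: card_image inj_on_subset)
qed

lemma dual_corner_dual_corner [simp]: "dual_corner A (dual_corner A c) = c"
  by (cases c) (simp add: dual_corner_def)

lemma fst_dual_corner [simp]: "fst (dual_corner A c) = fst c"
  by (cases c) (simp add: dual_corner_def)

text \<open>Swapping the bits at ribbons in \<open>A\<close> exchanges their segments and free
  sides. This is the core of partial duality: the subgraph \<open>B\<close> of the dual corresponds
  to the symmetric difference of \<open>A\<close> and \<open>B\<close> in \<open>G\<close>.\<close>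

lemma dual_corner_side_step:
  "dual_corner A (side_step B c) = side_step (sym_diff A B) (dual_corner A c)"
  by (cases c) (auto simp: dual_corner_def side_step_def)

lemma dual_corner_in_corners [simp]: "dual_corner A c \<in> corners G \<longleftrightarrow> c \<in> corners G"
  by (simp add: in_corners_iff)

lemma corners_partial_dual [simp]: "corners (partial_dual G A) = corners G"
  by (simp add: corners_def partial_dual_def)

lemma partial_dual_simps [simp]:
  "verts (partial_dual G A) = face_disks G A"
  "edges (partial_dual G A) = edges G"
  "arc (partial_dual G A) c = dual_corner A (arc G (dual_corner A c))"
  "disk_at (partial_dual G A) c = Inr (circle_of G A (dual_corner A c))"
  by (simp_all add: partial_dual_def)

lemma boundary_steps_partial_dual:
  "(c, c') \<in> boundary_steps (partial_dual G A) B \<longleftrightarrow>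
    (dual_corner A c, dual_corner A c') \<in> boundary_steps G (sym_diff A B)"
proof -
  have "c' = dual_corner A (arc G (dual_corner A c)) \<longleftrightarrow> dual_corner A c' = arc G (dual_corner A c)"
    by (metis dual_corner_dual_corner)
  moreover have "c' = side_step B c \<longleftrightarrow> dual_corner A c' = side_step (sym_diff A B) (dual_corner A c)"
    by (metis dual_corner_dual_corner dual_corner_side_step)
  ultimately show ?thesis
    unfolding boundary_steps_iff by simp
qed

lemma boundary_steps_cong:
  assumes "\<And>e. e \<in> edges G \<Longrightarrow> e \<in> A \<longleftrightarrow> e \<in> B"
  shows "boundary_steps G A = boundary_steps G B"
proof -
  have "side_step A c = side_step B c" if "c \<in> corners G" for c
    using assms that by (auto simp: side_step_def in_corners_iff)
  then show ?thesis by (auto simp: boundary_steps_iff)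
qed

text \<open>Arcs and both kinds of sides are allowed, a set of moves that \<open>dual_corner\<close>
  merely permutes. The classes stand for the components that contain a ribbon, which makes their
  number visibly invariant under partial duality.\<close>

definition surface_steps :: "('e, 'v) rgraph \<Rightarrow> 'e corner rel" where
  "surface_steps G = boundary_steps G {} \<union> boundary_steps G (edges G)"

lemma surface_steps_partial_dual:
  "(c, c') \<in> surface_steps (partial_dual G A) \<longleftrightarrow>
    (dual_corner A c, dual_corner A c') \<in> surface_steps G"
proof -
  have "side_step (sym_diff A (edges G)) x = y \<or> side_step A x = y \<longleftrightarrow>
      side_step {} x = y \<or> side_step (edges G) x = y" if "x \<in> corners G" for x y
    using that by (auto simp: side_step_def in_corners_iff)
  then show ?thesis
    unfolding surface_steps_def Un_iff boundary_steps_partial_dual partial_dual_simps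
    unfolding boundary_steps_iff by (metis Diff_empty Un_empty_right empty_Diff)
qed

definition isolated_verts :: "('e, 'v) rgraph \<Rightarrow> 'v set" where
  "isolated_verts G = verts G - disk_at G ` corners G"

context ribbon_graph
begin

lemma card_face_disks:
  "card (face_disks G A) = card (isolated_verts G) + card (circle_of G A ` corners G)"
proof -
  have "corners G // (boundary_steps G A)\<^sup>* = circle_of G A ` corners G"
    by (auto simp: quotient_def)
  then have eq: "face_disks G A = Inl ` isolated_verts G \<union> Inr ` (circle_of G A ` corners G)"
    by (simp add: face_disks_def isolated_verts_def)
  have "finite (isolated_verts G)" using finite_verts by (simp add: isolated_verts_def)
  then show ?thesis
    unfolding eq using finite_corners by (subst card_Un_disjoint) (auto simp: card_image)
qed

lemma sym_surface_steps: "sym (surface_steps G)"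
  unfolding surface_steps_def using sym_boundary_steps by (intro sym_Un)

text \<open>A path of vertex-disks joined by ribbons lifts to a walk on corners, since all corners
  of a disk lie on one circle; conversely each move stays on a disk or crosses a ribbon. Disks
  without ribbons are components of their own.\<close>

lemma card_components:
  "num_components G = card (isolated_verts G) + card ((\<lambda>c. (surface_steps G)\<^sup>* `` {c}) ` corners G)"
proof -
  define J where "J = {(disk_at G c, disk_at G (along_free_side c)) | c. c \<in> corners G}"
  let ?T = "surface_steps G"
  let ?cls = "\<lambda>c. ?T\<^sup>* `` {c}"
  have free: "side_step (edges G) c = along_free_side c" if "c \<in> corners G" for c
    using that by (simp add: side_step_def in_corners_iff)
  have TC: "c' \<in> corners G" if "(c, c') \<in> ?T\<^sup>*" "c \<in> corners G" for c c'
    using that by (induction rule: rtrancl_induct) (auto simp: surface_steps_def boundary_steps_iff arc_closed)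
  have mono: "(boundary_steps G {})\<^sup>* \<subseteq> ?T\<^sup>*"
    by (rule rtrancl_mono) (auto simp: surface_steps_def)
  have J1: "\<exists>c'. (c, c') \<in> ?T\<^sup>* \<and> w = disk_at G c'" if "(disk_at G c, w) \<in> J\<^sup>*" "c \<in> corners G" for c w
    using that
  proof (induction rule: rtrancl_induct)
    case (step y z)
    then obtain c' where c': "(c, c') \<in> ?T\<^sup>*" "y = disk_at G c'" by blast
    obtain c'' where c'': "c'' \<in> corners G" "y = disk_at G c''" "z = disk_at G (along_free_side c'')"
      using step.hyps(2) by (auto simp: J_def simp del: split_paired_Ex)
    have on_disk: "(c', c'') \<in> (boundary_steps G {})\<^sup>*"
      using disk_at_eq_iff[OF TC[OF c'(1) step.prems] c''(1)] c'(2) c''(2) by simp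
    have "(c'', along_free_side c'') \<in> ?T"
      using c''(1) free[OF c''(1)] by (simp add: surface_steps_def boundary_steps_iff)
    with rtrancl_trans[OF c'(1) subsetD[OF mono on_disk]] have "(c, along_free_side c'') \<in> ?T\<^sup>*"
      by (rule rtrancl_into_rtrancl)
    then show ?case using c''(3) by blast
  qed blast
  have J2: "(disk_at G c, disk_at G c') \<in> J\<^sup>*" if "(c, c') \<in> ?T\<^sup>*" "c \<in> corners G" for c c'
    using that
  proof (induction rule: rtrancl_induct)
    case (step y z)
    have y: "y \<in> corners G" using TC[OF step.hyps(1) step.prems] .
    have z: "z \<in> corners G" using TC[OF rtrancl_into_rtrancl[OF step.hyps] step.prems] .
    from step.hyps(2) consider "(y, z) \<in> boundary_steps G {}" | "(y, z) \<in> boundary_steps G (edges G)"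
      by (auto simp: surface_steps_def)
    then have "(disk_at G y, disk_at G z) \<in> J\<^sup>*"
    proof cases
      case 1
      then have "disk_at G y = disk_at G z" using disk_at_eq_iff[OF y z] by auto
      then show ?thesis by simp
    next
      case 2
      then consider "z = arc G y" | "z = along_free_side y" using free[OF y] by (auto simp: boundary_steps_iff)
      then show ?thesis
      proof cases
        case 1
        then have "(y, z) \<in> boundary_steps G {}" using y by (simp add: boundary_steps_iff)
        then have "disk_at G y = disk_at G z" using disk_at_eq_iff[OF y z] by auto
        then show ?thesis by simp
      next
        case 2
        then have "(disk_at G y, disk_at G z) \<in> J" using y unfolding J_def by blast
        then show ?thesis by blast
      qed
    qed
    with step.IH[OF step.prems] show ?case by (rule rtrancl_trans)
  qed auto
  have cls1: "J\<^sup>* `` {v} = {v}" if "v \<in> isolated_verts G" for v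
  proof -
    have "w = v" if "(v, w) \<in> J\<^sup>*" for w
      using that
    proof (cases rule: converse_rtranclE)
      case (step y)
      then have "v \<in> disk_at G ` corners G" by (auto simp: J_def)
      then show ?thesis using \<open>v \<in> isolated_verts G\<close> by (simp add: isolated_verts_def)
    qed auto
    then show ?thesis by auto
  qed
  have cls2: "J\<^sup>* `` {disk_at G c} = disk_at G ` ?cls c" if "c \<in> corners G" for c
    using J1 J2 that by blast
  have V: "verts G = isolated_verts G \<union> disk_at G ` corners G"
    using disk_at_closed by (auto simp: isolated_verts_def)
  have "components G = (\<lambda>v. J\<^sup>* `` {v}) ` verts G"
    unfolding components_def J_def[symmetric] by (auto simp: quotient_def)
  also have "\<dots> = (\<lambda>v. J\<^sup>* `` {v}) ` isolated_verts G \<union> (\<lambda>c. J\<^sup>* `` {disk_at G c}) ` corners G"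
    by (subst V) (simp only: image_Un image_image)
  also have "\<dots> = (\<lambda>v. {v}) ` isolated_verts G \<union> (`) (disk_at G) ` ?cls ` corners G"
    using cls1 cls2 by (simp add: image_image cong: image_cong)
  finally have comp: "components G = (\<lambda>v. {v}) ` isolated_verts G \<union> (`) (disk_at G) ` ?cls ` corners G" .
  have disj: "(\<lambda>v. {v}) ` isolated_verts G \<inter> (`) (disk_at G) ` ?cls ` corners G = {}"
  proof (rule equals0I)
    fix X assume "X \<in> (\<lambda>v. {v}) ` isolated_verts G \<inter> (`) (disk_at G) ` ?cls ` corners G"
    then obtain v c where v: "v \<in> isolated_verts G" "X = {v}" and c: "c \<in> corners G" "X = disk_at G ` ?cls c"
      by blast
    have "c \<in> ?cls c" by simp
    then have "disk_at G c = v" using v(2) c(2) by blast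
    then show False using v(1) c(1) by (auto simp: isolated_verts_def)
  qed
  have clseq: "?cls x = ?cls y" if "(x, y) \<in> ?T\<^sup>*" for x y
    using that symD[OF sym_rtrancl[OF sym_surface_steps] that] by (auto intro: rtrancl_trans)
  \<comment> \<open>A class is determined by its disks because corners of the same disk belong to
    the same class.\<close>
  have inj: "inj_on ((`) (disk_at G)) (?cls ` corners G)"
  proof (rule inj_onI)
    fix X Y assume "X \<in> ?cls ` corners G" "Y \<in> ?cls ` corners G" and eq: "disk_at G ` X = disk_at G ` Y"
    then obtain x y where x: "x \<in> corners G" "X = ?cls x" and y: "y \<in> corners G" "Y = ?cls y" by blast
    have "disk_at G x \<in> disk_at G ` X" using x(2) by blast
    then obtain y' where y': "y' \<in> Y" "disk_at G x = disk_at G y'" using eq by auto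
    then have "y' \<in> corners G" using TC y by blast
    then have "(x, y') \<in> (boundary_steps G {})\<^sup>*" using disk_at_eq_iff[OF x(1)] y'(2) by blast
    then have "?cls x = ?cls y'" using clseq mono by blast
    moreover have "?cls y = ?cls y'" using clseq y' y(2) by blast
    ultimately show "X = Y" using x(2) y(2) by simp
  qed
  have fin: "finite (isolated_verts G)" using finite_verts by (simp add: isolated_verts_def)
  show ?thesis
    unfolding num_components_def comp
    using fin finite_corners
    by (subst card_Un_disjoint[OF _ _ disj]) (simp_all add: card_image[OF inj] card_image)
qed

lemma partial_dual_isolated_verts: "isolated_verts (partial_dual G A) = Inl ` isolated_verts G"
proof -
  have "disk_at (partial_dual G A) ` corners G = Inr ` circle_of G A ` corners G"
  proof -
    have "dual_corner A ` corners G = corners G"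
    proof (intro equalityI subsetI)
      fix c assume "c \<in> corners G"
      then have "dual_corner A c \<in> corners G" by simp
      then have "dual_corner A (dual_corner A c) \<in> dual_corner A ` corners G" by (rule imageI)
      then show "c \<in> dual_corner A ` corners G" by simp
    qed auto
    then have "(\<lambda>c. Inr (circle_of G A c)) ` dual_corner A ` corners G = (\<lambda>c. Inr (circle_of G A c)) ` corners G"
      by simp
    then show ?thesis by (simp add: image_image)
  qed
  moreover have "corners G // (boundary_steps G A)\<^sup>* = circle_of G A ` corners G"
    by (auto simp: quotient_def)
  ultimately show ?thesis
    unfolding isolated_verts_def corners_partial_dual
    by (auto simp: face_disks_def isolated_verts_def)
qed

text \<open>Makes the counts of components and face-disks available for the dual. The vertex-disk
  condition is the boundary correspondence for the empty subgraph.\<close>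

lemma ribbon_graph_partial_dual: "ribbon_graph (partial_dual G A)"
proof
  show "finite (verts (partial_dual G A))" "finite (edges (partial_dual G A))"
    using finite_face_disks finite_edges by simp_all
  fix c assume "c \<in> corners (partial_dual G A)"
  then have c: "dual_corner A c \<in> corners G" by simp
  show "arc (partial_dual G A) c \<in> corners (partial_dual G A)"
    using arc_closed[OF c] by simp
  show "arc (partial_dual G A) (arc (partial_dual G A) c) = c"
    using arc_arc[OF c] by simp
  show "arc (partial_dual G A) c \<noteq> c"
    using arc_neq[OF c] by (metis dual_corner_dual_corner partial_dual_simps(3))
  show "disk_at (partial_dual G A) c \<in> verts (partial_dual G A)"
    using c unfolding partial_dual_simps Inr_face_disks_iff by blast
  fix c' assume "c' \<in> corners (partial_dual G A)"
  have "disk_at (partial_dual G A) c = disk_at (partial_dual G A) c' \<longleftrightarrow>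
      circle_of G A (dual_corner A c') = circle_of G A (dual_corner A c)"
    unfolding partial_dual_simps sum.inject by (rule eq_commute)
  also have "\<dots> \<longleftrightarrow> dual_corner A c' \<in> circle_of G A (dual_corner A c)"
    by (rule circle_of_eq_iff)
  also have "\<dots> \<longleftrightarrow> (c, c') \<in> (boundary_steps (partial_dual G A) {})\<^sup>*"
    using rtrancl_conjugate[OF boundary_steps_partial_dual[of _ _ G A "{}"] dual_corner_dual_corner, of c c'] by simp
  finally show "disk_at (partial_dual G A) c = disk_at (partial_dual G A) c' \<longleftrightarrow>
      (c, c') \<in> (boundary_steps (partial_dual G A) {})\<^sup>*" .
qed

text \<open>The vertices of the dual are the circles of \<open>A\<close> by construction; its
  boundary corresponds to the symmetric difference of \<open>A\<close> with all edges, which is the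
  complement; ribbons and the number of components do not change.\<close>

theorem euler_genus_partial_dual:
  assumes "A \<subseteq> edges G"
  shows "euler_genus (partial_dual G A) = 2 * int (num_components G) + int (card (edges G))
    - int (card (face_disks G A)) - int (card (face_disks G (edges G - A)))"
proof -
  let ?H = "partial_dual G A"
  interpret H: ribbon_graph ?H by (rule ribbon_graph_partial_dual)
  have iso: "card (isolated_verts ?H) = card (isolated_verts G)"
    by (simp add: partial_dual_isolated_verts card_image)
  have "num_components ?H = num_components G"
    unfolding H.card_components card_components iso corners_partial_dual
    using card_classes_conjugate[OF surface_steps_partial_dual dual_corner_dual_corner dual_corner_in_corners]
    by simp
  moreover have "card (face_disks ?H (edges ?H)) = card (face_disks G (edges G - A))"
  proof -
    have "boundary_steps G (sym_diff A (edges ?H)) = boundary_steps G (edges G - A)"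
      by (rule boundary_steps_cong) auto
    then have "card (circle_of ?H (edges ?H) ` corners G) = card (circle_of G (edges G - A) ` corners G)"
      using card_classes_conjugate[OF boundary_steps_partial_dual[of _ _ G A "edges ?H"]
        dual_corner_dual_corner dual_corner_in_corners[of A _ G]] by simp
    then show ?thesis
      unfolding H.card_face_disks card_face_disks iso corners_partial_dual by simp
  qed
  ultimately show ?thesis
    unfolding euler_genus_def by simp
qed

end


section \<open>Recovering the polynomials\<close>

definition trinomial_step :: "(int \<Rightarrow> nat) \<Rightarrow> int \<Rightarrow> nat" where
  "trinomial_step g s = g (s - 1) + g s + g (s + 1)"

text \<open>The coefficients of the n-th power of q + 1 + q^-1; \<open>trinomial_step\<close> is
  multiplication by this factor.\<close>

definition trinomial :: "nat \<Rightarrow> int \<Rightarrow> nat" where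
  "trinomial n = (trinomial_step ^^ n) (\<lambda>s. of_bool (s = 0))"

lemma trinomial_Suc: "trinomial (Suc n) s = trinomial n (s - 1) + trinomial n s + trinomial n (s + 1)"
  by (simp add: trinomial_def trinomial_step_def)

lemma trinomial_eq_0: "int n < s \<Longrightarrow> trinomial n s = 0"
proof (induction n arbitrary: s)
  case 0
  then show ?case by (simp add: trinomial_def)
qed (simp add: trinomial_Suc)

lemma trinomial_self: "trinomial n (int n) = 1"
proof (induction n)
  case 0
  then show ?case by (simp add: trinomial_def)
qed (simp add: trinomial_Suc trinomial_eq_0)

text \<open>Each circle has one basis vector in each of the degrees 1, 0 and -1, hence contributes
  one trinomial step. The weighted set \<open>Q\<close> stands for the remaining tensor factors, so
  that applying the lemma twice covers the V- and W-parts together.\<close>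

lemma card_M_power_basis_times:
  fixes X :: "('a, 'b) circle set" and w :: "'q \<Rightarrow> int"
  assumes "finite X" "finite Q"
  shows "card {(\<phi>, q). \<phi> \<in> M_power_basis X \<and> q \<in> Q \<and> M_power_deg X \<phi> + w q = s} =
    (trinomial_step ^^ card X) (\<lambda>s. card {q \<in> Q. w q = s}) s"
  using assms(1)
proof (induction X arbitrary: s)
  case empty
  have "{(\<phi>, q). \<phi> \<in> M_power_basis ({} :: ('a, 'b) circle set) \<and> q \<in> Q \<and> M_power_deg {} \<phi> + w q = s} =
      Pair (\<lambda>_. undefined) ` {q \<in> Q. w q = s}"
    by (auto simp: M_power_basis_def M_power_deg_def)
  then show ?case by (simp add: card_image inj_on_def)
next
  case (insert c X)
  define S where "S s = {(\<phi>, q). \<phi> \<in> M_power_basis X \<and> q \<in> Q \<and> M_power_deg X \<phi> + w q = s}" for s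
  define ext where "ext t p = ((fst p)(c := t), snd p)" for t :: nat and p :: "(('a, 'b) circle \<Rightarrow> nat) \<times> 'q"
  have S_sub: "S s \<subseteq> M_power_basis X \<times> Q" for s by (auto simp: S_def)
  have fin: "finite (S s)" for s
    using finite_subset[OF S_sub] finite_M_power_basis[OF insert.hyps(1)] assms(2) by blast
  have deg: "M_power_deg (insert c X) (\<phi>(c := t)) = 1 - int t + M_power_deg X \<phi>" for \<phi> t
  proof -
    have "(\<Sum>d\<in>X. 1 - int ((\<phi>(c := t)) d)) = (\<Sum>d\<in>X. 1 - int (\<phi> d))"
      using insert.hyps(2) by (intro sum.cong) auto
    then show ?thesis using insert.hyps by (simp add: M_power_deg_def)
  qed
  \<comment> \<open>Split by the exponent \<open>t\<close> at the new circle, which contributes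
    degree 1 - t.\<close>
  have "{(\<phi>, q). \<phi> \<in> M_power_basis (insert c X) \<and> q \<in> Q \<and> M_power_deg (insert c X) \<phi> + w q = s} =
      (\<Union>t\<in>{..2}. ext t ` S (s - (1 - int t)))" (is "?L = ?R")
  proof (intro equalityI subsetI)
    fix p assume "p \<in> ?L"
    then obtain \<phi> q where p: "p = (\<phi>, q)" "\<phi> \<in> M_power_basis (insert c X)" "q \<in> Q"
      "M_power_deg (insert c X) \<phi> + w q = s" by blast
    from p(2) obtain t \<phi>' where \<phi>: "t \<in> {..2}" "\<phi>' \<in> M_power_basis X" "\<phi> = \<phi>'(c := t)"
      by (auto simp: M_power_basis_def PiE_insert_eq)
    then have "(\<phi>', q) \<in> S (s - (1 - int t))" using p(3,4) deg by (auto simp: S_def)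
    moreover have "p = ext t (\<phi>', q)" by (simp add: ext_def p(1) \<phi>(3))
    ultimately show "p \<in> ?R" using \<phi>(1) by blast
  next
    fix p assume "p \<in> ?R"
    then obtain t \<phi>' q where t: "t \<in> {..2}" "(\<phi>', q) \<in> S (s - (1 - int t))" "p = ext t (\<phi>', q)" by auto
    then have "\<phi>'(c := t) \<in> M_power_basis (insert c X)"
      by (auto simp: S_def M_power_basis_def PiE_insert_eq)
    then show "p \<in> ?L" using t deg by (auto simp: S_def ext_def)
  qed
  moreover have "card ?R = (\<Sum>t\<in>{..2}. card (ext t ` S (s - (1 - int t))))"
  proof (rule card_UN_disjoint)
    show "\<forall>t\<in>{..2}. \<forall>t'\<in>{..2}. t \<noteq> t' \<longrightarrow> ext t ` S (s - (1 - int t)) \<inter> ext t' ` S (s - (1 - int t')) = {}"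
    proof (intro ballI impI equals0I)
      fix t t' p assume "t \<noteq> t'" "p \<in> ext t ` S (s - (1 - int t)) \<inter> ext t' ` S (s - (1 - int t'))"
      moreover have "fst (ext t x) c = t" for t x by (simp add: ext_def)
      ultimately show False by (metis IntD1 IntD2 imageE)
    qed
  qed (use fin in auto)
  moreover have "card (ext t ` S s) = card (S s)" for t s
  proof (rule card_image, rule inj_onI)
    fix p p' assume p: "p \<in> S s" "p' \<in> S s" and eq: "ext t p = ext t p'"
    have c: "fst p c = undefined" "fst p' c = undefined"
      using p insert.hyps(2) by (auto simp: S_def M_power_basis_def PiE_iff extensional_def)
    have "(fst p)(c := t) = (fst p')(c := t)" using eq by (simp add: ext_def)
    then have "fst p = fst p'" using c by (metis fun_upd_triv fun_upd_upd)
    then show "p = p'" using eq by (simp add: ext_def prod_eq_iff)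
  qed
  moreover have "{..2::nat} = {0, 1, 2}" by auto
  ultimately show ?case
    using insert.hyps by (simp add: insert.IH[folded S_def] trinomial_step_def)
qed

lemma card_M_power_basis_pairs:
  fixes X Y :: "('e, 'v) circle set"
  assumes "finite X" "finite Y"
  shows "card {(\<phi>, \<psi>). \<phi> \<in> M_power_basis X \<and> \<psi> \<in> M_power_basis Y \<and>
      M_power_deg X \<phi> + M_power_deg Y \<psi> = s} = trinomial (card X + card Y) s"
proof -
  have "card {\<psi> \<in> M_power_basis Y. M_power_deg Y \<psi> = s} = trinomial (card Y) s" for s
  proof -
    have "{(\<psi>, q). \<psi> \<in> M_power_basis Y \<and> q \<in> {()} \<and> M_power_deg Y \<psi> + 0 = s} =
        (\<lambda>\<psi>. (\<psi>, ())) ` {\<psi> \<in> M_power_basis Y. M_power_deg Y \<psi> = s}" by auto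
    moreover have "card {q \<in> {()}. (0::int) = s} = of_bool (s = 0)" for s by (cases "s = 0") auto
    ultimately show ?thesis
      using card_M_power_basis_times[OF assms(2), of "{()}" "\<lambda>_. 0" s]
      by (simp add: trinomial_def card_image inj_on_def)
  qed
  then show ?thesis
    using card_M_power_basis_times[OF assms(1) finite_M_power_basis[OF assms(2)], of "M_power_deg Y" s]
    by (simp add: trinomial_def funpow_add)
qed

text \<open>Basis of the degree m part of the j-th tensor power of \<open>N\<close>. Its size is the
  coefficient of p^m in (1 + p)^j; explicit values are needed only for m \<ge> j.\<close>

definition exponent_lists :: "nat \<Rightarrow> int \<Rightarrow> nat list set" where
  "exponent_lists j m = {l. length l = j \<and> set l \<subseteq> {..1} \<and> int (sum_list l) = m}"

lemma sum_list_le_length: "set l \<subseteq> {..1::nat} \<Longrightarrow> sum_list l \<le> length l"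
  by (induction l) auto

lemma exponent_lists_eq_empty: "int j < m \<Longrightarrow> exponent_lists j m = {}"
  using sum_list_le_length by (fastforce simp: exponent_lists_def)

lemma exponent_lists_self: "exponent_lists j (int j) = {replicate j 1}"
proof -
  have "l = replicate (length l) 1" if "set l \<subseteq> {..1}" "sum_list l = length l" for l :: "nat list"
    using that
  proof (induction l)
    case (Cons a l)
    then have "a = 1" "sum_list l = length l" using sum_list_le_length[of l] by auto
    then show ?case using Cons by simp
  qed simp
  then show ?thesis by (auto simp: exponent_lists_def sum_list_replicate)
qed

text \<open>Coefficient of p^m q^k in the product of the j-th power of - (1 + p) q^2 and the f-th
  power of q + 1 + q^-1.\<close>

definition character_coeff :: "nat \<times> nat \<Rightarrow> int \<times> int \<Rightarrow> int" where
  "character_coeff = (\<lambda>(j, f) (m, k).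
     (- 1) ^ j * int (card (exponent_lists j m)) * int (trinomial f (k - 2 * int j)))"

definition character :: "(nat \<times> nat) multiset \<Rightarrow> int \<times> int \<Rightarrow> int" where
  "character M mk = (\<Sum>p\<in>#M. character_coeff p mk)"

text \<open>
  Each pair \<open>(j, f)\<close> has the leading monomial \<open>p\<^sup>j q\<^bsup>2 j + f\<^esup>\<close>, so that the characters are
  triangular with respect to the lexicographic order.
\<close>

lemma character_coeff_leading:
  assumes "j' < j \<or> j' = j \<and> f' \<le> f"
  shows "character_coeff (j', f') (int j, int f + 2 * int j) = (if (j', f') = (j, f) then (- 1) ^ j else 0)"
  using assms exponent_lists_eq_empty[of j' "int j"] trinomial_eq_0[of f' "int f"]
  by (auto simp: character_coeff_def exponent_lists_self trinomial_self)

text \<open>Smaller pairs do not reach the leading monomial of \<open>(j, f)\<close>, so the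
  coefficient there reads off a multiplicity.\<close>

lemma character_leading:
  assumes "\<And>j' f'. (j', f') \<in># M \<Longrightarrow> j' < j \<or> j' = j \<and> f' \<le> f"
  shows "character M (int j, int f + 2 * int j) = (- 1) ^ j * int (count M (j, f))"
  using assms
proof (induction M)
  case (add p M)
  obtain j' f' where p: "p = (j', f')" by (cases p)
  show ?case
    using add.IH add.prems character_coeff_leading[of j' j f' f]
    by (auto simp: character_def p algebra_simps)
qed (simp add: character_def)

text \<open>After the common part is removed, two disjoint multisets with equal characters remain.
  The largest pair occurring belongs to only one of them, yet its leading coefficient gives its
  multiplicity in both.\<close>

lemma character_inject:
  assumes "character M = character M'"
  shows "M = M'"
proof (rule ccontr)
  assume ne: "M \<noteq> M'"
  define A B where "A = M - M'" and "B = M' - M"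
  have M: "M = M \<inter># M' + A" "M' = M \<inter># M' + B"
    by (auto simp: A_def B_def multiset_eq_iff min_def)
  have "character A mk = character B mk" for mk
    using arg_cong[OF M(1), of "\<lambda>M. character M mk"] arg_cong[OF M(2), of "\<lambda>M. character M mk"]
      fun_cong[OF assms, of mk]
    by (simp add: character_def)
  moreover have nonempty: "A + B \<noteq> {#}" using ne M by auto
  \<comment> \<open>The lexicographic maximum is taken over both multisets together, so that
    \<open>character_leading\<close> applies to each.\<close>
  define j where "j = Max (fst ` set_mset (A + B))"
  define f where "f = Max {f. (j, f) \<in># A + B}"
  have "j \<in> fst ` set_mset (A + B)" unfolding j_def using nonempty by (intro Max_in) auto
  then have j: "{f. (j, f) \<in># A + B} \<noteq> {}" by force
  have fin: "finite {f. (j, f) \<in># A + B}"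
    by (rule finite_subset[of _ "snd ` set_mset (A + B)"]) force+
  have jf: "(j, f) \<in># A + B" unfolding f_def using Max_in[OF fin j] by blast
  have max: "j' < j \<or> j' = j \<and> f' \<le> f" if p: "(j', f') \<in># A + B" for j' f'
  proof -
    have "j' \<le> j" unfolding j_def using p by (intro Max_ge) force+
    moreover have "f' \<le> f" if "j' = j" unfolding f_def using fin p that by (intro Max_ge) auto
    ultimately show ?thesis by auto
  qed
  have "character A (int j, int f + 2 * int j) = (- 1) ^ j * int (count A (j, f))"
    "character B (int j, int f + 2 * int j) = (- 1) ^ j * int (count B (j, f))"
    using max by (auto intro!: character_leading)
  ultimately have "count A (j, f) = count B (j, f)" by simp
  moreover have "count A (j, f) = 0 \<or> count B (j, f) = 0" by (auto simp: A_def B_def)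
  moreover have "count A (j, f) + count B (j, f) > 0" using jf by (metis count_union count_greater_zero_iff)
  ultimately show False by auto
qed

section \<open>Edge subsets and the Euler characteristic\<close>

definition subset_data :: "('e, 'v) rgraph \<Rightarrow> 'e set \<Rightarrow> nat \<times> nat" where
  "subset_data G A = (card A, card (face_disks G A) + card (face_disks G (edges G - A)))"

definition subset_data_mset :: "('e, 'v) rgraph \<Rightarrow> (nat \<times> nat) multiset" where
  "subset_data_mset G = image_mset (subset_data G) (mset_set (Pow (edges G)))"

lemma sum_subset_data: "(\<Sum>A\<in>Pow (edges G). h (subset_data G A)) = (\<Sum>p\<in>#subset_data_mset G. h p)"
  by (simp add: subset_data_mset_def sum_unfold_sum_mset multiset.map_comp comp_def)

context ordered_ribbon_graph
begin

lemma card_homogeneous_basis: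
  "card {b \<in> basis K A. bideg K A b = (m, k)} =
    card (exponent_lists (card A) m) * trinomial (snd (subset_data G A)) k"
proof -
  let ?P = "{(\<phi>, \<psi>). \<phi> \<in> M_power_basis (face_disks G A) \<and> \<psi> \<in> M_power_basis (face_disks G (edges G - A)) \<and>
      M_power_deg (face_disks G A) \<phi> + M_power_deg (face_disks G (edges G - A)) \<psi> = k}"
  have "{b \<in> basis K A. bideg K A b = (m, k)} =
      (\<lambda>(l, \<phi>, \<psi>). ((((), l), \<phi>), \<psi>)) ` (exponent_lists (card A) m \<times> ?P)"
    unfolding basis_pd_cube exponent_lists_def by (auto simp: bideg_pd_cube image_iff)
  moreover have "inj_on (\<lambda>(l, \<phi>, \<psi>). ((((), l), \<phi>), \<psi>)) (exponent_lists (card A) m \<times> ?P)"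
    by (auto intro!: inj_onI)
  ultimately have "card {b \<in> basis K A. bideg K A b = (m, k)} = card (exponent_lists (card A) m \<times> ?P)"
    by (simp only: card_image)
  then show ?thesis
    by (simp add: card_cartesian_product card_M_power_basis_pairs finite_face_disks subset_data_def)
qed

lemma card_generators_sum:
  "card (generators i (m, k)) = (\<Sum>A | A \<in> Pow (edges G) \<and> card A = i.
    card (exponent_lists (card A) m) * trinomial (snd (subset_data G A)) (k - 2 * int (card A)))"
proof -
  have "generators i (m, k) = Sigma {A. A \<in> Pow (edges G) \<and> card A = i}
      (\<lambda>A. {b \<in> basis K A. bideg K A b = (m, k - 2 * int (card A))})"
    by (auto simp: generators_def)
  then show ?thesis
    using finite_edges finite_basis by (simp add: card_homogeneous_basis)
qed

lemma graded_euler_char_eq_character: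
  "Poly_Mapping.lookup (graded_euler_char G es) = character (subset_data_mset G)"
proof
  fix mk :: "int \<times> int"
  obtain m k where mk: "mk = (m, k)" by (cases mk)
  have "Poly_Mapping.lookup (graded_euler_char G es) mk = (\<Sum>i\<le>card (edges G).
      \<Sum>A | A \<in> Pow (edges G) \<and> card A = i. character_coeff (subset_data G A) (m, k))"
    unfolding lookup_graded_euler_char mk card_generators_sum of_nat_sum sum_distrib_left
    by (intro sum.cong refl) (auto simp: character_coeff_def subset_data_def mult.assoc)
  also have "\<dots> = (\<Sum>A\<in>Pow (edges G). character_coeff (subset_data G A) (m, k))"
    using finite_edges by (intro sum.group) (auto intro: card_mono)
  also have "\<dots> = character (subset_data_mset G) mk"
    unfolding character_def mk by (rule sum_subset_data)
  finally show "Poly_Mapping.lookup (graded_euler_char G es) mk = character (subset_data_mset G) mk" .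
qed

end

text \<open>A mere choice suffices: by \<open>character_inject\<close> at most one multiset has the
  given character.\<close>

definition recovered_data :: "laurent2 \<Rightarrow> (nat \<times> nat) multiset" where
  "recovered_data \<chi> = (SOME M. character M = Poly_Mapping.lookup \<chi>)"

lemma (in ordered_ribbon_graph) recovered_data:
  "recovered_data (graded_euler_char G es) = subset_data_mset G"
  unfolding recovered_data_def graded_euler_char_eq_character
  by (rule some_equality) (auto intro: character_inject)

text \<open>For the multiset of a ribbon graph the maximum is the number of edges, attained at the
  full edge set; \<open>c\<close> stands for the number of components.\<close>

definition recovered_genus :: "nat \<Rightarrow> (nat \<times> nat) multiset \<Rightarrow> nat \<times> nat \<Rightarrow> int" where
  "recovered_genus c M p = 2 * int c + int (Max (fst ` set_mset M)) - int (snd p)"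

context ribbon_graph
begin

lemma recovered_genus:
  assumes "A \<subseteq> edges G"
  shows "recovered_genus (num_components G) (subset_data_mset G) (subset_data G A) =
    euler_genus (partial_dual G A)"
proof -
  have "fst ` set_mset (subset_data_mset G) = card ` Pow (edges G)"
    using finite_edges by (simp add: subset_data_mset_def subset_data_def image_image)
  moreover have "Max (card ` Pow (edges G)) = card (edges G)"
    using finite_edges by (intro Max_eqI) (auto intro: card_mono)
  ultimately show ?thesis
    unfolding recovered_genus_def euler_genus_partial_dual[OF assms] by (simp add: subset_data_def)
qed

lemma graded_pd_genus_poly_eq:
  "graded_pd_genus_poly G = (\<Sum>p\<in>#subset_data_mset G. Poly_Mapping.single
    (int (fst p), recovered_genus (num_components G) (subset_data_mset G) p) 1)"
proof -
  have "graded_pd_genus_poly G = (\<Sum>A\<in>Pow (edges G). Poly_Mapping.single (int (fst (subset_data G A)),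
      recovered_genus (num_components G) (subset_data_mset G) (subset_data G A)) 1)"
    unfolding graded_pd_genus_poly_def
    by (intro sum.cong refl) (simp add: recovered_genus, simp add: subset_data_def)
  also have "\<dots> = (\<Sum>p\<in>#subset_data_mset G. Poly_Mapping.single
    (int (fst p), recovered_genus (num_components G) (subset_data_mset G) p) 1)"
    by (rule sum_subset_data)
  finally show ?thesis .
qed

lemma pd_genus_poly_eq:
  "pd_genus_poly G = (\<Sum>p\<in>#subset_data_mset G. Poly_Mapping.single
    (recovered_genus (num_components G) (subset_data_mset G) p) 1)"
proof -
  have "pd_genus_poly G = (\<Sum>A\<in>Pow (edges G). Poly_Mapping.single
      (recovered_genus (num_components G) (subset_data_mset G) (subset_data G A)) 1)"
    unfolding pd_genus_poly_def by (intro sum.cong refl) (simp add: recovered_genus)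
  also have "\<dots> = (\<Sum>p\<in>#subset_data_mset G. Poly_Mapping.single
    (recovered_genus (num_components G) (subset_data_mset G) p) 1)"
    by (rule sum_subset_data)
  finally show ?thesis .
qed

end

theorem corollary5p4:
  shows "\<exists>(recover_graded :: nat \<Rightarrow> laurent2 \<Rightarrow> laurent2) (recover :: nat \<Rightarrow> laurent2 \<Rightarrow> laurent1).
    \<forall>(G :: ('e, 'v) rgraph) es. ribbon_graph G \<longrightarrow> edge_ordering G es \<longrightarrow>
      recover_graded (num_components G) (graded_euler_char G es) = graded_pd_genus_poly G \<and>
      recover (num_components G) (graded_euler_char G es) = pd_genus_poly G"
proof (intro exI allI impI)
  fix G :: "('e, 'v) rgraph" and es
  assume "ribbon_graph G" "edge_ordering G es"
  then interpret ordered_ribbon_graph G es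
    by (simp add: ordered_ribbon_graph_def ordered_ribbon_graph_axioms_def)
  show "(\<lambda>c \<chi>. \<Sum>p\<in>#recovered_data \<chi>. Poly_Mapping.single
        (int (fst p), recovered_genus c (recovered_data \<chi>) p) 1)
        (num_components G) (graded_euler_char G es) = graded_pd_genus_poly G \<and>
      (\<lambda>c \<chi>. \<Sum>p\<in>#recovered_data \<chi>. Poly_Mapping.single (recovered_genus c (recovered_data \<chi>) p) 1)
        (num_components G) (graded_euler_char G es) = pd_genus_poly G"
    by (simp add: recovered_data graded_pd_genus_poly_eq pd_genus_poly_eq)
qed

end
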